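(* (i) The system $\mathsf{RCA}_0^\omega+\mathsf{BOOT}$ proves $\mathsf{NCC}$. (ii) The system $\mathsf{RCA}_0^\omega$ proves $\mathsf{QF\text{-}AC}^{0,1}\rightarrow\mathsf{NCC}\rightarrow\Delta\text{-}\mathsf{CA}$.
   Context: $\mathsf{RCA}_0^\omega$ is Kohlenbach's base theory of higher-order reverse mathematics: a theory in the language of all finite types, with constants $0,1,<,+,\times,=_0$, combinators and Gödel's recursors; axioms: ordered semiring axioms, combinator axioms, defining axioms of the recursor $\mathbf R_0$, extensionality at all finite types, quantifier-free induction, and $\mathsf{QF\text{-}AC}^{1,0}$. $\mathsf{QF\text{-}AC}^{0,1}$: for every quantifier-free formula $A$, $(\forall n^0)(\exists f^1)A(n,f)\to(\exists F^{0\to1})(\forall n^0)A(n,F(n))$. $\mathsf{NCC}$: for every $Y^2$, with $A(n,m)\equiv(\exists f\in 2^{\mathbb N})(Y(f,m,n)=0)$, if $(\forall n)(\exists m)A(n,m)$ then $(\exists g^1)(\forall n)A(n,g(n))$. $\mathsf{BOOT}$: for every $Y^2$ there is $X\subseteq\mathbb N$ with $(\forall n)(n\in X\leftrightarrow(\exists f\in\mathbb N^{\mathbb N})(Y(f,n)=0))$. $\Delta\text{-}\mathsf{CA}$: for all $Y^2,Z^2$, if $(\forall n^0)[(\exists f^1)(Y(f,n)=0)\leftrightarrow(\forall g^1)(Z(g,n)=0)]$, then there is $X^1$ with $(\forall n^0)(n\in X\leftrightarrow(\exists f^1)(Y(f,n)=0))$. *)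

theory Defs
  imports Main
begin

section \<open>The language of all finite types\<close>

datatype ty = T0 | Fn ty ty  (infixr "\<rightarrow>" 60)

abbreviation T1 :: ty where "T1 \<equiv> T0 \<rightarrow> T0"

text \<open>
  The recursor constant \<open>Rec \<rho>\<close> belongs to the language for every \<open>\<rho>\<close>, but the theory below
  has a defining axiom only for \<open>Rec T0\<close>.
\<close>

datatype cnst =
    Zero | One | Plus | Times
  | Pi ty ty
  | Sigma ty ty ty
  | Rec ty

primrec cnst_ty :: "cnst \<Rightarrow> ty" where
  "cnst_ty Zero = T0"
| "cnst_ty One = T0"
| "cnst_ty Plus = T0 \<rightarrow> T0 \<rightarrow> T0"
| "cnst_ty Times = T0 \<rightarrow> T0 \<rightarrow> T0"
| "cnst_ty (Pi \<rho> \<tau>) = \<rho> \<rightarrow> \<tau> \<rightarrow> \<rho>"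
| "cnst_ty (Sigma \<rho> \<sigma> \<tau>) = (\<rho> \<rightarrow> \<sigma> \<rightarrow> \<tau>) \<rightarrow> (\<rho> \<rightarrow> \<sigma>) \<rightarrow> \<rho> \<rightarrow> \<tau>"
| "cnst_ty (Rec \<rho>) = (T0 \<rightarrow> \<rho> \<rightarrow> \<rho>) \<rightarrow> \<rho> \<rightarrow> T0 \<rightarrow> \<rho>"

text \<open>
  Variables are de Bruijn indices, counted separately for each type: \<open>Var \<sigma> k\<close> refers to the
  \<open>k\<close>-th enclosing quantifier of type \<open>\<sigma>\<close> (innermost first, quantifiers of other types being
  skipped), and to a free variable of type \<open>\<sigma>\<close> if there are at most \<open>k\<close> such quantifiers.
\<close>

datatype tm = Var ty nat | Con cnst | App tm tm  (infixl "\<cdot>" 90)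

primrec has_type :: "tm \<Rightarrow> ty \<Rightarrow> bool" where
  "has_type (Var \<sigma> k) \<tau> \<longleftrightarrow> \<tau> = \<sigma>"
| "has_type (Con c) \<tau> \<longleftrightarrow> \<tau> = cnst_ty c"
| "has_type (s \<cdot> t) \<tau> \<longleftrightarrow> (\<exists>\<sigma>. has_type s (\<sigma> \<rightarrow> \<tau>) \<and> has_type t \<sigma>)"

text \<open>Prime formulas are equations and inequalities between terms of type \<open>T0\<close> only.\<close>

datatype fm =
    Eq tm tm  (infix "\<^bold>=" 55)
  | Less tm tm  (infix "\<^bold><" 55)
  | Falsum
  | Conj fm fm  (infixr "\<^bold>\<and>" 53)
  | Disj fm fm  (infixr "\<^bold>\<or>" 52)
  | Impl fm fm  (infixr "\<^bold>\<longrightarrow>" 51)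
  | Forall ty fm
  | Exists ty fm

abbreviation Iff :: "fm \<Rightarrow> fm \<Rightarrow> fm"  (infix "\<^bold>\<longleftrightarrow>" 50)
  where "A \<^bold>\<longleftrightarrow> B \<equiv> (A \<^bold>\<longrightarrow> B) \<^bold>\<and> (B \<^bold>\<longrightarrow> A)"

abbreviation Neg :: "fm \<Rightarrow> fm" where "Neg A \<equiv> A \<^bold>\<longrightarrow> Falsum"

primrec wf_fm :: "fm \<Rightarrow> bool" where
  "wf_fm (s \<^bold>= t) \<longleftrightarrow> has_type s T0 \<and> has_type t T0"
| "wf_fm (s \<^bold>< t) \<longleftrightarrow> has_type s T0 \<and> has_type t T0"
| "wf_fm Falsum \<longleftrightarrow> True"
| "wf_fm (A \<^bold>\<and> B) \<longleftrightarrow> wf_fm A \<and> wf_fm B"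
| "wf_fm (A \<^bold>\<or> B) \<longleftrightarrow> wf_fm A \<and> wf_fm B"
| "wf_fm (A \<^bold>\<longrightarrow> B) \<longleftrightarrow> wf_fm A \<and> wf_fm B"
| "wf_fm (Forall \<sigma> A) \<longleftrightarrow> wf_fm A"
| "wf_fm (Exists \<sigma> A) \<longleftrightarrow> wf_fm A"

primrec qfree :: "fm \<Rightarrow> bool" where
  "qfree (s \<^bold>= t) \<longleftrightarrow> True"
| "qfree (s \<^bold>< t) \<longleftrightarrow> True"
| "qfree Falsum \<longleftrightarrow> True"
| "qfree (A \<^bold>\<and> B) \<longleftrightarrow> qfree A \<and> qfree B"
| "qfree (A \<^bold>\<or> B) \<longleftrightarrow> qfree A \<and> qfree B"
| "qfree (A \<^bold>\<longrightarrow> B) \<longleftrightarrow> qfree A \<and> qfree B"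
| "qfree (Forall \<sigma> A) \<longleftrightarrow> False"
| "qfree (Exists \<sigma> A) \<longleftrightarrow> False"

text \<open>
  \<open>lift \<sigma> k\<close> makes room for a new variable \<open>Var \<sigma> k\<close>; \<open>subst \<sigma> k u\<close> replaces \<open>Var \<sigma> k\<close>
  by \<open>u\<close> and closes the gap.
\<close>

primrec lift_tm :: "ty \<Rightarrow> nat \<Rightarrow> tm \<Rightarrow> tm" where
  "lift_tm \<sigma> k (Var \<tau> i) = Var \<tau> (if \<tau> = \<sigma> \<and> k \<le> i then Suc i else i)"
| "lift_tm \<sigma> k (Con c) = Con c"
| "lift_tm \<sigma> k (s \<cdot> t) = lift_tm \<sigma> k s \<cdot> lift_tm \<sigma> k t"

primrec lift :: "ty \<Rightarrow> nat \<Rightarrow> fm \<Rightarrow> fm" where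
  "lift \<sigma> k (s \<^bold>= t) = (lift_tm \<sigma> k s \<^bold>= lift_tm \<sigma> k t)"
| "lift \<sigma> k (s \<^bold>< t) = (lift_tm \<sigma> k s \<^bold>< lift_tm \<sigma> k t)"
| "lift \<sigma> k Falsum = Falsum"
| "lift \<sigma> k (A \<^bold>\<and> B) = (lift \<sigma> k A \<^bold>\<and> lift \<sigma> k B)"
| "lift \<sigma> k (A \<^bold>\<or> B) = (lift \<sigma> k A \<^bold>\<or> lift \<sigma> k B)"
| "lift \<sigma> k (A \<^bold>\<longrightarrow> B) = (lift \<sigma> k A \<^bold>\<longrightarrow> lift \<sigma> k B)"
| "lift \<sigma> k (Forall \<tau> A) = Forall \<tau> (lift \<sigma> (if \<tau> = \<sigma> then Suc k else k) A)"
| "lift \<sigma> k (Exists \<tau> A) = Exists \<tau> (lift \<sigma> (if \<tau> = \<sigma> then Suc k else k) A)"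

primrec subst_tm :: "ty \<Rightarrow> nat \<Rightarrow> tm \<Rightarrow> tm \<Rightarrow> tm" where
  "subst_tm \<sigma> k u (Var \<tau> i) =
     (if \<tau> \<noteq> \<sigma> \<or> i < k then Var \<tau> i else if i = k then u else Var \<tau> (i - 1))"
| "subst_tm \<sigma> k u (Con c) = Con c"
| "subst_tm \<sigma> k u (s \<cdot> t) = subst_tm \<sigma> k u s \<cdot> subst_tm \<sigma> k u t"

primrec subst :: "ty \<Rightarrow> nat \<Rightarrow> tm \<Rightarrow> fm \<Rightarrow> fm" where
  "subst \<sigma> k u (s \<^bold>= t) = (subst_tm \<sigma> k u s \<^bold>= subst_tm \<sigma> k u t)"
| "subst \<sigma> k u (s \<^bold>< t) = (subst_tm \<sigma> k u s \<^bold>< subst_tm \<sigma> k u t)"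
| "subst \<sigma> k u Falsum = Falsum"
| "subst \<sigma> k u (A \<^bold>\<and> B) = (subst \<sigma> k u A \<^bold>\<and> subst \<sigma> k u B)"
| "subst \<sigma> k u (A \<^bold>\<or> B) = (subst \<sigma> k u A \<^bold>\<or> subst \<sigma> k u B)"
| "subst \<sigma> k u (A \<^bold>\<longrightarrow> B) = (subst \<sigma> k u A \<^bold>\<longrightarrow> subst \<sigma> k u B)"
| "subst \<sigma> k u (Forall \<tau> A) =
     Forall \<tau> (subst \<sigma> (if \<tau> = \<sigma> then Suc k else k) (lift_tm \<tau> 0 u) A)"
| "subst \<sigma> k u (Exists \<tau> A) =
     Exists \<tau> (subst \<sigma> (if \<tau> = \<sigma> then Suc k else k) (lift_tm \<tau> 0 u) A)"


section \<open>Provability\<close>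

text \<open>
  Natural deduction for classical many-sorted first-order logic with equality at type \<open>T0\<close>.
  \<open>T\<close> is the set of axioms of a theory, \<open>\<Gamma>\<close> the set of open assumptions. Free variables of
  members of \<open>T\<close> are read as universally quantified: the eigenvariable conditions of
  \<open>ForallI\<close> and \<open>ExistsE\<close>, expressed by lifting, concern \<open>\<Gamma>\<close> but not \<open>T\<close>.
\<close>

inductive proves :: "fm set \<Rightarrow> fm set \<Rightarrow> fm \<Rightarrow> bool"  ("_; _ \<turnstile> _" [50, 50, 50] 49)
  for T :: "fm set"
where
  Axiom: "A \<in> T \<Longrightarrow> wf_fm A \<Longrightarrow> T; \<Gamma> \<turnstile> A"
| Assumption: "A \<in> \<Gamma> \<Longrightarrow> wf_fm A \<Longrightarrow> T; \<Gamma> \<turnstile> A"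
| ConjI: "T; \<Gamma> \<turnstile> A \<Longrightarrow> T; \<Gamma> \<turnstile> B \<Longrightarrow> T; \<Gamma> \<turnstile> A \<^bold>\<and> B"
| ConjE1: "T; \<Gamma> \<turnstile> A \<^bold>\<and> B \<Longrightarrow> T; \<Gamma> \<turnstile> A"
| ConjE2: "T; \<Gamma> \<turnstile> A \<^bold>\<and> B \<Longrightarrow> T; \<Gamma> \<turnstile> B"
| DisjI1: "T; \<Gamma> \<turnstile> A \<Longrightarrow> wf_fm B \<Longrightarrow> T; \<Gamma> \<turnstile> A \<^bold>\<or> B"
| DisjI2: "T; \<Gamma> \<turnstile> B \<Longrightarrow> wf_fm A \<Longrightarrow> T; \<Gamma> \<turnstile> A \<^bold>\<or> B"
| DisjE: "T; \<Gamma> \<turnstile> A \<^bold>\<or> B \<Longrightarrow> T; insert A \<Gamma> \<turnstile> C \<Longrightarrow> T; insert B \<Gamma> \<turnstile> C \<Longrightarrow> T; \<Gamma> \<turnstile> C"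
| ImplI: "T; insert A \<Gamma> \<turnstile> B \<Longrightarrow> wf_fm A \<Longrightarrow> T; \<Gamma> \<turnstile> A \<^bold>\<longrightarrow> B"
| ImplE: "T; \<Gamma> \<turnstile> A \<^bold>\<longrightarrow> B \<Longrightarrow> T; \<Gamma> \<turnstile> A \<Longrightarrow> T; \<Gamma> \<turnstile> B"
| Classical: "T; insert (Neg A) \<Gamma> \<turnstile> Falsum \<Longrightarrow> wf_fm A \<Longrightarrow> T; \<Gamma> \<turnstile> A"
| ForallI: "T; lift \<sigma> 0 ` \<Gamma> \<turnstile> A \<Longrightarrow> T; \<Gamma> \<turnstile> Forall \<sigma> A"
| ForallE: "T; \<Gamma> \<turnstile> Forall \<sigma> A \<Longrightarrow> has_type t \<sigma> \<Longrightarrow> T; \<Gamma> \<turnstile> subst \<sigma> 0 t A"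
| ExistsI: "T; \<Gamma> \<turnstile> subst \<sigma> 0 t A \<Longrightarrow> has_type t \<sigma> \<Longrightarrow> wf_fm A \<Longrightarrow> T; \<Gamma> \<turnstile> Exists \<sigma> A"
| ExistsE: "T; \<Gamma> \<turnstile> Exists \<sigma> A \<Longrightarrow> T; insert A (lift \<sigma> 0 ` \<Gamma>) \<turnstile> lift \<sigma> 0 C \<Longrightarrow> T; \<Gamma> \<turnstile> C"
| EqRefl: "has_type t T0 \<Longrightarrow> T; \<Gamma> \<turnstile> t \<^bold>= t"
| EqSubst: "T; \<Gamma> \<turnstile> s \<^bold>= t \<Longrightarrow> T; \<Gamma> \<turnstile> subst T0 0 s A \<Longrightarrow> wf_fm A \<Longrightarrow> T; \<Gamma> \<turnstile> subst T0 0 t A"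


section \<open>The base theory\<close>

abbreviation zero :: tm where "zero \<equiv> Con Zero"
abbreviation one :: tm where "one \<equiv> Con One"
abbreviation add :: "tm \<Rightarrow> tm \<Rightarrow> tm"  (infixl "\<^bold>+" 65)
  where "s \<^bold>+ t \<equiv> Con Plus \<cdot> s \<cdot> t"
abbreviation mul :: "tm \<Rightarrow> tm \<Rightarrow> tm"  (infixl "\<^bold>*" 70)
  where "s \<^bold>* t \<equiv> Con Times \<cdot> s \<cdot> t"

text \<open>Equality at higher types is the usual extensional abbreviation.\<close>

primrec eq_at :: "ty \<Rightarrow> tm \<Rightarrow> tm \<Rightarrow> fm" where
  "eq_at T0 s t = (s \<^bold>= t)"
| "eq_at (\<sigma> \<rightarrow> \<tau>) s t =
     Forall \<sigma> (eq_at \<tau> (lift_tm \<sigma> 0 s \<cdot> Var \<sigma> 0) (lift_tm \<sigma> 0 t \<cdot> Var \<sigma> 0))"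

text \<open>Discretely ordered commutative semirings.\<close>

definition arith_axioms :: "fm set" where
  "arith_axioms =
    (let x = Var T0 0; y = Var T0 1; z = Var T0 2;
         all1 = Forall T0; all2 = (\<lambda>A. Forall T0 (Forall T0 A));
         all3 = (\<lambda>A. Forall T0 (Forall T0 (Forall T0 A)))
     in {all3 ((x \<^bold>+ y) \<^bold>+ z \<^bold>= x \<^bold>+ (y \<^bold>+ z)),
         all2 (x \<^bold>+ y \<^bold>= y \<^bold>+ x),
         all1 (x \<^bold>+ zero \<^bold>= x),
         all3 ((x \<^bold>* y) \<^bold>* z \<^bold>= x \<^bold>* (y \<^bold>* z)),
         all2 (x \<^bold>* y \<^bold>= y \<^bold>* x),
         all1 (x \<^bold>* one \<^bold>= x),
         all1 (x \<^bold>* zero \<^bold>= zero),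
         all3 (x \<^bold>* (y \<^bold>+ z) \<^bold>= x \<^bold>* y \<^bold>+ x \<^bold>* z),
         all1 (Neg (x \<^bold>< x)),
         all3 (x \<^bold>< y \<^bold>\<and> y \<^bold>< z \<^bold>\<longrightarrow> x \<^bold>< z),
         all2 (x \<^bold>< y \<^bold>\<or> x \<^bold>= y \<^bold>\<or> y \<^bold>< x),
         all3 (x \<^bold>< y \<^bold>\<longrightarrow> x \<^bold>+ z \<^bold>< y \<^bold>+ z),
         all3 (x \<^bold>< y \<^bold>\<and> zero \<^bold>< z \<^bold>\<longrightarrow> x \<^bold>* z \<^bold>< y \<^bold>* z),
         zero \<^bold>< one,
         all1 (x \<^bold>= zero \<^bold>\<or> zero \<^bold>< x),
         all1 (zero \<^bold>< x \<^bold>\<longrightarrow> x \<^bold>= one \<^bold>\<or> one \<^bold>< x)})"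

definition Pi_axiom :: "ty \<Rightarrow> ty \<Rightarrow> fm" where
  "Pi_axiom \<rho> \<tau> =
    (let x = (if \<rho> = \<tau> then Var \<rho> 1 else Var \<rho> 0); y = Var \<tau> 0
     in Forall \<rho> (Forall \<tau> (eq_at \<rho> (Con (Pi \<rho> \<tau>) \<cdot> x \<cdot> y) x)))"

text \<open>The types of \<open>x\<close>, \<open>y\<close> and \<open>z\<close> below are pairwise distinct.\<close>

definition Sigma_axiom :: "ty \<Rightarrow> ty \<Rightarrow> ty \<Rightarrow> fm" where
  "Sigma_axiom \<rho> \<sigma> \<tau> =
    (let x = Var (\<rho> \<rightarrow> \<sigma> \<rightarrow> \<tau>) 0; y = Var (\<rho> \<rightarrow> \<sigma>) 0; z = Var \<rho> 0
     in Forall (\<rho> \<rightarrow> \<sigma> \<rightarrow> \<tau>) (Forall (\<rho> \<rightarrow> \<sigma>) (Forall \<rho>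
          (eq_at \<tau> (Con (Sigma \<rho> \<sigma> \<tau>) \<cdot> x \<cdot> y \<cdot> z) (x \<cdot> z \<cdot> (y \<cdot> z))))))"

definition Rec_axioms :: "fm set" where
  "Rec_axioms =
    (let f = Var (T0 \<rightarrow> T0 \<rightarrow> T0) 0; m = Var T0 1; n = Var T0 0; R = Con (Rec T0);
         all3 = (\<lambda>A. Forall (T0 \<rightarrow> T0 \<rightarrow> T0) (Forall T0 (Forall T0 A)))
     in {all3 (R \<cdot> f \<cdot> m \<cdot> zero \<^bold>= m),
         all3 (R \<cdot> f \<cdot> m \<cdot> (n \<^bold>+ one) \<^bold>= f \<cdot> n \<cdot> (R \<cdot> f \<cdot> m \<cdot> n))})"

definition ext_axiom :: "ty \<Rightarrow> ty \<Rightarrow> fm" where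
  "ext_axiom \<rho> \<tau> =
    (let x = Var \<rho> 1; y = Var \<rho> 0; \<phi> = Var (\<rho> \<rightarrow> \<tau>) 0
     in Forall \<rho> (Forall \<rho> (Forall (\<rho> \<rightarrow> \<tau>)
          (eq_at \<rho> x y \<^bold>\<longrightarrow> eq_at \<tau> (\<phi> \<cdot> x) (\<phi> \<cdot> y)))))"

text \<open>In \<open>A\<close>, the induction variable is \<open>Var T0 0\<close>; all others are parameters.\<close>

definition induction_axiom :: "fm \<Rightarrow> fm" where
  "induction_axiom A =
    (subst T0 0 zero A \<^bold>\<and> Forall T0 (A \<^bold>\<longrightarrow> subst T0 0 (Var T0 0 \<^bold>+ one) (lift T0 1 A))
      \<^bold>\<longrightarrow> Forall T0 A)"

text \<open>
  \<open>(\<forall>x\<^sup>\<sigma>)(\<exists>y\<^sup>\<tau>) A(x,y) \<longrightarrow> (\<exists>F)(\<forall>x\<^sup>\<sigma>) A(x,F(x))\<close>. In \<open>A\<close>, the variable \<open>y\<close> is \<open>Var \<tau> 0\<close>, and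
  \<open>x\<close> is \<open>Var \<sigma> 0\<close> (\<open>Var \<sigma> 1\<close> if \<open>\<sigma> = \<tau>\<close>). As \<open>\<sigma> \<rightarrow> \<tau>\<close> differs from \<open>\<sigma>\<close> and \<open>\<tau>\<close>, room for
  \<open>F\<close> is made at index \<open>0\<close>.
\<close>

definition choice_axiom :: "ty \<Rightarrow> ty \<Rightarrow> fm \<Rightarrow> fm" where
  "choice_axiom \<sigma> \<tau> A =
    (Forall \<sigma> (Exists \<tau> A) \<^bold>\<longrightarrow>
     Exists (\<sigma> \<rightarrow> \<tau>) (Forall \<sigma>
       (subst \<tau> 0 (Var (\<sigma> \<rightarrow> \<tau>) 0 \<cdot> Var \<sigma> 0) (lift (\<sigma> \<rightarrow> \<tau>) 0 A))))"

definition QF_AC :: "ty \<Rightarrow> ty \<Rightarrow> fm set" where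
  "QF_AC \<sigma> \<tau> = {choice_axiom \<sigma> \<tau> A |A. qfree A \<and> wf_fm A}"

definition RCA0_omega :: "fm set" where
  "RCA0_omega =
     arith_axioms
     \<union> {Pi_axiom \<rho> \<tau> |\<rho> \<tau>. True}
     \<union> {Sigma_axiom \<rho> \<sigma> \<tau> |\<rho> \<sigma> \<tau>. True}
     \<union> Rec_axioms
     \<union> {ext_axiom \<rho> \<tau> |\<rho> \<tau>. True}
     \<union> {induction_axiom A |A. qfree A \<and> wf_fm A}
     \<union> QF_AC T1 T0"


section \<open>The principles\<close>

text \<open>Sets of numbers are given by characteristic functions, with \<open>n \<in> X\<close> meaning \<open>X(n) = 1\<close>.
  Type 2 functionals \<open>Y(f,n)\<close>, \<open>Y(f,m,n)\<close> with number arguments are curried.\<close>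

definition binary :: "tm \<Rightarrow> fm" where
  "binary f = (let k = Var T0 0; f' = lift_tm T0 0 f
               in Forall T0 (f' \<cdot> k \<^bold>= zero \<^bold>\<or> f' \<cdot> k \<^bold>= one))"

definition mem :: "tm \<Rightarrow> tm \<Rightarrow> fm" where
  "mem n X = (X \<cdot> n \<^bold>= one)"

text \<open>\<open>NCC_matrix Y n m\<close> is \<open>(\<exists>f \<in> 2\<^sup>\<nat>)(Y(f,m,n) = 0)\<close>.\<close>

definition NCC_matrix :: "tm \<Rightarrow> tm \<Rightarrow> tm \<Rightarrow> fm" where
  "NCC_matrix Y n m =
    (let f = Var T1 0
     in Exists T1 (binary f \<^bold>\<and>
          lift_tm T1 0 Y \<cdot> f \<cdot> lift_tm T1 0 m \<cdot> lift_tm T1 0 n \<^bold>= zero))"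

definition NCC :: fm where
  "NCC =
    (let Y = Var (T1 \<rightarrow> T0 \<rightarrow> T0 \<rightarrow> T0) 0
     in Forall (T1 \<rightarrow> T0 \<rightarrow> T0 \<rightarrow> T0)
          (Forall T0 (Exists T0 (NCC_matrix Y (Var T0 1) (Var T0 0)))
           \<^bold>\<longrightarrow> Exists T1 (Forall T0 (NCC_matrix Y (Var T0 0) (Var T1 0 \<cdot> Var T0 0)))))"

definition BOOT :: fm where
  "BOOT =
    (let Y = Var (T1 \<rightarrow> T0 \<rightarrow> T0) 0; n = Var T0 0
     in Forall (T1 \<rightarrow> T0 \<rightarrow> T0) (Exists T1
          (binary (Var T1 0) \<^bold>\<and>
           Forall T0 (mem n (Var T1 0) \<^bold>\<longleftrightarrow> Exists T1 (Y \<cdot> Var T1 0 \<cdot> n \<^bold>= zero)))))"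

definition Delta_CA :: fm where
  "Delta_CA =
    (let Y = Var (T1 \<rightarrow> T0 \<rightarrow> T0) 1; Z = Var (T1 \<rightarrow> T0 \<rightarrow> T0) 0; n = Var T0 0
     in Forall (T1 \<rightarrow> T0 \<rightarrow> T0) (Forall (T1 \<rightarrow> T0 \<rightarrow> T0)
          (Forall T0 (Exists T1 (Y \<cdot> Var T1 0 \<cdot> n \<^bold>= zero)
                      \<^bold>\<longleftrightarrow> Forall T1 (Z \<cdot> Var T1 0 \<cdot> n \<^bold>= zero))
           \<^bold>\<longrightarrow> Exists T1
                (binary (Var T1 0) \<^bold>\<and>
                 Forall T0 (mem n (Var T1 0) \<^bold>\<longleftrightarrow> Exists T1 (Y \<cdot> Var T1 0 \<cdot> n \<^bold>= zero))))))"

end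

theory Submission
  imports Defs "HOL-Library.Countable"
begin

text \<open>By a Henkin completeness theorem, whose models satisfy extensionality as a genuine equality,
  each of the three claims reduces to an argument about an arbitrary model.

  \<open>BOOT\<close> gives the set of codes of the pairs \<open>(n, m)\<close> with \<open>A(n,m)\<close>, and \<open>QF-AC\<^sup>0\<^sup>,\<^sup>0\<close>, a consequence
  of \<open>QF-AC\<^sup>1\<^sup>,\<^sup>0\<close>, chooses from it. \<open>QF-AC\<^sup>0\<^sup>,\<^sup>1\<close> directly chooses \<open>m\<close> together with a witness \<open>f\<close>.

  For \<open>\<Delta>-CA\<close>, apply \<open>NCC\<close> to "\<open>m\<close> is even and \<open>Y(f,n) = 0\<close>, or \<open>m\<close> is odd and \<open>Z(f,n) \<noteq> 0\<close>", with
  \<open>f\<close> decoded from a binary function. No total functional decodes all of Baire space from Cantor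
  space in general, so distinguish two cases. If \<open>\<exists>\<^sup>2\<close> exists, it makes the search through a graph
  total. Otherwise Grilliot's trick shows that every type 2 functional with a zero has a bounded
  zero, and functions bounded by \<open>m\<close> are found in their graph by bounded search.\<close>

section \<open>Simultaneous substitution\<close>

text \<open>The numbers of a model may be nonstandard. Every induction inside it must therefore be
  given as an equation F(n) = 0 for a functional F of the model, and every functional must be built
  from combinators, the recursor of type 0 and choice. Existential claims are made quantifier-free
  by naming their witnesses before induction is applied.

  What \<open>NCC\<close> returns is a number only, not the binary function that witnesses it, so
  this number must carry everything that is read off later. In the argument for
  \<open>Delta_CA\<close> it has two duties: where \<exists>^2 is absent it bounds the searches of
  the decoder, and its parity is the decision. The duties are compatible because a bound may be
  raised by one; hence decoding is required to succeed at two consecutive numbers.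

  The case distinction on \<exists>^2 is a classical split inside one model. Both cases deliver a
  decoder with the same specification, so the rest of the argument is uniform.\<close>

definition scons :: "ty \<Rightarrow> 'b \<Rightarrow> (ty \<Rightarrow> nat \<Rightarrow> 'b) \<Rightarrow> ty \<Rightarrow> nat \<Rightarrow> 'b" where
  "scons \<sigma> u s = (\<lambda>\<tau> i. if \<tau> = \<sigma> then (case i of 0 \<Rightarrow> u | Suc j \<Rightarrow> s \<sigma> j) else s \<tau> i)"

definition up :: "ty \<Rightarrow> (ty \<Rightarrow> nat \<Rightarrow> tm) \<Rightarrow> ty \<Rightarrow> nat \<Rightarrow> tm" where
  "up \<sigma> s = scons \<sigma> (Var \<sigma> 0) (\<lambda>\<tau> i. lift_tm \<sigma> 0 (s \<tau> i))"

primrec ssub_tm :: "(ty \<Rightarrow> nat \<Rightarrow> tm) \<Rightarrow> tm \<Rightarrow> tm" where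
  "ssub_tm s (Var \<tau> i) = s \<tau> i"
| "ssub_tm s (Con c) = Con c"
| "ssub_tm s (t \<cdot> u) = ssub_tm s t \<cdot> ssub_tm s u"

primrec ssub :: "(ty \<Rightarrow> nat \<Rightarrow> tm) \<Rightarrow> fm \<Rightarrow> fm" where
  "ssub s (t \<^bold>= u) = (ssub_tm s t \<^bold>= ssub_tm s u)"
| "ssub s (t \<^bold>< u) = (ssub_tm s t \<^bold>< ssub_tm s u)"
| "ssub s Falsum = Falsum"
| "ssub s (A \<^bold>\<and> B) = (ssub s A \<^bold>\<and> ssub s B)"
| "ssub s (A \<^bold>\<or> B) = (ssub s A \<^bold>\<or> ssub s B)"
| "ssub s (A \<^bold>\<longrightarrow> B) = (ssub s A \<^bold>\<longrightarrow> ssub s B)"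
| "ssub s (Forall \<sigma> A) = Forall \<sigma> (ssub (up \<sigma> s) A)"
| "ssub s (Exists \<sigma> A) = Exists \<sigma> (ssub (up \<sigma> s) A)"

text \<open>\<open>scons\<close> is polymorphic in its values, because it extends substitutions and
  environments of a model alike. Only indices of type \<sigma> move, as indices are counted per
  type.\<close>

lemma scons_simps [simp]:
  "scons \<sigma> u s \<sigma> 0 = u"
  "scons \<sigma> u s \<sigma> (Suc j) = s \<sigma> j"
  "\<tau> \<noteq> \<sigma> \<Longrightarrow> scons \<sigma> u s \<tau> i = s \<tau> i"
  by (auto simp: scons_def)

text \<open>Lifting and single substitution are both instances of \<open>ssub\<close>, so all their
  commutation laws come from the one composition law \<open>ssub_comp\<close>.\<close>

lemma lift_tm_eq_ssub: "lift_tm \<sigma> k t = ssub_tm (\<lambda>\<tau> i. lift_tm \<sigma> k (Var \<tau> i)) t"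
  by (induction t) auto

lemma subst_tm_eq_ssub: "subst_tm \<sigma> k u t = ssub_tm (\<lambda>\<tau> i. subst_tm \<sigma> k u (Var \<tau> i)) t"
  by (induction t) auto

lemma up_lift:
  "up \<tau> (\<lambda>\<rho> i. lift_tm \<sigma> k (Var \<rho> i))
     = (\<lambda>\<rho> i. lift_tm \<sigma> (if \<tau> = \<sigma> then Suc k else k) (Var \<rho> i))"
  by (rule ext, rule ext) (auto simp: up_def scons_def split: nat.splits)

lemma up_subst:
  "up \<tau> (\<lambda>\<rho> i. subst_tm \<sigma> k u (Var \<rho> i))
     = (\<lambda>\<rho> i. subst_tm \<sigma> (if \<tau> = \<sigma> then Suc k else k) (lift_tm \<tau> 0 u) (Var \<rho> i))"
  by (rule ext, rule ext) (auto simp: up_def scons_def split: nat.splits)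

lemma lift_eq_ssub: "lift \<sigma> k A = ssub (\<lambda>\<tau> i. lift_tm \<sigma> k (Var \<tau> i)) A"
proof (induction A arbitrary: k)
  case (Forall \<tau> A)
  show ?case by (simp only: lift.simps ssub.simps up_lift Forall.IH)
next
  case (Exists \<tau> A)
  show ?case by (simp only: lift.simps ssub.simps up_lift Exists.IH)
qed (simp_all add: lift_tm_eq_ssub[symmetric] del: lift_tm.simps)

lemma subst_eq_ssub: "subst \<sigma> k u A = ssub (\<lambda>\<tau> i. subst_tm \<sigma> k u (Var \<tau> i)) A"
proof (induction A arbitrary: k u)
  case (Forall \<tau> A)
  show ?case by (simp only: subst.simps ssub.simps up_subst Forall.IH)
next
  case (Exists \<tau> A)
  show ?case by (simp only: subst.simps ssub.simps up_subst Exists.IH)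
qed (simp_all add: subst_tm_eq_ssub[symmetric] del: subst_tm.simps)

lemma subst0_var: "(\<lambda>\<tau> i. subst_tm \<sigma> 0 u (Var \<tau> i)) = scons \<sigma> u Var"
  by (rule ext, rule ext) (auto simp: scons_def split: nat.splits)

lemma ssub_tm_lift [simp]: "ssub_tm (scons \<sigma> u s) (lift_tm \<sigma> 0 t) = ssub_tm s t"
  by (induction t) auto

lemma lift_ssub_tm: "lift_tm \<sigma> k (ssub_tm s t) = ssub_tm (\<lambda>\<tau> i. lift_tm \<sigma> k (s \<tau> i)) t"
  by (induction t) auto

lemma ssub_tm_comp: "ssub_tm s (ssub_tm s' t) = ssub_tm (\<lambda>\<tau> i. ssub_tm s (s' \<tau> i)) t"
  by (induction t) auto

lemma up_lift_tm: "ssub_tm (up \<sigma> s) (lift_tm \<sigma> 0 t) = lift_tm \<sigma> 0 (ssub_tm s t)"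
  by (simp add: up_def lift_ssub_tm)

lemma ssub_tm_scons:
  "ssub_tm s (scons \<sigma> u s' \<tau> i) = scons \<sigma> (ssub_tm s u) (\<lambda>\<tau> i. ssub_tm s (s' \<tau> i)) \<tau> i"
  by (auto simp: scons_def split: nat.splits)

lemma up_comp: "(\<lambda>\<tau> i. ssub_tm (up \<sigma> s) (up \<sigma> s' \<tau> i)) = up \<sigma> (\<lambda>\<tau> i. ssub_tm s (s' \<tau> i))"
  by (rule ext, rule ext, unfold up_def[of _ s'] up_def[of _ "\<lambda>\<tau> i. ssub_tm s (s' \<tau> i)"],
      subst ssub_tm_scons, subst up_lift_tm) (simp add: up_def)

lemma ssub_comp: "ssub s (ssub s' A) = ssub (\<lambda>\<tau> i. ssub_tm s (s' \<tau> i)) A"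
  by (induction A arbitrary: s s') (simp_all add: ssub_tm_comp up_comp)

lemma ssub_tm_Var [simp]: "ssub_tm Var t = t"
  by (induction t) auto

lemma up_Var [simp]: "up \<sigma> Var = Var"
  by (rule ext, rule ext) (auto simp: up_def scons_def split: nat.splits)

lemma ssub_Var [simp]: "ssub Var A = A"
  by (induction A) auto

lemma scons_up:
  "(\<lambda>\<tau> i. ssub_tm (scons \<sigma> u Var) (up \<sigma> s \<tau> i)) = scons \<sigma> u s"
  by (rule ext, rule ext, unfold up_def, subst ssub_tm_scons) simp

text \<open>Instantiating a quantifier after a substitution has passed under it amounts to extending
  the substitution; the quantifier cases of the truth lemma need this shape.\<close>

lemma subst_ssub_up: "subst \<sigma> 0 u (ssub (up \<sigma> s) A) = ssub (scons \<sigma> u s) A"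
  by (simp only: subst_eq_ssub subst0_var ssub_comp scons_up)

lemma ssub_subst: "ssub s (subst \<sigma> 0 u A) = subst \<sigma> 0 (ssub_tm s u) (ssub (up \<sigma> s) A)"
proof -
  have "(\<lambda>\<tau> i. ssub_tm s (scons \<sigma> u Var \<tau> i)) = scons \<sigma> (ssub_tm s u) s"
    by (rule ext, rule ext, subst ssub_tm_scons) simp
  then show ?thesis
    by (simp only: subst_ssub_up) (simp only: subst_eq_ssub subst0_var ssub_comp)
qed

lemma ssub_lift: "ssub (up \<sigma> s) (lift \<sigma> 0 A) = lift \<sigma> 0 (ssub s A)"
proof -
  have "(\<lambda>\<tau> i. ssub_tm (up \<sigma> s) (lift_tm \<sigma> 0 (Var \<tau> i)))
      = (\<lambda>\<tau> i. ssub_tm (\<lambda>\<tau> i. lift_tm \<sigma> 0 (Var \<tau> i)) (s \<tau> i))"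
    by (simp only: up_lift_tm ssub_tm.simps lift_tm_eq_ssub[symmetric])
  then show ?thesis
    by (simp only: lift_eq_ssub ssub_comp)
qed

section \<open>Typing of substitutions and bounds on free variables\<close>

lemma has_type_unique: "has_type t \<sigma> \<Longrightarrow> has_type t \<tau> \<Longrightarrow> \<sigma> = \<tau>"
  by (induction t arbitrary: \<sigma> \<tau>) (simp, simp, metis has_type.simps(3) ty.inject)

lemma has_type_lift [simp]: "has_type (lift_tm \<sigma> k t) \<tau> = has_type t \<tau>"
  by (induction t arbitrary: \<tau>) auto

definition wt_sub :: "(ty \<Rightarrow> nat \<Rightarrow> tm) \<Rightarrow> bool" where
  "wt_sub s \<longleftrightarrow> (\<forall>\<sigma> i. has_type (s \<sigma> i) \<sigma>)"

lemma wt_sub_Var [simp]: "wt_sub Var"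
  by (simp add: wt_sub_def)

lemma wt_sub_scons [simp]: "has_type u \<sigma> \<Longrightarrow> wt_sub s \<Longrightarrow> wt_sub (scons \<sigma> u s)"
  by (auto simp: wt_sub_def scons_def split: nat.splits)

lemma wt_sub_up [simp]: "wt_sub s \<Longrightarrow> wt_sub (up \<sigma> s)"
  unfolding up_def by (rule wt_sub_scons) (auto simp: wt_sub_def)

lemma has_type_ssub: "wt_sub s \<Longrightarrow> has_type t \<tau> \<Longrightarrow> has_type (ssub_tm s t) \<tau>"
  by (induction t arbitrary: \<tau>) (auto simp: wt_sub_def)

lemma wf_ssub: "wt_sub s \<Longrightarrow> wf_fm A \<Longrightarrow> wf_fm (ssub s A)"
  by (induction A arbitrary: s) (auto simp: has_type_ssub)

lemma wf_subst: "has_type u \<sigma> \<Longrightarrow> wf_fm A \<Longrightarrow> wf_fm (subst \<sigma> 0 u A)"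
  by (simp only: subst_eq_ssub subst0_var) (simp add: wf_ssub)

lemma wf_lift: "wf_fm (lift \<sigma> k A) = wf_fm A"
  by (induction A arbitrary: k) auto

lemma ssub_eq_at: "ssub s (eq_at \<tau> a b) = eq_at \<tau> (ssub_tm s a) (ssub_tm s b)"
  by (induction \<tau> arbitrary: s a b) (simp_all add: up_lift_tm, simp add: up_def)

lemma wf_eq_at: "has_type a \<tau> \<Longrightarrow> has_type b \<tau> \<Longrightarrow> wf_fm (eq_at \<tau> a b)"
proof (induction \<tau> arbitrary: a b)
  case (Fn \<sigma> \<tau>)
  show ?case unfolding eq_at.simps wf_fm.simps
    by (rule Fn.IH) (use Fn.prems in auto)
qed simp

text \<open>Free variables are bounded through the action of substitutions. This avoids index
  arithmetic at binders, since \<open>up\<close> preserves agreement below N. For N = 0 it says that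
  the formula is a sentence.\<close>

definition fv_below :: "nat \<Rightarrow> fm \<Rightarrow> bool" where
  "fv_below N A \<longleftrightarrow> (\<forall>s s'. (\<forall>\<sigma>. \<forall>i<N. s \<sigma> i = s' \<sigma> i) \<longrightarrow> ssub s A = ssub s' A)"

lemma fv_belowD: "fv_below N A \<Longrightarrow> (\<And>\<sigma> i. i < N \<Longrightarrow> s \<sigma> i = s' \<sigma> i) \<Longrightarrow> ssub s A = ssub s' A"
  by (auto simp: fv_below_def)

lemma closed_ssub: "fv_below 0 A \<Longrightarrow> ssub s A = A"
  by (metis fv_belowD ssub_Var not_less_zero)

lemma ex_tm_bound: "\<exists>N. \<forall>s s'. (\<forall>\<sigma>. \<forall>i<N. s \<sigma> i = s' \<sigma> i) \<longrightarrow> ssub_tm s t = ssub_tm s' t"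
proof (induction t)
  case (App t u)
  then obtain N M where *:
    "\<forall>s s'. (\<forall>\<sigma>. \<forall>i<N. s \<sigma> i = s' \<sigma> i) \<longrightarrow> ssub_tm s t = ssub_tm s' t"
    "\<forall>s s'. (\<forall>\<sigma>. \<forall>i<M. s \<sigma> i = s' \<sigma> i) \<longrightarrow> ssub_tm s u = ssub_tm s' u" by blast
  show ?case
  proof (intro exI[of _ "max N M"] allI impI)
    fix s s' :: "ty \<Rightarrow> nat \<Rightarrow> tm" assume "\<forall>\<sigma>. \<forall>i<max N M. s \<sigma> i = s' \<sigma> i"
    then show "ssub_tm s (t \<cdot> u) = ssub_tm s' (t \<cdot> u)" using * by (simp add: less_max_iff_disj)
  qed
qed auto

lemma fv_below_mono: "fv_below N A \<Longrightarrow> N \<le> M \<Longrightarrow> fv_below M A"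
  by (auto simp: fv_below_def)

lemma up_agree: "\<forall>\<sigma>. \<forall>i<N. s \<sigma> i = s' \<sigma> i \<Longrightarrow> \<forall>\<sigma>. \<forall>i<N. up \<rho> s \<sigma> i = up \<rho> s' \<sigma> i"
  by (auto simp: up_def scons_def split: nat.splits)

lemma ex_tm_bound2:
  "\<exists>N. \<forall>s s'. (\<forall>\<sigma>. \<forall>i<N. s \<sigma> i = s' \<sigma> i)
    \<longrightarrow> ssub_tm s t = ssub_tm s' t \<and> ssub_tm s u = ssub_tm s' u"
  using ex_tm_bound[of "t \<cdot> u"] by simp

lemma ex_fv_below: "\<exists>N. fv_below N A"
proof (induction A)
  case (Eq t u)
  show ?case using ex_tm_bound2[of t u] by (simp add: fv_below_def)
next
  case (Less t u)
  show ?case using ex_tm_bound2[of t u] by (simp add: fv_below_def)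
next
  case Falsum
  show ?case by (simp add: fv_below_def)
next
  case (Conj A B)
  then obtain N where "fv_below N A" "fv_below N B"
    by (metis fv_below_mono nat_le_linear)
  then have "fv_below N (A \<^bold>\<and> B)" unfolding fv_below_def ssub.simps by blast
  then show ?case ..
next
  case (Disj A B)
  then obtain N where "fv_below N A" "fv_below N B"
    by (metis fv_below_mono nat_le_linear)
  then have "fv_below N (A \<^bold>\<or> B)" unfolding fv_below_def ssub.simps by blast
  then show ?case ..
next
  case (Impl A B)
  then obtain N where "fv_below N A" "fv_below N B"
    by (metis fv_below_mono nat_le_linear)
  then have "fv_below N (A \<^bold>\<longrightarrow> B)" unfolding fv_below_def ssub.simps by blast
  then show ?case ..
next
  case (Forall \<sigma> A)
  then obtain N where N: "fv_below N A" by blast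
  have "ssub (up \<sigma> s) A = ssub (up \<sigma> s') A" if "\<forall>\<sigma>. \<forall>i<N. s \<sigma> i = s' \<sigma> i" for s s'
    using up_agree[OF that] by (intro fv_belowD[OF N]) auto
  then show ?case unfolding fv_below_def ssub.simps by blast
next
  case (Exists \<sigma> A)
  then obtain N where N: "fv_below N A" by blast
  have "ssub (up \<sigma> s) A = ssub (up \<sigma> s') A" if "\<forall>\<sigma>. \<forall>i<N. s \<sigma> i = s' \<sigma> i" for s s'
    using up_agree[OF that] by (intro fv_belowD[OF N]) auto
  then show ?case unfolding fv_below_def ssub.simps by blast
qed

lemma ex_fv_below_finite: "finite G \<Longrightarrow> \<exists>N. \<forall>A\<in>G. fv_below N A"
proof (induction rule: finite_induct)
  case (insert A G)
  then obtain N where N: "\<forall>A\<in>G. fv_below N A" by blast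
  obtain M where M: "fv_below M A" using ex_fv_below by blast
  have "\<forall>B\<in>insert A G. fv_below (max N M) B"
    using N M by (metis fv_below_mono insert_iff max.cobounded1 max.cobounded2)
  then show ?case ..
qed simp


section \<open>Structural properties of provability\<close>

lemma proves_weaken: "T; \<Gamma> \<turnstile> A \<Longrightarrow> \<Gamma> \<subseteq> \<Delta> \<Longrightarrow> T; \<Delta> \<turnstile> A"
proof (induction arbitrary: \<Delta> rule: proves.induct)
  case (DisjE \<Gamma> A B C)
  then show ?case by (meson proves.DisjE insert_mono)
next
  case (ImplI A \<Gamma> B)
  then show ?case by (meson proves.ImplI insert_mono)
next
  case (Classical A \<Gamma>)
  then show ?case by (meson proves.Classical insert_mono)
next
  case (ForallI \<sigma> \<Gamma> A)
  then show ?case by (meson proves.ForallI image_mono)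
next
  case (ExistsE \<Gamma> \<sigma> A C)
  then show ?case by (meson proves.ExistsE image_mono insert_mono)
next
  case (EqSubst \<Gamma> s t A)
  then show ?case by (meson proves.EqSubst)
next
  case (ConjE1 \<Gamma> A B)
  then show ?case  by (metis proves.ConjE1)
next
  case (ConjE2 \<Gamma> A B)
  then show ?case  by (metis proves.ConjE2)
next
  case (ImplE \<Gamma> A B)
  then show ?case  by (metis proves.ImplE)
next
  case (ForallE \<Gamma> \<sigma> A t)
  then show ?case by (meson proves.ForallE)
qed (auto intro: proves.Axiom proves.Assumption proves.ConjI proves.DisjI1 proves.DisjI2
    proves.ExistsI proves.EqRefl subsetD)

lemma proves_wf: "T; \<Gamma> \<turnstile> A \<Longrightarrow> wf_fm A"
  by (induction rule: proves.induct) (auto simp: wf_subst wf_lift)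

text \<open>Derivability from no assumptions can be weakened to any context, and so replaces an
  axiom wherever it occurs, also below eigenvariable rules.\<close>

lemma proves_theory:
  assumes "T'; \<Gamma> \<turnstile> A" and "\<And>B. B \<in> T' \<Longrightarrow> wf_fm B \<Longrightarrow> T; {} \<turnstile> B"
  shows "T; \<Gamma> \<turnstile> A"
  using assms(1)
proof (induction rule: proves.induct)
  case (Axiom A \<Gamma>)
  then show ?case using assms(2) proves_weaken by blast
qed (rule proves.intros; assumption)+

text \<open>The axioms must be sentences: a substitution instance of an open axiom would in general
  not be an axiom. This is what later forces the passage to \<open>closed_base\<close>.\<close>

lemma proves_ssub:
  assumes "T; \<Gamma> \<turnstile> A" and T: "\<And>B. B \<in> T \<Longrightarrow> fv_below 0 B" and "wt_sub s"
  shows "T; ssub s ` \<Gamma> \<turnstile> ssub s A"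
  using assms(1,3)
proof (induction arbitrary: s rule: proves.induct)
  case (Axiom A \<Gamma>)
  then show ?case by (simp add: closed_ssub T proves.Axiom)
next
  case (ImplI A \<Gamma> B)
  then show ?case by (auto intro: proves.ImplI wf_ssub)
next
  case (DisjE \<Gamma> A B C)
  then show ?case by (auto intro: proves.DisjE)
next
  case (Classical A \<Gamma>)
  then show ?case by (auto intro: proves.Classical wf_ssub)
next
  case (ForallI \<sigma> \<Gamma> A)
  have "ssub (up \<sigma> s) ` lift \<sigma> 0 ` \<Gamma> = lift \<sigma> 0 ` ssub s ` \<Gamma>"
    by (simp add: image_image ssub_lift)
  then show ?case using ForallI.IH[of "up \<sigma> s"] ForallI.prems by (auto intro: proves.ForallI)
next
  case (ForallE \<Gamma> \<sigma> A t)
  then show ?case by (auto simp: ssub_subst intro: proves.ForallE has_type_ssub)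
next
  case (ExistsI \<Gamma> \<sigma> t A)
  then show ?case by (auto simp: ssub_subst intro!: proves.ExistsI has_type_ssub wf_ssub)
next
  case (ExistsE \<Gamma> \<sigma> A C)
  have "ssub (up \<sigma> s) ` insert A (lift \<sigma> 0 ` \<Gamma>)
      = insert (ssub (up \<sigma> s) A) (lift \<sigma> 0 ` ssub s ` \<Gamma>)"
    by (simp add: image_image ssub_lift)
  then show ?case
    using ExistsE.IH(1)[of s] ExistsE.IH(2)[of "up \<sigma> s"] ExistsE.prems
    by (auto simp: ssub_lift intro: proves.ExistsE)
next
  case (EqSubst \<Gamma> t u A)
  then show ?case unfolding ssub_subst
    by (metis proves.EqSubst ssub.simps(1) wf_ssub wt_sub_up)
next
  case (ConjE1 \<Gamma> A B)
  then show ?case  by (metis proves.ConjE1 ssub.simps)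
next
  case (ConjE2 \<Gamma> A B)
  then show ?case  by (metis proves.ConjE2 ssub.simps)
next
  case (ImplE \<Gamma> A B)
  then show ?case  by (metis proves.ImplE ssub.simps)
qed (auto intro: proves.Axiom proves.Assumption proves.ConjI proves.DisjI1 proves.DisjI2
    proves.ExistsI proves.EqRefl wf_ssub has_type_ssub)

lemma proves_cut:
  assumes "finite \<Gamma>" "T; \<Gamma> \<turnstile> A" "\<And>B. B \<in> \<Gamma> \<Longrightarrow> T; \<Delta> \<turnstile> B"
  shows "T; \<Delta> \<turnstile> A"
  using assms
proof (induction \<Gamma> arbitrary: A rule: finite_induct)
  case empty
  then show ?case using proves_weaken by blast
next
  case (insert B \<Gamma>)
  then have "T; \<Gamma> \<turnstile> B \<^bold>\<longrightarrow> A" by (meson insertI1 proves_wf proves.ImplI)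
  then have "T; \<Delta> \<turnstile> B \<^bold>\<longrightarrow> A" using insert by blast
  then show ?case using insert.prems(2) proves.ImplE by blast
qed

text \<open>Renaming \<open>Var \<sigma> k\<close> to the variable bound by the quantifier turns \<open>ExistsE\<close>, whose
  eigenvariable is index \<open>0\<close>, into the rule for a fresh named witness.\<close>

lemma fresh_witness:
  assumes "T; insert (subst \<sigma> 0 (Var \<sigma> k) A) \<Gamma> \<turnstile> Falsum"
    and T: "\<And>B. B \<in> T \<Longrightarrow> fv_below 0 B"
    and fresh: "fv_below k A" "\<And>B. B \<in> \<Gamma> \<Longrightarrow> fv_below k B"
    and ex: "T; \<Gamma> \<turnstile> Exists \<sigma> A"
  shows "T; \<Gamma> \<turnstile> Falsum"
proof -
  define s where "s = (\<lambda>\<tau> i. if \<tau> = \<sigma> \<and> i = k then Var \<sigma> 0 else lift_tm \<sigma> 0 (Var \<tau> i))"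
  have wt: "wt_sub s" by (simp add: wt_sub_def s_def)
  have lift_B: "ssub s B = lift \<sigma> 0 B" if "B \<in> \<Gamma>" for B
    unfolding lift_eq_ssub by (rule fv_belowD[OF fresh(2)[OF that]]) (simp add: s_def)
  have "ssub s (subst \<sigma> 0 (Var \<sigma> k) A) = ssub (scons \<sigma> (Var \<sigma> 0) s) A"
    unfolding ssub_subst subst_ssub_up by (simp add: s_def)
  also have "\<dots> = ssub (scons \<sigma> (Var \<sigma> 0) (\<lambda>\<tau> i. lift_tm \<sigma> 0 (Var \<tau> i))) A"
    by (rule fv_belowD[OF fresh(1)]) (auto simp: s_def scons_def split: nat.splits)
  also have "scons \<sigma> (Var \<sigma> 0) (\<lambda>\<tau> i. lift_tm \<sigma> 0 (Var \<tau> i)) = Var"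
    by (rule ext, rule ext) (auto simp: scons_def split: nat.splits)
  finally have A: "ssub s (subst \<sigma> 0 (Var \<sigma> k) A) = A" by simp
  have "T; ssub s ` insert (subst \<sigma> 0 (Var \<sigma> k) A) \<Gamma> \<turnstile> ssub s Falsum"
    by (rule proves_ssub[OF assms(1) T wt])
  moreover have "ssub s ` insert (subst \<sigma> 0 (Var \<sigma> k) A) \<Gamma> = insert A (lift \<sigma> 0 ` \<Gamma>)"
    using A lift_B by auto
  ultimately have "T; insert A (lift \<sigma> 0 ` \<Gamma>) \<turnstile> lift \<sigma> 0 Falsum" by simp
  then show ?thesis using ex proves.ExistsE by blast
qed

section \<open>Maximal consistent theories\<close>

instance ty :: countable by countable_datatype
instance cnst :: countable by countable_datatype
instance tm :: countable by countable_datatype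
instance fm :: countable by countable_datatype

text \<open>Henkin witnesses are supplied for existential formulas only; through this law a refuted
  universal formula obtains its counterexample as well.\<close>

lemma proves_Neg_Forall:
  assumes "wf_fm A"
  shows "T; {Neg (Forall \<sigma> A)} \<turnstile> Exists \<sigma> (Neg A)"
proof -
  let ?E = "Exists \<sigma> (Neg A)"
  let ?G = "{Neg A, lift \<sigma> 0 (Neg ?E), lift \<sigma> 0 (Neg (Forall \<sigma> A))}"
  \<comment> \<open>Under the new eigenvariable, the formula is recovered from the lifted body by
    instantiating it with that very variable.\<close>
  have "subst \<sigma> 0 (Var \<sigma> 0) (lift \<sigma> (Suc 0) (Neg A)) = Neg A"
  proof -
    have "(\<lambda>\<tau> i. ssub_tm (scons \<sigma> (Var \<sigma> 0) Var) (lift_tm \<sigma> (Suc 0) (Var \<tau> i))) = Var"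
      by (rule ext, rule ext) (auto simp: scons_def split: nat.splits)
    then show ?thesis by (simp only: subst_eq_ssub subst0_var lift_eq_ssub ssub_comp ssub_Var)
  qed
  then have "T; ?G \<turnstile> Exists \<sigma> (lift \<sigma> (Suc 0) (Neg A))"
    using assms by (intro proves.ExistsI[where t = "Var \<sigma> 0"] proves.Assumption)
      (auto simp: wf_lift)
  moreover have "T; ?G \<turnstile> lift \<sigma> 0 (Neg ?E)"
    using assms by (intro proves.Assumption) (auto simp: wf_lift)
  ultimately have "T; ?G \<turnstile> Falsum"
    using proves.ImplE[of T ?G "Exists \<sigma> (lift \<sigma> (Suc 0) (Neg A))" Falsum] by simp
  then have "T; lift \<sigma> 0 ` {Neg ?E, Neg (Forall \<sigma> A)} \<turnstile> A"
    using assms proves.Classical[of T A "lift \<sigma> 0 ` {Neg ?E, Neg (Forall \<sigma> A)}"] by simp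
  then have "T; {Neg ?E, Neg (Forall \<sigma> A)} \<turnstile> Forall \<sigma> A" by (rule proves.ForallI)
  moreover have "T; {Neg ?E, Neg (Forall \<sigma> A)} \<turnstile> Neg (Forall \<sigma> A)"
    using assms by (intro proves.Assumption) auto
  ultimately have "T; {Neg ?E, Neg (Forall \<sigma> A)} \<turnstile> Falsum" by (rule proves.ImplE[rotated])
  then show ?thesis by (rule proves.Classical) (simp add: assms)
qed

text \<open>Deductive closure is demanded for finite \<Gamma> only, since finitely many members are
  already derivable at one common stage of the construction; no compactness theorem is
  involved.\<close>

locale henkin =
  fixes T S :: "fm set"
  assumes deductive: "finite \<Gamma> \<Longrightarrow> \<Gamma> \<subseteq> S \<Longrightarrow> T; \<Gamma> \<turnstile> A \<Longrightarrow> A \<in> S"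
    and wf: "A \<in> S \<Longrightarrow> wf_fm A"
    and consistent: "Falsum \<notin> S"
    and complete: "wf_fm A \<Longrightarrow> A \<in> S \<or> Neg A \<in> S"
    and witness: "Exists \<sigma> A \<in> S \<Longrightarrow> \<exists>t. has_type t \<sigma> \<and> subst \<sigma> 0 t A \<in> S"

text \<open>Stage n adds the formula with number n if this is consistent, together with a witness
  instance if it is existential. All stages stay finite, so an index beyond all their free variables
  always exists.\<close>

lemma lindenbaum:
  assumes T: "\<And>B. B \<in> T \<Longrightarrow> fv_below 0 B"
    and "wf_fm A" and unprovable: "\<not> (T; {Neg A} \<turnstile> Falsum)"
  shows "\<exists>S. henkin T S \<and> Neg A \<in> S"
proof -
  \<comment> \<open>The witness is a variable whose index is fresh for the body and for everything
    collected so far, as \<open>fresh_witness\<close> requires.\<close>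
  define wit where "wit \<Gamma> B = (case B of Exists \<sigma> C \<Rightarrow>
      {subst \<sigma> 0 (Var \<sigma> (SOME k. fv_below k C \<and> (\<forall>D\<in>insert B \<Gamma>. fv_below k D))) C} | _ \<Rightarrow> {})"
    for \<Gamma> B
  define G where "G = rec_nat {Neg A} (\<lambda>n \<Gamma>. let B = from_nat n in
      if wf_fm B \<and> \<not> (T; insert B \<Gamma> \<turnstile> Falsum) then wit \<Gamma> B \<union> insert B \<Gamma> else \<Gamma>)"
  have G0: "G 0 = {Neg A}" by (simp add: G_def)
  have GSuc: "G (Suc n) = (let B = from_nat n in
      if wf_fm B \<and> \<not> (T; insert B (G n) \<turnstile> Falsum) then wit (G n) B \<union> insert B (G n) else G n)" for n
    unfolding G_def by simp
  have wit_fin: "finite (wit \<Gamma> B)" for \<Gamma> B by (auto simp: wit_def split: fm.splits)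
  have wit_wf: "wf_fm C" if "C \<in> wit \<Gamma> B" "wf_fm B" for C \<Gamma> B
    using that by (auto simp: wit_def wf_subst split: fm.splits)
  have wit_con: "\<not> (T; wit \<Gamma> B \<union> insert B \<Gamma> \<turnstile> Falsum)"
    if fin: "finite \<Gamma>" and "wf_fm B" and con: "\<not> (T; insert B \<Gamma> \<turnstile> Falsum)" for \<Gamma> B
  proof (cases "\<exists>\<sigma> C. B = Exists \<sigma> C")
    case True
    then obtain \<sigma> C where B: "B = Exists \<sigma> C" by blast
    obtain k1 where "fv_below k1 C" using ex_fv_below by blast
    moreover obtain k2 where "\<forall>D\<in>insert B \<Gamma>. fv_below k2 D"
      using ex_fv_below_finite fin by (metis finite_insert)
    ultimately have "\<exists>k. fv_below k C \<and> (\<forall>D\<in>insert B \<Gamma>. fv_below k D)"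
      by (metis fv_below_mono max.cobounded1 max.cobounded2)
    then have some: "fv_below k C \<and> (\<forall>D\<in>insert B \<Gamma>. fv_below k D)"
      if "k = (SOME k. fv_below k C \<and> (\<forall>D\<in>insert B \<Gamma>. fv_below k D))" for k
      unfolding that by (rule someI_ex)
    obtain k where k: "fv_below k C" "\<forall>D\<in>insert B \<Gamma>. fv_below k D"
      and wit: "wit \<Gamma> B = {subst \<sigma> 0 (Var \<sigma> k) C}"
      using some[OF refl] unfolding wit_def B fm.case by blast
    have ex: "T; insert B \<Gamma> \<turnstile> Exists \<sigma> C"
      using \<open>wf_fm B\<close> B by (intro proves.Assumption) auto
    show ?thesis
    proof
      assume "T; wit \<Gamma> B \<union> insert B \<Gamma> \<turnstile> Falsum"
      then have "T; insert (subst \<sigma> 0 (Var \<sigma> k) C) (insert B \<Gamma>) \<turnstile> Falsum"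
        by (simp add: wit insert_commute)
      from fresh_witness[OF this T k(1) _ ex] k(2) con show False by blast
    qed
  next
    case False
    then have "wit \<Gamma> B = {}" by (auto simp: wit_def split: fm.splits)
    then show ?thesis using con by simp
  qed
  have inv: "finite (G n) \<and> (\<forall>B\<in>G n. wf_fm B) \<and> \<not> (T; G n \<turnstile> Falsum)" for n
  proof (induction n)
    case 0
    show ?case using assms by (simp add: G0)
  next
    case (Suc n)
    show ?case
    proof (cases "wf_fm (from_nat n :: fm) \<and> \<not> (T; insert (from_nat n) (G n) \<turnstile> Falsum)")
      case True
      then have eq: "G (Suc n) = wit (G n) (from_nat n) \<union> insert (from_nat n) (G n)"
        by (simp add: GSuc Let_def)
      show ?thesis unfolding eq using Suc True wit_fin wit_wf wit_con by blast
    next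
      case False
      then have "G (Suc n) = G n" by (auto simp: GSuc Let_def)
      then show ?thesis using Suc by simp
    qed
  qed
  have "G n \<subseteq> G (Suc n)" for n by (auto simp: GSuc Let_def)
  then have mono: "G m \<subseteq> G n" if "m \<le> n" for m n using lift_Suc_mono_le[of G] that by blast
  \<comment> \<open>Taking the deductive closure of the stages instead of their union makes closure
    under finite derivations a matter of cut.\<close>
  define S where "S = {B. \<exists>n. T; G n \<turnstile> B}"
  have common: "\<exists>n. \<forall>B\<in>\<Gamma>. T; G n \<turnstile> B" if "finite \<Gamma>" "\<Gamma> \<subseteq> S" for \<Gamma>
    using that
  proof (induction rule: finite_induct)
    case (insert B \<Gamma>)
    then obtain n m where "\<forall>C\<in>\<Gamma>. T; G n \<turnstile> C" "T; G m \<turnstile> B" by (auto simp: S_def)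
    then have "\<forall>C\<in>insert B \<Gamma>. T; G (max n m) \<turnstile> C"
      using proves_weaken mono by (metis insert_iff max.cobounded1 max.cobounded2)
    then show ?case ..
  qed simp
  have ded: "B \<in> S" if "finite \<Gamma>" "\<Gamma> \<subseteq> S" "T; \<Gamma> \<turnstile> B" for \<Gamma> B
    using common[OF that(1,2)] proves_cut[OF that(1,3)] by (auto simp: S_def)
  have con: "Falsum \<notin> S" using inv by (auto simp: S_def)
  have refuted: "Neg B \<in> S" if "wf_fm B" "T; insert B (G n) \<turnstile> Falsum" for B n
    using that by (auto simp: S_def intro: proves.ImplI)
  have stage: "wit (G (to_nat B)) B \<union> {B} \<subseteq> G (Suc (to_nat B))"
    if "wf_fm B" "\<not> (T; insert B (G (to_nat B)) \<turnstile> Falsum)" for B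
    using that by (auto simp: GSuc)
  have in_S: "B \<in> S" if "B \<in> G n" for B n
    using that inv by (auto simp: S_def intro: proves.Assumption)
  have "henkin T S"
  proof
    fix B assume "wf_fm B"
    show "B \<in> S \<or> Neg B \<in> S"
      using refuted[OF \<open>wf_fm B\<close>] stage[OF \<open>wf_fm B\<close>] in_S by blast
  next
    fix \<sigma> C assume ex: "Exists \<sigma> C \<in> S"
    then have wf: "wf_fm (Exists \<sigma> C)" unfolding S_def using proves_wf by blast
    \<comment> \<open>Members of S are derivable but need not have been added by themselves. Had
      this formula been rejected at its own stage, its negation would lie in S too; so it was added,
      and its witness with it.\<close>
    have "Neg (Exists \<sigma> C) \<notin> S"
    proof
      assume neg: "Neg (Exists \<sigma> C) \<in> S"
      have "T; {Exists \<sigma> C, Neg (Exists \<sigma> C)} \<turnstile> Falsum"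
        using wf by (intro proves.ImplE[where A = "Exists \<sigma> C" and B = Falsum] proves.Assumption) auto
      then show False using ded[of "{Exists \<sigma> C, Neg (Exists \<sigma> C)}"] ex neg con by blast
    qed
    then have "\<not> (T; insert (Exists \<sigma> C) (G (to_nat (Exists \<sigma> C))) \<turnstile> Falsum)"
      using refuted[OF wf] by blast
    from stage[OF wf this] obtain k where "subst \<sigma> 0 (Var \<sigma> k) C \<in> G (Suc (to_nat (Exists \<sigma> C)))"
      by (auto simp: wit_def)
    then show "\<exists>t. has_type t \<sigma> \<and> subst \<sigma> 0 t C \<in> S" using in_S by force
  qed (use ded con proves_wf in \<open>auto simp: S_def\<close>)
  moreover have "Neg A \<in> S" using in_S[of _ 0] by (simp add: G0)
  ultimately show ?thesis by blast
qed

context henkin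
begin

lemma deductive': "T; set Bs \<turnstile> A \<Longrightarrow> set Bs \<subseteq> S \<Longrightarrow> A \<in> S"
  by (rule deductive[of "set Bs"]) auto

lemma mp: "A \<^bold>\<longrightarrow> B \<in> S \<Longrightarrow> A \<in> S \<Longrightarrow> B \<in> S"
  using wf[of "A \<^bold>\<longrightarrow> B"] by (intro deductive'[of "[A \<^bold>\<longrightarrow> B, A]"] proves.ImplE[of _ _ A B] proves.Assumption) auto

lemma Neg_iff: "wf_fm A \<Longrightarrow> Neg A \<in> S \<longleftrightarrow> A \<notin> S"
  using mp consistent complete by blast

lemma Conj_iff: "A \<^bold>\<and> B \<in> S \<longleftrightarrow> A \<in> S \<and> B \<in> S"
proof safe
  assume "A \<^bold>\<and> B \<in> S"
  then have "T; set [A \<^bold>\<and> B] \<turnstile> A \<^bold>\<and> B" using wf by (auto intro: proves.Assumption)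
  from proves.ConjE1[OF this] proves.ConjE2[OF this] \<open>A \<^bold>\<and> B \<in> S\<close>
  show "A \<in> S" "B \<in> S" by (auto intro: deductive[of "{A \<^bold>\<and> B}"])
next
  assume "A \<in> S" "B \<in> S"
  then show "A \<^bold>\<and> B \<in> S" using wf
    by (intro deductive'[of "[A, B]"] proves.ConjI proves.Assumption) auto
qed

lemma Impl_iff: "wf_fm A \<Longrightarrow> wf_fm B \<Longrightarrow> A \<^bold>\<longrightarrow> B \<in> S \<longleftrightarrow> (A \<in> S \<longrightarrow> B \<in> S)"
proof safe
  assume AB: "wf_fm A" "wf_fm B"
  show "A \<^bold>\<longrightarrow> B \<in> S" if "A \<notin> S"
  proof -
    have "Neg A \<in> S" using that AB Neg_iff by blast
    moreover have "T; insert (Neg B) (insert A (set [Neg A])) \<turnstile> Falsum"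
      using AB by (intro proves.ImplE[of _ _ A Falsum] proves.Assumption) auto
    ultimately show ?thesis
      using AB by (intro deductive'[of "[Neg A]"] proves.ImplI proves.Classical[of _ B]) auto
  qed
  show "A \<^bold>\<longrightarrow> B \<in> S" if "B \<in> S"
    using that AB by (intro deductive'[of "[B]"] proves.ImplI proves.Assumption) auto
qed (rule mp)

lemma Disj_iff: "wf_fm A \<Longrightarrow> wf_fm B \<Longrightarrow> A \<^bold>\<or> B \<in> S \<longleftrightarrow> A \<in> S \<or> B \<in> S"
proof (intro iffI)
  assume AB: "wf_fm A" "wf_fm B" and or: "A \<^bold>\<or> B \<in> S"
  show "A \<in> S \<or> B \<in> S"
  proof (rule ccontr)
    assume "\<not> (A \<in> S \<or> B \<in> S)"
    then have neg: "Neg A \<in> S" "Neg B \<in> S" using AB Neg_iff by auto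
    let ?G = "set [A \<^bold>\<or> B, Neg A, Neg B]"
    have "T; insert A ?G \<turnstile> Falsum"
      using AB by (intro proves.ImplE[of _ _ A Falsum] proves.Assumption) auto
    moreover have "T; insert B ?G \<turnstile> Falsum"
      using AB by (intro proves.ImplE[of _ _ B Falsum] proves.Assumption) auto
    moreover have "T; ?G \<turnstile> A \<^bold>\<or> B" using AB by (intro proves.Assumption) auto
    ultimately have "T; ?G \<turnstile> Falsum" using proves.DisjE by blast
    then show False using or neg consistent deductive' by (metis empty_subsetI insert_subset list.set)
  qed
next
  assume AB: "wf_fm A" "wf_fm B" and "A \<in> S \<or> B \<in> S"
  then show "A \<^bold>\<or> B \<in> S"
  proof (elim disjE)
    assume "A \<in> S"
    then show ?thesis
      using AB by (intro deductive'[of "[A]"] proves.DisjI1 proves.Assumption) auto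
  next
    assume "B \<in> S"
    then show ?thesis
      using AB by (intro deductive'[of "[B]"] proves.DisjI2 proves.Assumption) auto
  qed
qed

lemma Exists_iff: "wf_fm A \<Longrightarrow> Exists \<sigma> A \<in> S \<longleftrightarrow> (\<exists>t. has_type t \<sigma> \<and> subst \<sigma> 0 t A \<in> S)"
proof (intro iffI witness)
  assume A: "wf_fm A" and "\<exists>t. has_type t \<sigma> \<and> subst \<sigma> 0 t A \<in> S"
  then obtain t where t: "has_type t \<sigma>" "subst \<sigma> 0 t A \<in> S" by blast
  then show "Exists \<sigma> A \<in> S"
    using A by (intro deductive'[of "[subst \<sigma> 0 t A]"] proves.ExistsI[of _ _ _ t] proves.Assumption)
      (auto simp: wf_subst)
qed

lemma Forall_iff: "wf_fm A \<Longrightarrow> Forall \<sigma> A \<in> S \<longleftrightarrow> (\<forall>t. has_type t \<sigma> \<longrightarrow> subst \<sigma> 0 t A \<in> S)"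
proof (intro iffI allI impI)
  fix t assume "wf_fm A" "Forall \<sigma> A \<in> S" "has_type t \<sigma>"
  then show "subst \<sigma> 0 t A \<in> S"
    by (intro deductive'[of "[Forall \<sigma> A]"] proves.ForallE proves.Assumption) auto
next
  assume A: "wf_fm A" and all: "\<forall>t. has_type t \<sigma> \<longrightarrow> subst \<sigma> 0 t A \<in> S"
  show "Forall \<sigma> A \<in> S"
  proof (rule ccontr)
    assume "Forall \<sigma> A \<notin> S"
    then have "Neg (Forall \<sigma> A) \<in> S" using A Neg_iff by simp
    then have "Exists \<sigma> (Neg A) \<in> S"
      using proves_Neg_Forall[OF A] deductive'[of "[Neg (Forall \<sigma> A)]"] by simp
    then obtain t where t: "has_type t \<sigma>" "subst \<sigma> 0 t (Neg A) \<in> S" using witness by blast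
    then show False using all A Neg_iff[of "subst \<sigma> 0 t A"] by (simp add: wf_subst)
  qed
qed

lemma ssub_Exists_iff:
  assumes "wf_fm A" "wt_sub s"
  shows "ssub s (Exists \<sigma> A) \<in> S \<longleftrightarrow> (\<exists>t. has_type t \<sigma> \<and> ssub (scons \<sigma> t s) A \<in> S)"
  using assms by (simp add: Exists_iff wf_ssub subst_ssub_up)

lemma ssub_Forall_iff:
  assumes "wf_fm A" "wt_sub s"
  shows "ssub s (Forall \<sigma> A) \<in> S \<longleftrightarrow> (\<forall>t. has_type t \<sigma> \<longrightarrow> ssub (scons \<sigma> t s) A \<in> S)"
  using assms by (simp add: Forall_iff wf_ssub subst_ssub_up)

end


section \<open>Extensional models\<close>

locale applicative =
  fixes D :: "ty \<Rightarrow> 'a set" and ap :: "'a \<Rightarrow> 'a \<Rightarrow> 'a" (infixl "\<bullet>" 90)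
    and I :: "cnst \<Rightarrow> 'a" and lt :: "'a \<Rightarrow> 'a \<Rightarrow> bool"
begin

primrec val :: "(ty \<Rightarrow> nat \<Rightarrow> 'a) \<Rightarrow> tm \<Rightarrow> 'a" where
  "val e (Var \<sigma> k) = e \<sigma> k"
| "val e (Con c) = I c"
| "val e (s \<cdot> t) = val e s \<bullet> val e t"

primrec sat :: "(ty \<Rightarrow> nat \<Rightarrow> 'a) \<Rightarrow> fm \<Rightarrow> bool" where
  "sat e (s \<^bold>= t) \<longleftrightarrow> val e s = val e t"
| "sat e (s \<^bold>< t) \<longleftrightarrow> lt (val e s) (val e t)"
| "sat e Falsum \<longleftrightarrow> False"
| "sat e (A \<^bold>\<and> B) \<longleftrightarrow> sat e A \<and> sat e B"
| "sat e (A \<^bold>\<or> B) \<longleftrightarrow> sat e A \<or> sat e B"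
| "sat e (A \<^bold>\<longrightarrow> B) \<longleftrightarrow> (sat e A \<longrightarrow> sat e B)"
| "sat e (Forall \<sigma> A) \<longleftrightarrow> (\<forall>x\<in>D \<sigma>. sat (scons \<sigma> x e) A)"
| "sat e (Exists \<sigma> A) \<longleftrightarrow> (\<exists>x\<in>D \<sigma>. sat (scons \<sigma> x e) A)"

definition wt_env :: "(ty \<Rightarrow> nat \<Rightarrow> 'a) \<Rightarrow> bool" where
  "wt_env e \<longleftrightarrow> (\<forall>\<sigma> k. e \<sigma> k \<in> D \<sigma>)"

end

locale extensional_model = applicative D ap I lt
  for D :: "ty \<Rightarrow> 'a set" and ap (infixl "\<bullet>" 90) and I lt +
  assumes ap_in: "u \<in> D (\<sigma> \<rightarrow> \<tau>) \<Longrightarrow> x \<in> D \<sigma> \<Longrightarrow> u \<bullet> x \<in> D \<tau>"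
    and I_in: "I c \<in> D (cnst_ty c)"
    and D_nonempty: "D \<sigma> \<noteq> {}"
    and extensional: "u \<in> D (\<sigma> \<rightarrow> \<tau>) \<Longrightarrow> v \<in> D (\<sigma> \<rightarrow> \<tau>)
      \<Longrightarrow> (\<And>x. x \<in> D \<sigma> \<Longrightarrow> u \<bullet> x = v \<bullet> x) \<Longrightarrow> u = v"

section \<open>The term model modulo derivable extensional equality\<close>

locale henkin_ext = henkin +
  assumes ext_axioms: "ext_axiom \<rho> \<tau> \<in> S"
begin

abbreviation eqv :: "ty \<Rightarrow> tm \<Rightarrow> tm \<Rightarrow> bool" where
  "eqv \<sigma> s t \<equiv> eq_at \<sigma> s t \<in> S"

lemma subst_eq_at_lift:
  "subst \<sigma> 0 u (eq_at \<tau> (lift_tm \<sigma> 0 s \<cdot> Var \<sigma> 0) (lift_tm \<sigma> 0 t \<cdot> Var \<sigma> 0))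
     = eq_at \<tau> (s \<cdot> u) (t \<cdot> u)"
  by (simp only: subst_eq_ssub subst0_var ssub_eq_at) simp

lemma eqv_Fn:
  assumes "has_type s (\<sigma> \<rightarrow> \<tau>)" "has_type t (\<sigma> \<rightarrow> \<tau>)"
  shows "eqv (\<sigma> \<rightarrow> \<tau>) s t \<longleftrightarrow> (\<forall>u. has_type u \<sigma> \<longrightarrow> eqv \<tau> (s \<cdot> u) (t \<cdot> u))"
proof -
  have "wf_fm (eq_at \<tau> (lift_tm \<sigma> 0 s \<cdot> Var \<sigma> 0) (lift_tm \<sigma> 0 t \<cdot> Var \<sigma> 0))"
    using assms by (intro wf_eq_at) auto
  then show ?thesis by (simp add: Forall_iff subst_eq_at_lift)
qed

lemma eq_refl: "has_type t T0 \<Longrightarrow> t \<^bold>= t \<in> S"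
  by (rule deductive[of "{}"]) (auto intro: proves.EqRefl)

lemma eq_subst: "s \<^bold>= t \<in> S \<Longrightarrow> subst T0 0 s A \<in> S \<Longrightarrow> wf_fm A \<Longrightarrow> subst T0 0 t A \<in> S"
  by (rule deductive'[of "[s \<^bold>= t, subst T0 0 s A]"], rule proves.EqSubst[of _ _ s t A])
    (auto intro: proves.Assumption dest: wf)

lemma subst_tm_lift [simp]: "subst_tm \<sigma> 0 u (lift_tm \<sigma> 0 t) = t"
  by (induction t) auto

lemma eq_sym: assumes "s \<^bold>= t \<in> S" shows "t \<^bold>= s \<in> S"
proof -
  have "has_type s T0" "has_type t T0" using wf[OF assms] by auto
  then show ?thesis using eq_subst[OF assms, of "Var T0 0 \<^bold>= lift_tm T0 0 s"] eq_refl by simp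
qed

lemma eq_trans: assumes "s \<^bold>= t \<in> S" "t \<^bold>= u \<in> S" shows "s \<^bold>= u \<in> S"
proof -
  have "has_type s T0" "has_type t T0" using wf[OF assms(1)] by auto
  then show ?thesis using eq_subst[OF assms(2), of "lift_tm T0 0 s \<^bold>= Var T0 0"] assms(1) by simp
qed

lemma less_cong:
  assumes "s \<^bold>= s' \<in> S" "t \<^bold>= t' \<in> S" "s \<^bold>< t \<in> S" shows "s' \<^bold>< t' \<in> S"
proof -
  have "has_type s' T0" "has_type t T0" using wf[OF assms(1)] wf[OF assms(2)] by auto
  then show ?thesis
    using eq_subst[OF assms(1), of "Var T0 0 \<^bold>< lift_tm T0 0 t"]
      eq_subst[OF assms(2), of "lift_tm T0 0 s' \<^bold>< Var T0 0"] assms(3) by simp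
qed

lemma eqv_refl: "has_type t \<sigma> \<Longrightarrow> eqv \<sigma> t t"
proof (induction \<sigma> arbitrary: t)
  case T0
  then show ?case by (simp add: eq_refl)
next
  case (Fn \<sigma> \<tau>)
  then show ?case by (subst eqv_Fn) (auto intro!: Fn.IH(2))
qed

lemma eqv_sym: "has_type s \<sigma> \<Longrightarrow> has_type t \<sigma> \<Longrightarrow> eqv \<sigma> s t \<Longrightarrow> eqv \<sigma> t s"
proof (induction \<sigma> arbitrary: s t)
  case T0
  then show ?case by (simp add: eq_sym)
next
  case (Fn \<sigma> \<tau>)
  have "eqv \<tau> (t \<cdot> u) (s \<cdot> u)" if u: "has_type u \<sigma>" for u
  proof (rule Fn.IH(2))
    show "eqv \<tau> (s \<cdot> u) (t \<cdot> u)" using Fn.prems u eqv_Fn by blast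
  qed (use Fn.prems u in auto)
  then show ?case using Fn.prems eqv_Fn by blast
qed

lemma eqv_trans:
  "has_type s \<sigma> \<Longrightarrow> has_type t \<sigma> \<Longrightarrow> has_type u \<sigma> \<Longrightarrow> eqv \<sigma> s t \<Longrightarrow> eqv \<sigma> t u \<Longrightarrow> eqv \<sigma> s u"
proof (induction \<sigma> arbitrary: s t u)
  case T0
  then show ?case using eq_trans by simp
next
  case (Fn \<sigma> \<tau>)
  have "eqv \<tau> (s \<cdot> v) (u \<cdot> v)" if v: "has_type v \<sigma>" for v
  proof (rule Fn.IH(2))
    show "eqv \<tau> (s \<cdot> v) (t \<cdot> v)" "eqv \<tau> (t \<cdot> v) (u \<cdot> v)"
      using Fn.prems v eqv_Fn by blast+
  qed (use Fn.prems v in auto)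
  then show ?case using Fn.prems eqv_Fn by blast
qed

text \<open>Congruence in the function is built into \<open>eq_at\<close>; congruence in the
  argument is what the extensionality axiom contributes. Together they make application well defined
  on classes.\<close>

lemma eqv_ap:
  assumes ty: "has_type s (\<sigma> \<rightarrow> \<tau>)" "has_type s' (\<sigma> \<rightarrow> \<tau>)" "has_type t \<sigma>" "has_type t' \<sigma>"
    and eq: "eqv (\<sigma> \<rightarrow> \<tau>) s s'" "eqv \<sigma> t t'"
  shows "eqv \<tau> (s \<cdot> t) (s' \<cdot> t')"
proof -
  let ?F = "Var (\<sigma> \<rightarrow> \<tau>) 0"
  let ?A = "eq_at \<sigma> (Var \<sigma> 1) (Var \<sigma> 0) \<^bold>\<longrightarrow> eq_at \<tau> (?F \<cdot> Var \<sigma> 1) (?F \<cdot> Var \<sigma> 0)"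
  have ne: "\<sigma> \<noteq> \<sigma> \<rightarrow> \<tau>" by (induction \<sigma>) auto
  have wfA: "wf_fm ?A" by (simp add: wf_eq_at)
  have "ssub Var (Forall \<sigma> (Forall \<sigma> (Forall (\<sigma> \<rightarrow> \<tau>) ?A))) \<in> S"
    using ext_axioms[of \<sigma> \<tau>] unfolding ext_axiom_def Let_def ssub_Var .
  then have "ssub (scons \<sigma> t Var) (Forall \<sigma> (Forall (\<sigma> \<rightarrow> \<tau>) ?A)) \<in> S"
    by (subst (asm) ssub_Forall_iff) (use wfA ty in auto)
  then have "ssub (scons \<sigma> t' (scons \<sigma> t Var)) (Forall (\<sigma> \<rightarrow> \<tau>) ?A) \<in> S"
    by (subst (asm) ssub_Forall_iff) (use wfA ty in auto)
  then have "ssub (scons (\<sigma> \<rightarrow> \<tau>) s (scons \<sigma> t' (scons \<sigma> t Var))) ?A \<in> S"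
    by (subst (asm) ssub_Forall_iff) (use wfA ty in auto)
  then have "eq_at \<sigma> t t' \<^bold>\<longrightarrow> eq_at \<tau> (s \<cdot> t) (s \<cdot> t') \<in> S"
    using ne by (simp add: ssub_eq_at)
  then have 1: "eqv \<tau> (s \<cdot> t) (s \<cdot> t')" using eq(2) mp by blast
  have 2: "eqv \<tau> (s \<cdot> t') (s' \<cdot> t')" using eq(1) ty eqv_Fn by blast
  show ?thesis by (rule eqv_trans[OF _ _ _ 1 2]) (use ty in auto)
qed

text \<open>The type is recovered from the term, where it is unique, instead of being an argument.
  Application can then be one untyped binary operation, as the locale \<open>applicative\<close> has
  it.\<close>

definition cls :: "tm \<Rightarrow> tm set" where
  "cls t = {s. \<exists>\<sigma>. has_type t \<sigma> \<and> has_type s \<sigma> \<and> eqv \<sigma> t s}"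

definition dom :: "ty \<Rightarrow> tm set set" where
  "dom \<sigma> = cls ` {t. has_type t \<sigma>}"

definition rep :: "tm set \<Rightarrow> tm" where
  "rep U = (SOME u. u \<in> U)"

definition app :: "tm set \<Rightarrow> tm set \<Rightarrow> tm set" where
  "app U V = cls (rep U \<cdot> rep V)"

definition less :: "tm set \<Rightarrow> tm set \<Rightarrow> bool" where
  "less U V \<longleftrightarrow> (rep U \<^bold>< rep V) \<in> S"

abbreviation const :: "cnst \<Rightarrow> tm set" where
  "const c \<equiv> cls (Con c)"

lemma cls_eq: "has_type t \<sigma> \<Longrightarrow> cls t = {s. has_type s \<sigma> \<and> eqv \<sigma> t s}"
  unfolding cls_def using has_type_unique by blast

lemma cls_eq_iff:
  assumes "has_type s \<sigma>" "has_type t \<sigma>"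
  shows "cls s = cls t \<longleftrightarrow> eqv \<sigma> s t"
proof
  assume "cls s = cls t"
  then have "t \<in> cls s" using assms(2) eqv_refl by (simp add: cls_eq)
  then show "eqv \<sigma> s t" using assms(1) by (simp add: cls_eq)
next
  assume st: "eqv \<sigma> s t"
  have ts: "eqv \<sigma> t s" by (rule eqv_sym[OF assms st])
  show "cls s = cls t"
    unfolding assms[THEN cls_eq] using assms st ts eqv_trans by blast
qed

lemma rep_cls:
  assumes "has_type t \<sigma>"
  shows "has_type (rep (cls t)) \<sigma>" "eqv \<sigma> t (rep (cls t))"
proof -
  have "t \<in> cls t" using assms eqv_refl by (simp add: cls_eq)
  then have "rep (cls t) \<in> cls t" unfolding rep_def by (rule someI)
  then show "has_type (rep (cls t)) \<sigma>" "eqv \<sigma> t (rep (cls t))"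
    using assms by (simp_all add: cls_eq)
qed

lemma cls_dom: "has_type t \<sigma> \<Longrightarrow> cls t \<in> dom \<sigma>"
  by (simp add: dom_def)

lemma domE: "U \<in> dom \<sigma> \<Longrightarrow> (\<And>t. has_type t \<sigma> \<Longrightarrow> U = cls t \<Longrightarrow> P) \<Longrightarrow> P"
  by (auto simp: dom_def)

lemma ball_dom: "(\<forall>U\<in>dom \<sigma>. P U) \<longleftrightarrow> (\<forall>t. has_type t \<sigma> \<longrightarrow> P (cls t))"
  and bex_dom: "(\<exists>U\<in>dom \<sigma>. P U) \<longleftrightarrow> (\<exists>t. has_type t \<sigma> \<and> P (cls t))"
  by (auto simp: dom_def)

lemma app_cls:
  assumes "has_type s (\<sigma> \<rightarrow> \<tau>)" "has_type t \<sigma>"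
  shows "app (cls s) (cls t) = cls (s \<cdot> t)"
proof -
  note r = rep_cls[OF assms(1)] rep_cls[OF assms(2)]
  have "eqv \<tau> (s \<cdot> t) (rep (cls s) \<cdot> rep (cls t))"
    by (rule eqv_ap[OF assms(1) r(1) assms(2) r(3) r(2) r(4)])
  then show ?thesis unfolding app_def
    using assms r by (subst eq_commute, subst cls_eq_iff[of _ \<tau>]) auto
qed

lemma less_cls:
  assumes "has_type s T0" "has_type t T0"
  shows "less (cls s) (cls t) \<longleftrightarrow> s \<^bold>< t \<in> S"
proof -
  note r = rep_cls[OF assms(1)] rep_cls[OF assms(2)]
  show ?thesis unfolding less_def
    using less_cong[of s "rep (cls s)" t "rep (cls t)"] less_cong[of "rep (cls s)" s "rep (cls t)" t]
      eq_sym r by auto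
qed

sublocale extensional_model dom app const less
proof
  fix u \<sigma> \<tau> x assume "u \<in> dom (\<sigma> \<rightarrow> \<tau>)" "x \<in> dom \<sigma>"
  then show "app u x \<in> dom \<tau>" by (elim domE) (auto simp: app_cls intro!: cls_dom)
next
  fix c show "const c \<in> dom (cnst_ty c)" by (rule cls_dom) simp
next
  fix \<sigma> show "dom \<sigma> \<noteq> {}" using cls_dom[of "Var \<sigma> 0" \<sigma>] by auto
next
  fix u v \<sigma> \<tau> assume "u \<in> dom (\<sigma> \<rightarrow> \<tau>)" "v \<in> dom (\<sigma> \<rightarrow> \<tau>)"
    and eq: "\<And>x. x \<in> dom \<sigma> \<Longrightarrow> app u x = app v x"
  then obtain s t where st: "has_type s (\<sigma> \<rightarrow> \<tau>)" "has_type t (\<sigma> \<rightarrow> \<tau>)" "u = cls s" "v = cls t"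
    by (metis domE)
  have "eqv \<tau> (s \<cdot> w) (t \<cdot> w)" if w: "has_type w \<sigma>" for w
  proof -
    have "cls (s \<cdot> w) = cls (t \<cdot> w)" using eq[OF cls_dom[OF w]] st w by (simp add: app_cls)
    then show ?thesis using cls_eq_iff[of "s \<cdot> w" \<tau> "t \<cdot> w"] st w by auto
  qed
  then show "u = v" using st cls_eq_iff eqv_Fn by blast
qed

lemma val_cls: "wt_sub s \<Longrightarrow> has_type t \<sigma> \<Longrightarrow> val (\<lambda>\<tau> k. cls (s \<tau> k)) t = cls (ssub_tm s t)"
proof (induction t arbitrary: \<sigma>)
  case (App t u)
  then obtain \<tau> where *: "has_type t (\<tau> \<rightarrow> \<sigma>)" "has_type u \<tau>" by auto
  then have "has_type (ssub_tm s t) (\<tau> \<rightarrow> \<sigma>)" "has_type (ssub_tm s u) \<tau>"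
    using App.prems has_type_ssub by blast+
  then show ?case using App * by (simp add: app_cls)
qed simp_all

lemma scons_cls: "scons \<sigma> (cls t) (\<lambda>\<tau> k. cls (s \<tau> k)) = (\<lambda>\<tau> k. cls (scons \<sigma> t s \<tau> k))"
  by (rule ext, rule ext) (auto simp: scons_def split: nat.splits)

text \<open>The environment comes from an arbitrary well-typed substitution because each quantifier
  step extends the substitution by a term; the identity substitution gives the model itself.\<close>

lemma truth: "wf_fm A \<Longrightarrow> wt_sub s \<Longrightarrow> sat (\<lambda>\<tau> k. cls (s \<tau> k)) A \<longleftrightarrow> ssub s A \<in> S"
proof (induction A arbitrary: s)
  case (Eq t u)
  then show ?case using cls_eq_iff[of "ssub_tm s t" T0 "ssub_tm s u"]
    by (simp add: val_cls[of _ _ T0] has_type_ssub)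
next
  case (Less t u)
  then show ?case by (simp add: val_cls[of _ _ T0] has_type_ssub less_cls)
next
  case Falsum
  then show ?case by (simp add: consistent)
next
  case (Conj A B)
  then show ?case by (simp add: Conj_iff)
next
  case (Disj A B)
  then show ?case by (simp add: Disj_iff wf_ssub)
next
  case (Impl A B)
  then show ?case by (simp add: Impl_iff wf_ssub)
next
  case (Forall \<sigma> A)
  then show ?case
    by (subst ssub_Forall_iff) (simp_all add: ball_dom scons_cls)
next
  case (Exists \<sigma> A)
  then show ?case
    by (subst ssub_Exists_iff) (simp_all add: bex_dom scons_cls cong: conj_cong)
qed

end

text \<open>It is enough to know validity in models with carrier \<open>tm set\<close>, the type of
  the classes in the term model of a maximal consistent set containing the negation of the
  formula.\<close>

theorem completeness:
  assumes T: "\<And>B. B \<in> T \<Longrightarrow> fv_below 0 B" "\<And>B. B \<in> T \<Longrightarrow> wf_fm B"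
    and ext: "\<And>\<rho> \<tau>. ext_axiom \<rho> \<tau> \<in> T"
    and A: "wf_fm A"
    and valid: "\<And>(D :: ty \<Rightarrow> tm set set) ap I lt e.
      extensional_model D ap I \<Longrightarrow>
      (\<And>B e. B \<in> T \<Longrightarrow> applicative.wt_env D e \<Longrightarrow> applicative.sat D ap I lt e B) \<Longrightarrow>
      applicative.wt_env D e \<Longrightarrow> applicative.sat D ap I lt e A"
  shows "T; {} \<turnstile> A"
proof (rule ccontr)
  assume "\<not> (T; {} \<turnstile> A)"
  then have "\<not> (T; {Neg A} \<turnstile> Falsum)" using A proves.Classical by blast
  from lindenbaum[OF T(1) A this] obtain S where "henkin T S" and neg: "Neg A \<in> S" by blast
  then interpret henkin T S by simp
  have T_S: "B \<in> S" if "B \<in> T" for B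
    using that T(2) by (intro deductive[of "{}"] proves.Axiom) auto
  interpret henkin_ext T S by unfold_locales (rule T_S[OF ext])
  have sat_T: "sat e B" if B: "B \<in> T" and e: "wt_env e" for B e
  proof -
    \<comment> \<open>Choosing representatives turns the environment into a substitution, to which
      \<open>truth\<close> applies; an axiom, being closed, is left unchanged by it.\<close>
    have "\<forall>\<tau> k. \<exists>t. has_type t \<tau> \<and> e \<tau> k = cls t"
      using e unfolding wt_env_def by (metis domE)
    then obtain s where "\<forall>\<tau> k. has_type (s \<tau> k) \<tau> \<and> e \<tau> k = cls (s \<tau> k)" by metis
    then have "wt_sub s" "e = (\<lambda>\<tau> k. cls (s \<tau> k))" by (auto simp: wt_sub_def fun_eq_iff)
    then show ?thesis using truth T_S T closed_ssub B by simp
  qed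
  have "sat (\<lambda>\<tau> k. cls (Var \<tau> k)) A"
    by (rule valid) (unfold_locales, simp_all add: wt_env_def cls_dom sat_T)
  then show False using neg A truth[OF A wt_sub_Var] Neg_iff by simp
qed

section \<open>Models of the base theory\<close>

context extensional_model
begin

definition e0 :: "ty \<Rightarrow> nat \<Rightarrow> 'a" where "e0 \<sigma> n = (SOME x. x \<in> D \<sigma>)"

lemma wt_e0 [simp]: "wt_env e0"
  using D_nonempty by (simp add: wt_env_def e0_def some_in_eq)

lemma val_lift [simp]: "val (scons \<sigma> x e) (lift_tm \<sigma> 0 t) = val e t"
  by (induction t) (auto simp: scons_def)

text \<open>Axioms stated with \<open>eq_at\<close> thereby become equations of the model that can
  be used for rewriting at every type.\<close>

lemma sat_eq_at:
  "val e s \<in> D \<sigma> \<Longrightarrow> val e t \<in> D \<sigma> \<Longrightarrow> sat e (eq_at \<sigma> s t) \<longleftrightarrow> val e s = val e t"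
proof (induction \<sigma> arbitrary: e s t)
  case (Fn \<sigma> \<tau>)
  have "sat e (eq_at (\<sigma> \<rightarrow> \<tau>) s t) \<longleftrightarrow> (\<forall>x\<in>D \<sigma>. val e s \<bullet> x = val e t \<bullet> x)"
    using Fn.prems by (auto simp: Fn.IH ap_in)
  then show ?case using Fn.prems extensional by metis
qed simp

end

text \<open>Evaluating indices that are counted per type means deciding whether the types of two
  variables coincide; comparing sizes shows that no type is a proper part of itself.\<close>

lemma Fn_neq [simp]:
  "(\<sigma> \<rightarrow> \<tau>) \<noteq> \<sigma>" "\<sigma> \<noteq> (\<sigma> \<rightarrow> \<tau>)" "(\<sigma> \<rightarrow> \<tau>) \<noteq> \<tau>" "\<tau> \<noteq> (\<sigma> \<rightarrow> \<tau>)"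
  "(\<rho> \<rightarrow> \<tau> \<rightarrow> \<sigma>) \<noteq> \<tau>"
proof -
  have "size (\<sigma> \<rightarrow> \<tau>) \<noteq> size \<sigma>" "size (\<sigma> \<rightarrow> \<tau>) \<noteq> size \<tau>"
    "size (\<rho> \<rightarrow> \<tau> \<rightarrow> \<sigma>) \<noteq> size \<tau>" by simp_all
  then show "(\<sigma> \<rightarrow> \<tau>) \<noteq> \<sigma>" "\<sigma> \<noteq> (\<sigma> \<rightarrow> \<tau>)" "(\<sigma> \<rightarrow> \<tau>) \<noteq> \<tau>" "\<tau> \<noteq> (\<sigma> \<rightarrow> \<tau>)"
    "(\<rho> \<rightarrow> \<tau> \<rightarrow> \<sigma>) \<noteq> \<tau>" by metis+
qed

section \<open>An equivalent supply of axioms consisting of sentences\<close>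

definition induction_instance :: fm where
  "induction_instance = Forall T1 (induction_axiom (Var T1 0 \<cdot> Var T0 0 \<^bold>= zero))"

definition choice_instance :: "ty \<Rightarrow> ty \<Rightarrow> fm" where
  "choice_instance \<sigma> \<tau> = Forall (\<sigma> \<rightarrow> \<tau> \<rightarrow> T0)
     (choice_axiom \<sigma> \<tau> (Var (\<sigma> \<rightarrow> \<tau> \<rightarrow> T0) 0 \<cdot> Var \<sigma> 0 \<cdot> Var \<tau> 0 \<^bold>= zero))"

text \<open>Choice for \<open>A(f,m)\<close> of this shape yields a characteristic functional of \<open>B(f)\<close>.\<close>

definition decision_instance :: "fm \<Rightarrow> fm" where
  "decision_instance B = choice_axiom T1 T0
     ((B \<^bold>\<and> Var T0 0 \<^bold>= zero) \<^bold>\<or> (Neg B \<^bold>\<and> Var T0 0 \<^bold>= one))"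

text \<open>One instance of induction suffices, since every quantifier-free formula is equivalent in the
  theory to one of the form \<open>F(n) = 0\<close>; all members are sentences, as \<open>completeness\<close> requires.\<close>

definition closed_base :: "fm set" where
  "closed_base =
     arith_axioms
     \<union> {Pi_axiom \<rho> \<tau> |\<rho> \<tau>. True}
     \<union> {Sigma_axiom \<rho> \<sigma> \<tau> |\<rho> \<sigma> \<tau>. True}
     \<union> Rec_axioms
     \<union> {ext_axiom \<rho> \<tau> |\<rho> \<tau>. True}
     \<union> {induction_instance, choice_instance T1 T0,
        decision_instance (Var T1 0 \<cdot> zero \<^bold>= Var T1 0 \<cdot> one),
        decision_instance (Var T1 0 \<cdot> zero \<^bold>< Var T1 0 \<cdot> one)}"

lemma up_simps [simp]:
  "up \<sigma> s \<sigma> 0 = Var \<sigma> 0"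
  "up \<sigma> s \<sigma> (Suc j) = lift_tm \<sigma> 0 (s \<sigma> j)"
  "\<tau> \<noteq> \<sigma> \<Longrightarrow> up \<sigma> s \<tau> i = lift_tm \<sigma> 0 (s \<tau> i)"
  by (auto simp: up_def)

lemma fv_below_0I: "(\<And>s s'. ssub s A = ssub s' A) \<Longrightarrow> fv_below 0 A"
  by (simp add: fv_below_def)

lemmas axiom_defs = arith_axioms_def Pi_axiom_def Sigma_axiom_def Rec_axioms_def ext_axiom_def
  induction_instance_def choice_instance_def decision_instance_def induction_axiom_def
  choice_axiom_def

lemma closed_base_closed: "B \<in> closed_base \<Longrightarrow> fv_below 0 B"
  by (rule fv_below_0I)
    (auto simp: closed_base_def axiom_defs Let_def ssub_eq_at numeral_2_eq_2)

lemma closed_base_wf: "B \<in> closed_base \<Longrightarrow> wf_fm B"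
  by (auto simp: closed_base_def axiom_defs Let_def wf_eq_at)

text \<open>The eigenvariable condition does not concern axioms, so the free variables of an axiom
  may be generalized.\<close>

lemma proves_axiom_closure:
  assumes "A \<in> T" "wf_fm (Forall \<sigma> A)"
  shows "T; {} \<turnstile> Forall \<sigma> A"
  using assms by (intro proves.ForallI proves.Axiom) auto

lemma RCA0_omega_closed_base:
  assumes B: "B \<in> closed_base"
  shows "RCA0_omega; {} \<turnstile> B"
proof -
  let ?eq = "Var T1 0 \<cdot> zero \<^bold>= Var T1 0 \<cdot> one" and ?lt = "Var T1 0 \<cdot> zero \<^bold>< Var T1 0 \<cdot> one"
  have ind: "induction_axiom (Var T1 0 \<cdot> Var T0 0 \<^bold>= zero) \<in> RCA0_omega"
    and ch: "choice_axiom T1 T0 (Var (T1 \<rightarrow> T0 \<rightarrow> T0) 0 \<cdot> Var T1 0 \<cdot> Var T0 0 \<^bold>= zero) \<in> RCA0_omega"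
    by (auto simp: RCA0_omega_def QF_AC_def)
  have dec: "decision_instance A \<in> RCA0_omega" if "qfree A" "wf_fm A" for A
    using that by (auto simp: RCA0_omega_def QF_AC_def decision_instance_def)
  have "B \<in> RCA0_omega \<or> B = induction_instance \<or> B = choice_instance T1 T0
      \<or> B = decision_instance ?eq \<or> B = decision_instance ?lt"
    using B unfolding closed_base_def RCA0_omega_def by blast
  moreover have "decision_instance ?eq \<in> RCA0_omega" "decision_instance ?lt \<in> RCA0_omega"
    by (rule dec; simp)+
  moreover have "RCA0_omega; {} \<turnstile> induction_instance" "RCA0_omega; {} \<turnstile> choice_instance T1 T0"
    unfolding induction_instance_def choice_instance_def
    by (rule proves_axiom_closure, rule ind ch, simp add: induction_axiom_def choice_axiom_def)+
  ultimately show ?thesis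
    using closed_base_wf[OF B] proves.Axiom by blast
qed

section \<open>What the base axioms say in a model\<close>

locale rca_model = extensional_model +
  assumes base: "B \<in> closed_base \<Longrightarrow> wt_env e \<Longrightarrow> sat e B"
begin

abbreviation N :: "'a set" where "N \<equiv> D T0"
abbreviation zer :: 'a ("\<zero>") where "\<zero> \<equiv> I Zero"
abbreviation uni :: 'a ("\<one>") where "\<one> \<equiv> I One"
abbreviation plus (infixl "\<oplus>" 65) where "x \<oplus> y \<equiv> I Plus \<bullet> x \<bullet> y"
abbreviation times (infixl "\<otimes>" 70) where "x \<otimes> y \<equiv> I Times \<bullet> x \<bullet> y"
abbreviation less (infix "\<prec>" 50) where "x \<prec> y \<equiv> lt x y"

lemma ap_in_simps [simp]:
  "f \<in> D T1 \<Longrightarrow> x \<in> N \<Longrightarrow> f \<bullet> x \<in> N"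
  "F \<in> D (T1 \<rightarrow> T0) \<Longrightarrow> f \<in> D T1 \<Longrightarrow> F \<bullet> f \<in> N"
  "F2 \<in> D (T0 \<rightarrow> T0 \<rightarrow> T0) \<Longrightarrow> x \<in> N \<Longrightarrow> F2 \<bullet> x \<in> D T1"
  "G \<in> D (T1 \<rightarrow> T0 \<rightarrow> T0) \<Longrightarrow> f \<in> D T1 \<Longrightarrow> G \<bullet> f \<in> D T1"
  by (rule ap_in; assumption)+

lemma const_in [simp]:
  "\<zero> \<in> N" "\<one> \<in> N" "I Plus \<in> D (T0 \<rightarrow> T0 \<rightarrow> T0)" "I Times \<in> D (T0 \<rightarrow> T0 \<rightarrow> T0)"
  "I (Pi \<rho> \<tau>) \<in> D (\<rho> \<rightarrow> \<tau> \<rightarrow> \<rho>)"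
  "I (Sigma \<rho> \<sigma> \<tau>) \<in> D ((\<rho> \<rightarrow> \<sigma> \<rightarrow> \<tau>) \<rightarrow> (\<rho> \<rightarrow> \<sigma>) \<rightarrow> \<rho> \<rightarrow> \<tau>)"
  "I (Rec \<rho>) \<in> D ((T0 \<rightarrow> \<rho> \<rightarrow> \<rho>) \<rightarrow> \<rho> \<rightarrow> T0 \<rightarrow> \<rho>)"
  using I_in[of Zero] I_in[of One] I_in[of Plus] I_in[of Times] I_in[of "Pi \<rho> \<tau>"]
    I_in[of "Sigma \<rho> \<sigma> \<tau>"] I_in[of "Rec \<rho>"] by simp_all

lemma arith:
  "x \<in> N \<Longrightarrow> y \<in> N \<Longrightarrow> w \<in> N \<Longrightarrow> (x \<oplus> y) \<oplus> w = x \<oplus> (y \<oplus> w)"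
  "x \<in> N \<Longrightarrow> y \<in> N \<Longrightarrow> x \<oplus> y = y \<oplus> x"
  "x \<in> N \<Longrightarrow> x \<oplus> \<zero> = x"
  "x \<in> N \<Longrightarrow> y \<in> N \<Longrightarrow> w \<in> N \<Longrightarrow> (x \<otimes> y) \<otimes> w = x \<otimes> (y \<otimes> w)"
  "x \<in> N \<Longrightarrow> y \<in> N \<Longrightarrow> x \<otimes> y = y \<otimes> x"
  "x \<in> N \<Longrightarrow> x \<otimes> \<one> = x"
  "x \<in> N \<Longrightarrow> x \<otimes> \<zero> = \<zero>"
  "x \<in> N \<Longrightarrow> y \<in> N \<Longrightarrow> w \<in> N \<Longrightarrow> x \<otimes> (y \<oplus> w) = x \<otimes> y \<oplus> x \<otimes> w"
  "x \<in> N \<Longrightarrow> \<not> x \<prec> x"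
  "x \<in> N \<Longrightarrow> y \<in> N \<Longrightarrow> w \<in> N \<Longrightarrow> x \<prec> y \<Longrightarrow> y \<prec> w \<Longrightarrow> x \<prec> w"
  "x \<in> N \<Longrightarrow> y \<in> N \<Longrightarrow> x \<prec> y \<or> x = y \<or> y \<prec> x"
  "x \<in> N \<Longrightarrow> y \<in> N \<Longrightarrow> w \<in> N \<Longrightarrow> x \<prec> y \<Longrightarrow> x \<oplus> w \<prec> y \<oplus> w"
  "x \<in> N \<Longrightarrow> y \<in> N \<Longrightarrow> w \<in> N \<Longrightarrow> x \<prec> y \<Longrightarrow> \<zero> \<prec> w \<Longrightarrow> x \<otimes> w \<prec> y \<otimes> w"
  "\<zero> \<prec> \<one>"
  "x \<in> N \<Longrightarrow> x = \<zero> \<or> \<zero> \<prec> x"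
  "x \<in> N \<Longrightarrow> \<zero> \<prec> x \<Longrightarrow> x = \<one> \<or> \<one> \<prec> x"
proof -
  have "\<forall>B\<in>arith_axioms. sat e0 B" using base wt_e0 by (auto simp: closed_base_def)
  note A = this[unfolded arith_axioms_def Let_def ball_simps, simplified numeral_2_eq_2 One_nat_def,
      simplified]
  show
  "x \<in> N \<Longrightarrow> y \<in> N \<Longrightarrow> w \<in> N \<Longrightarrow> (x \<oplus> y) \<oplus> w = x \<oplus> (y \<oplus> w)"
  "x \<in> N \<Longrightarrow> y \<in> N \<Longrightarrow> x \<oplus> y = y \<oplus> x"
  "x \<in> N \<Longrightarrow> x \<oplus> \<zero> = x"
  "x \<in> N \<Longrightarrow> y \<in> N \<Longrightarrow> w \<in> N \<Longrightarrow> (x \<otimes> y) \<otimes> w = x \<otimes> (y \<otimes> w)"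
  "x \<in> N \<Longrightarrow> y \<in> N \<Longrightarrow> x \<otimes> y = y \<otimes> x"
  "x \<in> N \<Longrightarrow> x \<otimes> \<one> = x"
  "x \<in> N \<Longrightarrow> x \<otimes> \<zero> = \<zero>"
  "x \<in> N \<Longrightarrow> y \<in> N \<Longrightarrow> w \<in> N \<Longrightarrow> x \<otimes> (y \<oplus> w) = x \<otimes> y \<oplus> x \<otimes> w"
  "x \<in> N \<Longrightarrow> \<not> x \<prec> x"
  "x \<in> N \<Longrightarrow> y \<in> N \<Longrightarrow> w \<in> N \<Longrightarrow> x \<prec> y \<Longrightarrow> y \<prec> w \<Longrightarrow> x \<prec> w"
  "x \<in> N \<Longrightarrow> y \<in> N \<Longrightarrow> x \<prec> y \<or> x = y \<or> y \<prec> x"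
  "x \<in> N \<Longrightarrow> y \<in> N \<Longrightarrow> w \<in> N \<Longrightarrow> x \<prec> y \<Longrightarrow> x \<oplus> w \<prec> y \<oplus> w"
  "x \<in> N \<Longrightarrow> y \<in> N \<Longrightarrow> w \<in> N \<Longrightarrow> x \<prec> y \<Longrightarrow> \<zero> \<prec> w \<Longrightarrow> x \<otimes> w \<prec> y \<otimes> w"
  "\<zero> \<prec> \<one>"
  "x \<in> N \<Longrightarrow> x = \<zero> \<or> \<zero> \<prec> x"
  "x \<in> N \<Longrightarrow> \<zero> \<prec> x \<Longrightarrow> x = \<one> \<or> \<one> \<prec> x"
    using A by metis+
qed

lemma K_eq: assumes "x \<in> D \<rho>" "y \<in> D \<tau>" shows "I (Pi \<rho> \<tau>) \<bullet> x \<bullet> y = x"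
proof -
  have "sat e0 (Pi_axiom \<rho> \<tau>)" by (rule base[OF _ wt_e0], unfold closed_base_def) blast
  moreover have "I (Pi \<rho> \<tau>) \<bullet> x \<bullet> y \<in> D \<rho>"
    using assms by (meson ap_in const_in)
  ultimately show ?thesis using assms
    by (force simp: Pi_axiom_def Let_def sat_eq_at split: if_splits)
qed

lemma S_eq:
  assumes "x \<in> D (\<rho> \<rightarrow> \<sigma> \<rightarrow> \<tau>)" "y \<in> D (\<rho> \<rightarrow> \<sigma>)" "w \<in> D \<rho>"
  shows "I (Sigma \<rho> \<sigma> \<tau>) \<bullet> x \<bullet> y \<bullet> w = x \<bullet> w \<bullet> (y \<bullet> w)"
proof -
  have "sat e0 (Sigma_axiom \<rho> \<sigma> \<tau>)" by (rule base[OF _ wt_e0], unfold closed_base_def) blast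
  moreover have "I (Sigma \<rho> \<sigma> \<tau>) \<bullet> x \<bullet> y \<bullet> w \<in> D \<tau>" "x \<bullet> w \<bullet> (y \<bullet> w) \<in> D \<tau>"
    using assms by (meson ap_in const_in)+
  ultimately show ?thesis using assms
    by (force simp: Sigma_axiom_def Let_def sat_eq_at)
qed

lemma Rec_eq:
  assumes "f \<in> D (T0 \<rightarrow> T0 \<rightarrow> T0)" "m \<in> N"
  shows "I (Rec T0) \<bullet> f \<bullet> m \<bullet> \<zero> = m"
    and "n \<in> N \<Longrightarrow> I (Rec T0) \<bullet> f \<bullet> m \<bullet> (n \<oplus> \<one>) = f \<bullet> n \<bullet> (I (Rec T0) \<bullet> f \<bullet> m \<bullet> n)"
proof -
  have "\<forall>B\<in>Rec_axioms. sat e0 B" using base wt_e0 by (auto simp: closed_base_def)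
  note R = this[unfolded Rec_axioms_def Let_def ball_simps, simplified]
  show "I (Rec T0) \<bullet> f \<bullet> m \<bullet> \<zero> = m"
    using R assms const_in(1) by blast
  show "n \<in> N \<Longrightarrow> I (Rec T0) \<bullet> f \<bullet> m \<bullet> (n \<oplus> \<one>) = f \<bullet> n \<bullet> (I (Rec T0) \<bullet> f \<bullet> m \<bullet> n)"
    using R assms by blast
qed

lemma induct0:
  assumes "F \<in> D T1" "F \<bullet> \<zero> = \<zero>"
    and "\<And>n. n \<in> N \<Longrightarrow> F \<bullet> n = \<zero> \<Longrightarrow> F \<bullet> (n \<oplus> \<one>) = \<zero>" and "n \<in> N"
  shows "F \<bullet> n = \<zero>"
proof -
  have "sat e induction_instance \<longleftrightarrow> (\<forall>F\<in>D T1. F \<bullet> \<zero> = \<zero>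
      \<and> (\<forall>n\<in>N. F \<bullet> n = \<zero> \<longrightarrow> F \<bullet> (n \<oplus> \<one>) = \<zero>) \<longrightarrow> (\<forall>n\<in>N. F \<bullet> n = \<zero>))" for e
    by (simp add: induction_instance_def induction_axiom_def)
  moreover have "sat e0 induction_instance" by (rule base[OF _ wt_e0], unfold closed_base_def) blast
  ultimately show ?thesis using assms by blast
qed

text \<open>For distinct types both x and y carry index 0, each within its own type, as the matrix
  of \<open>choice_instance\<close> presumes.\<close>

lemma sat_choice_instance:
  assumes "sat e (choice_instance \<sigma> \<tau>)" and "\<sigma> \<noteq> \<tau>"
    and "W \<in> D (\<sigma> \<rightarrow> \<tau> \<rightarrow> T0)" "\<And>x. x \<in> D \<sigma> \<Longrightarrow> \<exists>y\<in>D \<tau>. W \<bullet> x \<bullet> y = \<zero>"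
  shows "\<exists>F\<in>D (\<sigma> \<rightarrow> \<tau>). \<forall>x\<in>D \<sigma>. W \<bullet> x \<bullet> (F \<bullet> x) = \<zero>"
proof -
  have "(\<sigma> \<rightarrow> \<tau> \<rightarrow> T0) \<noteq> (\<sigma> \<rightarrow> \<tau>)" "(\<sigma> \<rightarrow> \<tau> \<rightarrow> T0) \<noteq> \<tau>" by auto
  then have "sat e (choice_instance \<sigma> \<tau>) \<longleftrightarrow> (\<forall>W\<in>D (\<sigma> \<rightarrow> \<tau> \<rightarrow> T0).
      (\<forall>x\<in>D \<sigma>. \<exists>y\<in>D \<tau>. W \<bullet> x \<bullet> y = \<zero>)
      \<longrightarrow> (\<exists>F\<in>D (\<sigma> \<rightarrow> \<tau>). \<forall>x\<in>D \<sigma>. W \<bullet> x \<bullet> (F \<bullet> x) = \<zero>))"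
    using assms(2) by (simp add: choice_instance_def choice_axiom_def)
  then show ?thesis using assms(1,3,4) by blast
qed

lemma choice10:
  assumes "W \<in> D (T1 \<rightarrow> T0 \<rightarrow> T0)" "\<And>f. f \<in> D T1 \<Longrightarrow> \<exists>m\<in>N. W \<bullet> f \<bullet> m = \<zero>"
  shows "\<exists>F\<in>D (T1 \<rightarrow> T0). \<forall>f\<in>D T1. W \<bullet> f \<bullet> (F \<bullet> f) = \<zero>"
  using base[OF _ wt_e0, of "choice_instance T1 T0"] assms
  by (intro sat_choice_instance) (auto simp: closed_base_def)

lemma one_neq_zero [simp]: "\<one> \<noteq> \<zero>" "\<zero> \<noteq> \<one>"
  using arith(9)[of \<zero>] arith(14) by auto

text \<open>Choice is available on arguments of type 1 only, so the two numbers to be compared enter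
  as the first two values of a function. Excluded middle supplies the value that choice
  selects.\<close>

lemma ex_eq_functional:
  "\<exists>E\<in>D (T1 \<rightarrow> T0). \<forall>f\<in>D T1. E \<bullet> f = (if f \<bullet> \<zero> = f \<bullet> \<one> then \<zero> else \<one>)"
proof -
  have "sat e0 (decision_instance (Var T1 0 \<cdot> zero \<^bold>= Var T1 0 \<cdot> one))" for e
    using base by (auto simp: closed_base_def)
  then have "\<exists>E\<in>D (T1 \<rightarrow> T0). \<forall>f\<in>D T1.
      f \<bullet> \<zero> = f \<bullet> \<one> \<and> E \<bullet> f = \<zero> \<or> f \<bullet> \<zero> \<noteq> f \<bullet> \<one> \<and> E \<bullet> f = \<one>"
    by (simp add: decision_instance_def choice_axiom_def) (use const_in(1,2) in blast)
  then show ?thesis by (elim bexE, intro bexI ballI) auto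
qed

lemma ex_less_functional:
  "\<exists>E\<in>D (T1 \<rightarrow> T0). \<forall>f\<in>D T1. E \<bullet> f = (if f \<bullet> \<zero> \<prec> f \<bullet> \<one> then \<zero> else \<one>)"
proof -
  have "sat e0 (decision_instance (Var T1 0 \<cdot> zero \<^bold>< Var T1 0 \<cdot> one))" for e
    using base by (auto simp: closed_base_def)
  then have "\<exists>E\<in>D (T1 \<rightarrow> T0). \<forall>f\<in>D T1.
      f \<bullet> \<zero> \<prec> f \<bullet> \<one> \<and> E \<bullet> f = \<zero> \<or> \<not> f \<bullet> \<zero> \<prec> f \<bullet> \<one> \<and> E \<bullet> f = \<one>"
    by (simp add: decision_instance_def choice_axiom_def) (use const_in(1,2) in blast)
  then show ?thesis by (elim bexE, intro bexI ballI) auto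
qed

end

section \<open>Definable functionals\<close>

text \<open>Combinatory terms with named variables, a separate name space for each type, and with
  elements of the model as parameters.\<close>

datatype 'a px = PV ty nat | PC ty 'a | PA "'a px" "'a px"  (infixl "\<odot>" 90)

primrec pty :: "'a px \<Rightarrow> ty" where
  "pty (PV \<sigma> n) = \<sigma>"
| "pty (PC \<sigma> a) = \<sigma>"
| "pty (s \<odot> t) = (case pty s of T0 \<Rightarrow> T0 | Fn \<sigma> \<tau> \<Rightarrow> \<tau>)"

definition upd :: "(ty \<Rightarrow> nat \<Rightarrow> 'a) \<Rightarrow> ty \<Rightarrow> nat \<Rightarrow> 'a \<Rightarrow> ty \<Rightarrow> nat \<Rightarrow> 'a" where
  "upd e \<sigma> n x = (\<lambda>\<tau> m. if \<tau> = \<sigma> \<and> m = n then x else e \<tau> m)"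

lemma upd_apply [simp]: "upd e \<sigma> n x \<tau> m = (if \<tau> = \<sigma> \<and> m = n then x else e \<tau> m)"
  by (simp add: upd_def)

context rca_model
begin

primrec ev :: "(ty \<Rightarrow> nat \<Rightarrow> 'a) \<Rightarrow> 'a px \<Rightarrow> 'a" where
  "ev e (PV \<sigma> n) = e \<sigma> n"
| "ev e (PC \<sigma> a) = a"
| "ev e (s \<odot> t) = ev e s \<bullet> ev e t"

primrec pwt :: "'a px \<Rightarrow> bool" where
  "pwt (PV \<sigma> n) \<longleftrightarrow> True"
| "pwt (PC \<sigma> a) \<longleftrightarrow> a \<in> D \<sigma>"
| "pwt (s \<odot> t) \<longleftrightarrow> pwt s \<and> pwt t \<and> pty s = (pty t \<rightarrow> pty (s \<odot> t))"

text \<open>Bracket abstraction by the combinators S and K. The identity SKK enters as an element of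
  the model, and the type annotations select the right instances of the combinators.\<close>

primrec lam :: "nat \<Rightarrow> ty \<Rightarrow> 'a px \<Rightarrow> 'a px" where
  "lam n \<sigma> (PV \<tau> m) =
    (if \<tau> = \<sigma> \<and> m = n
     then PC (\<sigma> \<rightarrow> \<sigma>) (I (Sigma \<sigma> (\<sigma> \<rightarrow> \<sigma>) \<sigma>) \<bullet> I (Pi \<sigma> (\<sigma> \<rightarrow> \<sigma>)) \<bullet> I (Pi \<sigma> \<sigma>))
     else PC (\<tau> \<rightarrow> \<sigma> \<rightarrow> \<tau>) (I (Pi \<tau> \<sigma>)) \<odot> PV \<tau> m)"
| "lam n \<sigma> (PC \<tau> a) = PC (\<tau> \<rightarrow> \<sigma> \<rightarrow> \<tau>) (I (Pi \<tau> \<sigma>)) \<odot> PC \<tau> a"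
| "lam n \<sigma> (s \<odot> t) =
    PC ((\<sigma> \<rightarrow> pty s) \<rightarrow> (\<sigma> \<rightarrow> pty t) \<rightarrow> \<sigma> \<rightarrow> pty (s \<odot> t)) (I (Sigma \<sigma> (pty t) (pty (s \<odot> t))))
      \<odot> lam n \<sigma> s \<odot> lam n \<sigma> t"

lemma SKK_in: "I (Sigma \<sigma> (\<sigma> \<rightarrow> \<sigma>) \<sigma>) \<bullet> I (Pi \<sigma> (\<sigma> \<rightarrow> \<sigma>)) \<bullet> I (Pi \<sigma> \<sigma>) \<in> D (\<sigma> \<rightarrow> \<sigma>)"
  by (meson ap_in const_in)

lemma SKK_eq: "x \<in> D \<sigma> \<Longrightarrow> I (Sigma \<sigma> (\<sigma> \<rightarrow> \<sigma>) \<sigma>) \<bullet> I (Pi \<sigma> (\<sigma> \<rightarrow> \<sigma>)) \<bullet> I (Pi \<sigma> \<sigma>) \<bullet> x = x"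
proof -
  assume x: "x \<in> D \<sigma>"
  then have "I (Pi \<sigma> \<sigma>) \<bullet> x \<in> D (\<sigma> \<rightarrow> \<sigma>)" by (meson ap_in const_in)
  then show ?thesis using x by (simp add: S_eq K_eq)
qed

lemma lam_wt: "pwt t \<Longrightarrow> pwt (lam n \<sigma> t) \<and> pty (lam n \<sigma> t) = (\<sigma> \<rightarrow> pty t)"
proof (induction t)
  case (PA s t)
  then obtain \<tau> where "pty s = (pty t \<rightarrow> \<tau>)" by auto
  then show ?case using PA by simp
qed (auto simp: SKK_in)

lemma pwt_lam [simp]: "pwt t \<Longrightarrow> pwt (lam n \<sigma> t)"
  and pty_lam [simp]: "pwt t \<Longrightarrow> pty (lam n \<sigma> t) = (\<sigma> \<rightarrow> pty t)"
  using lam_wt by auto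

lemma wt_env_upd [simp]: "wt_env e \<Longrightarrow> x \<in> D \<sigma> \<Longrightarrow> wt_env (upd e \<sigma> n x)"
  by (simp add: wt_env_def)

lemma ev_in0: "wt_env e \<Longrightarrow> pwt t \<Longrightarrow> ev e t \<in> D (pty t)"
proof (induction t)
  case (PA s t)
  then obtain \<tau> where "pty s = (pty t \<rightarrow> \<tau>)" by auto
  then show ?case using PA ap_in[of "ev e s" "pty t" \<tau>] by simp
qed (simp_all add: wt_env_def)

lemma ev_in [simp]: "wt_env e \<Longrightarrow> pwt t \<Longrightarrow> pty t = \<sigma> \<Longrightarrow> ev e t \<in> D \<sigma>"
  using ev_in0 by blast

lemma ev_lam [simp]:
  assumes "wt_env e" "pwt t" "x \<in> D \<sigma>"
  shows "ev e (lam n \<sigma> t) \<bullet> x = ev (upd e \<sigma> n x) t"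
  using assms(2)
proof (induction t)
  case (PV \<tau> m)
  have "e \<tau> m \<in> D \<tau>" using assms(1) by (simp add: wt_env_def)
  then show ?case using assms(3) by (auto simp: SKK_eq K_eq)
next
  case (PC \<tau> a)
  then show ?case using assms(3) by (simp add: K_eq)
next
  case (PA s t)
  then obtain \<tau> where ty: "pty s = (pty t \<rightarrow> \<tau>)" by auto
  have "ev e (lam n \<sigma> s) \<in> D (\<sigma> \<rightarrow> pty t \<rightarrow> \<tau>)"
    by (rule ev_in) (use PA.prems ty assms(1) in simp_all)
  moreover have "ev e (lam n \<sigma> t) \<in> D (\<sigma> \<rightarrow> pty t)"
    by (rule ev_in) (use PA.prems assms(1) in simp_all)
  ultimately show ?case using PA assms(3) ty S_eq by simp
qed

declare lam.simps [simp del]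

text \<open>Primitive recursion with values of type 0, the only type whose recursor has defining
  axioms. In the step term, variable i is the counter and variable j the previous value.\<close>

definition prec :: "nat \<Rightarrow> nat \<Rightarrow> 'a px \<Rightarrow> 'a px \<Rightarrow> 'a px" where
  "prec i j t a = PC ((T0 \<rightarrow> T0 \<rightarrow> T0) \<rightarrow> T0 \<rightarrow> T0 \<rightarrow> T0) (I (Rec T0)) \<odot> lam i T0 (lam j T0 t) \<odot> a"

lemma prec_wt [simp]:
  "pwt t \<Longrightarrow> pty t = T0 \<Longrightarrow> pwt a \<Longrightarrow> pty a = T0 \<Longrightarrow> pwt (prec i j t a)"
  "pwt t \<Longrightarrow> pty t = T0 \<Longrightarrow> pwt a \<Longrightarrow> pty a = T0 \<Longrightarrow> pty (prec i j t a) = T1"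
  by (simp_all add: prec_def)

lemma ev_prec [simp]:
  assumes "wt_env e" "pwt t" "pty t = T0" "pwt a" "pty a = T0"
  shows "ev e (prec i j t a) \<bullet> \<zero> = ev e a"
    and "n \<in> N \<Longrightarrow> ev e (prec i j t a) \<bullet> (n \<oplus> \<one>)
      = ev (upd (upd e T0 i n) T0 j (ev e (prec i j t a) \<bullet> n)) t"
proof -
  have 1: "ev e (lam i T0 (lam j T0 t)) \<in> D (T0 \<rightarrow> T0 \<rightarrow> T0)" "ev e a \<in> N"
    using assms by (auto intro!: ev_in)
  show "ev e (prec i j t a) \<bullet> \<zero> = ev e a"
    using Rec_eq(1)[OF 1] by (simp add: prec_def)
  assume n: "n \<in> N"
  have 2: "ev e (prec i j t a) \<in> D T1" using assms by simp
  have "ev e (prec i j t a) \<bullet> (n \<oplus> \<one>)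
      = ev e (lam i T0 (lam j T0 t)) \<bullet> n \<bullet> (ev e (prec i j t a) \<bullet> n)"
    using Rec_eq(2)[OF 1 n] by (simp add: prec_def)
  then show "ev e (prec i j t a) \<bullet> (n \<oplus> \<one>)
      = ev (upd (upd e T0 i n) T0 j (ev e (prec i j t a) \<bullet> n)) t"
    using assms n 2 by simp
qed

abbreviation bin :: "'a \<Rightarrow> 'a px \<Rightarrow> 'a px \<Rightarrow> 'a px" where
  "bin f s t \<equiv> PC (T0 \<rightarrow> T0 \<rightarrow> T0) f \<odot> s \<odot> t"


section \<open>Arithmetic in the model\<close>

lemma add_zero [simp]: "x \<in> N \<Longrightarrow> x \<oplus> \<zero> = x" "x \<in> N \<Longrightarrow> \<zero> \<oplus> x = x"
  using arith(3)[of x] arith(2)[of \<zero> x] by auto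

lemma add_left_commute:
  "x \<in> N \<Longrightarrow> y \<in> N \<Longrightarrow> w \<in> N \<Longrightarrow> x \<oplus> (y \<oplus> w) = y \<oplus> (x \<oplus> w)"
  using arith(1)[of x y w] arith(1)[of y x w] arith(2)[of x y] by simp

lemma mul_simps [simp]: "x \<in> N \<Longrightarrow> x \<otimes> \<zero> = \<zero>" "x \<in> N \<Longrightarrow> \<zero> \<otimes> x = \<zero>"
  "x \<in> N \<Longrightarrow> x \<otimes> \<one> = x" "x \<in> N \<Longrightarrow> \<one> \<otimes> x = x"
  using arith(6,7)[of x] arith(5)[of \<zero> x] arith(5)[of \<one> x] by auto

lemma less_irrefl [simp]: "x \<in> N \<Longrightarrow> \<not> x \<prec> x" by (rule arith(9))

lemma less_trans: "x \<prec> y \<Longrightarrow> y \<prec> w \<Longrightarrow> x \<in> N \<Longrightarrow> y \<in> N \<Longrightarrow> w \<in> N \<Longrightarrow> x \<prec> w"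
  using arith(10) by blast

lemma less_zero [simp]: "x \<in> N \<Longrightarrow> \<not> x \<prec> \<zero>"
  using arith(15)[of x] less_trans[of x \<zero> x] by auto

lemma add_less_cancel [simp]:
  assumes "x \<in> N" "y \<in> N" "w \<in> N"
  shows "x \<oplus> w \<prec> y \<oplus> w \<longleftrightarrow> x \<prec> y"
proof
  assume lt: "x \<oplus> w \<prec> y \<oplus> w"
  then have "x \<noteq> y" using assms by auto
  moreover have "\<not> y \<prec> x"
    using lt arith(12)[of y x w] less_trans[of "x \<oplus> w" "y \<oplus> w" "x \<oplus> w"] assms by auto
  ultimately show "x \<prec> y" using arith(11) assms by blast
qed (use arith(12) assms in blast)

lemma add_cancel [simp]:
  assumes "x \<in> N" "y \<in> N" "w \<in> N"
  shows "x \<oplus> w = y \<oplus> w \<longleftrightarrow> x = y"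
proof
  assume eq: "x \<oplus> w = y \<oplus> w"
  show "x = y"
    using arith(11)[OF assms(1,2)] add_less_cancel[OF assms] add_less_cancel[OF assms(2,1,3)] eq assms
    by auto
qed simp

lemma less_Suc [simp]: "x \<in> N \<Longrightarrow> x \<prec> x \<oplus> \<one>"
  using add_less_cancel[of \<zero> \<one> x] arith(14) arith(2)[of x \<one>] by simp

lemma Suc_neq_zero [simp]: "x \<in> N \<Longrightarrow> x \<oplus> \<one> \<noteq> \<zero>" "x \<in> N \<Longrightarrow> \<zero> \<noteq> x \<oplus> \<one>"
  using less_Suc[of x] less_zero[of x] by fastforce+

lemma less_add: "x \<in> N \<Longrightarrow> w \<in> N \<Longrightarrow> x \<prec> x \<oplus> w \<or> w = \<zero>"
  using add_less_cancel[of \<zero> w x] arith(15)[of w] arith(2)[of x w] by auto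

text \<open>Truth of a decision term is coded by zero. This law turns sums into conjunctions, and
  \<open>mul_eq_zero\<close> turns products into disjunctions; all decision terms below are read in
  this way.\<close>

lemma add_eq_zero [simp]: "x \<in> N \<Longrightarrow> w \<in> N \<Longrightarrow> x \<oplus> w = \<zero> \<longleftrightarrow> x = \<zero> \<and> w = \<zero>"
  using less_add[of x w] by fastforce

lemma mul_eq_zero [simp]: "x \<in> N \<Longrightarrow> y \<in> N \<Longrightarrow> x \<otimes> y = \<zero> \<longleftrightarrow> x = \<zero> \<or> y = \<zero>"
  using arith(13)[of \<zero> x y] arith(15)[of x] arith(15)[of y] by force

text \<open>The recursion packs x and y into a function with value x at zero and y at every
  successor; the functional obtained from choice then compares its values at zero and one.\<close>

definition eqE :: 'a where
  "eqE = ev e0 (lam 0 T0 (lam 1 T0 (PC (T1 \<rightarrow> T0)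
     (SOME E. E \<in> D (T1 \<rightarrow> T0) \<and> (\<forall>f\<in>D T1. E \<bullet> f = (if f \<bullet> \<zero> = f \<bullet> \<one> then \<zero> else \<one>)))
     \<odot> prec 2 3 (PV T0 1) (PV T0 0))))"

definition ltE :: 'a where
  "ltE = ev e0 (lam 0 T0 (lam 1 T0 (PC (T1 \<rightarrow> T0)
     (SOME E. E \<in> D (T1 \<rightarrow> T0) \<and> (\<forall>f\<in>D T1. E \<bullet> f = (if f \<bullet> \<zero> \<prec> f \<bullet> \<one> then \<zero> else \<one>)))
     \<odot> prec 2 3 (PV T0 1) (PV T0 0))))"

lemma ev_prec_one:
  assumes "wt_env e" "pwt t" "pty t = T0" "pwt a" "pty a = T0"
  shows "ev e (prec i j t a) \<bullet> \<one> = ev (upd (upd e T0 i \<zero>) T0 j (ev e a)) t"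
  using ev_prec(2)[OF assms, of \<zero>] ev_prec(1)[OF assms] by simp

lemma eqE_in [simp]: "eqE \<in> D (T0 \<rightarrow> T0 \<rightarrow> T0)"
  and eqE [simp]: "x \<in> N \<Longrightarrow> y \<in> N \<Longrightarrow> eqE \<bullet> x \<bullet> y = (if x = y then \<zero> else \<one>)"
proof -
  let ?P = "\<lambda>E. E \<in> D (T1 \<rightarrow> T0) \<and> (\<forall>f\<in>D T1. E \<bullet> f = (if f \<bullet> \<zero> = f \<bullet> \<one> then \<zero> else \<one>))"
  have E: "?P (SOME E. ?P E)" by (rule someI_ex) (use ex_eq_functional in blast)
  then show "eqE \<in> D (T0 \<rightarrow> T0 \<rightarrow> T0)" unfolding eqE_def by simp
  show "x \<in> N \<Longrightarrow> y \<in> N \<Longrightarrow> eqE \<bullet> x \<bullet> y = (if x = y then \<zero> else \<one>)"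
    using E unfolding eqE_def by (simp add: ev_prec_one)
qed

lemma ltE_in [simp]: "ltE \<in> D (T0 \<rightarrow> T0 \<rightarrow> T0)"
  and ltE [simp]: "x \<in> N \<Longrightarrow> y \<in> N \<Longrightarrow> ltE \<bullet> x \<bullet> y = (if x \<prec> y then \<zero> else \<one>)"
proof -
  let ?P = "\<lambda>E. E \<in> D (T1 \<rightarrow> T0) \<and> (\<forall>f\<in>D T1. E \<bullet> f = (if f \<bullet> \<zero> \<prec> f \<bullet> \<one> then \<zero> else \<one>))"
  have E: "?P (SOME E. ?P E)" by (rule someI_ex) (use ex_less_functional in blast)
  then show "ltE \<in> D (T0 \<rightarrow> T0 \<rightarrow> T0)" unfolding ltE_def by simp
  show "x \<in> N \<Longrightarrow> y \<in> N \<Longrightarrow> ltE \<bullet> x \<bullet> y = (if x \<prec> y then \<zero> else \<one>)"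
    using E unfolding ltE_def by (simp add: ev_prec_one)
qed

definition ntE :: 'a where
  "ntE = ev e0 (lam 0 T0 (bin eqE (bin eqE (PV T0 0) (PC T0 \<zero>)) (PC T0 \<one>)))"

lemma ntE_in [simp]: "ntE \<in> D T1"
  unfolding ntE_def by simp

lemma ntE [simp]: "x \<in> N \<Longrightarrow> ntE \<bullet> x = (if x = \<zero> then \<one> else \<zero>)"
  unfolding ntE_def by simp

text \<open>Induction in the model holds only for predicates expressed by a vanishing term. The term
  t certifies that P is of this kind, with other elements of the model as parameters.\<close>

lemma N_induct:
  assumes n: "n \<in> N" and t: "pwt t" "pty t = T0"
    and P: "\<And>n. n \<in> N \<Longrightarrow> P n \<longleftrightarrow> ev (upd e0 T0 0 n) t = \<zero>"
    and base: "P \<zero>" and step: "\<And>n. n \<in> N \<Longrightarrow> P n \<Longrightarrow> P (n \<oplus> \<one>)"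
  shows "P n"
proof -
  have eq: "ev e0 (lam 0 T0 t) \<bullet> m = \<zero> \<longleftrightarrow> P m" if "m \<in> N" for m
    using that t(1) P[OF that] by simp
  have "ev e0 (lam 0 T0 t) \<bullet> n = \<zero>"
  proof (rule induct0[OF _ _ _ n])
    show "ev e0 (lam 0 T0 t) \<in> D T1" using t by simp
    show "ev e0 (lam 0 T0 t) \<bullet> \<zero> = \<zero>" unfolding eq[OF const_in(1)] by (rule base)
    fix m assume m: "m \<in> N" "ev e0 (lam 0 T0 t) \<bullet> m = \<zero>"
    have "m \<oplus> \<one> \<in> N" using m(1) by simp
    from eq[OF this] show "ev e0 (lam 0 T0 t) \<bullet> (m \<oplus> \<one>) = \<zero>" using step m eq by blast
  qed
  then show ?thesis using eq[OF n] by blast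
qed

definition predE :: 'a where "predE = ev e0 (prec 0 1 (PV T0 0) (PC T0 \<zero>))"

lemma predE [simp]: "predE \<in> D T1" "predE \<bullet> \<zero> = \<zero>" "n \<in> N \<Longrightarrow> predE \<bullet> (n \<oplus> \<one>) = n"
  unfolding predE_def by simp_all

text \<open>Naming the witness by \<open>predE\<close> makes the claim quantifier-free, so that
  induction applies.\<close>

lemma N_cases: assumes "y \<in> N" shows "y = \<zero> \<or> (\<exists>w\<in>N. y = w \<oplus> \<one>)"
proof -
  have "y = \<zero> \<or> y = predE \<bullet> y \<oplus> \<one>"
    by (rule N_induct[OF assms, of "bin (I Times) (bin eqE (PV T0 0) (PC T0 \<zero>))
        (bin eqE (PV T0 0) (bin (I Plus) (PC T1 predE \<odot> PV T0 0) (PC T0 \<one>)))"]) simp_all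
  then show ?thesis using assms by fastforce
qed

lemma not_less_iff:
  assumes "x \<in> N" "y \<in> N" shows "\<not> y \<prec> x \<longleftrightarrow> (\<exists>w\<in>N. y = x \<oplus> w)"
proof
  \<comment> \<open>The value of M at n is the truncated difference of y and n, which names the
    witness w and so keeps the induction quantifier-free.\<close>
  define M where "M = ev e0 (prec 0 1 (PC T1 predE \<odot> PV T0 1) (PC T0 y))"
  have M [simp]: "M \<in> D T1" "M \<bullet> \<zero> = y" "\<And>n. n \<in> N \<Longrightarrow> M \<bullet> (n \<oplus> \<one>) = predE \<bullet> (M \<bullet> n)"
    using assms unfolding M_def by simp_all
  have "y \<prec> x \<or> y = x \<oplus> M \<bullet> x"
  proof (rule N_induct[OF assms(1), of "bin (I Times) (bin ltE (PC T0 y) (PV T0 0))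
      (bin eqE (PC T0 y) (bin (I Plus) (PV T0 0) (PC T1 M \<odot> PV T0 0)))"])
    fix n assume n: "n \<in> N" and IH: "y \<prec> n \<or> y = n \<oplus> M \<bullet> n"
    show "y \<prec> n \<oplus> \<one> \<or> y = n \<oplus> \<one> \<oplus> M \<bullet> (n \<oplus> \<one>)"
    proof (cases "y \<prec> n")
      case True
      then show ?thesis using less_trans[of y n "n \<oplus> \<one>"] n assms by simp
    next
      case False
      then have y: "y = n \<oplus> M \<bullet> n" using IH by simp
      from N_cases[of "M \<bullet> n"] n consider "M \<bullet> n = \<zero>" | w where "w \<in> N" "M \<bullet> n = w \<oplus> \<one>" by auto
      then show ?thesis
      proof cases
        case 1
        then have "y = n" using y n by simp
        then show ?thesis using n by simp
      next
        case 2
        then have "y = n \<oplus> \<one> \<oplus> w" using y n arith(1)[of n \<one> w] arith(2)[of \<one> w] by simp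
        then show ?thesis using 2 n by simp
      qed
    qed
  qed (use assms in simp_all)
  then show "\<not> y \<prec> x \<Longrightarrow> \<exists>w\<in>N. y = x \<oplus> w" using assms by auto
next
  assume "\<exists>w\<in>N. y = x \<oplus> w"
  then obtain w where w: "w \<in> N" "y = x \<oplus> w" by blast
  then show "\<not> y \<prec> x" using less_add[of x w] less_trans[of y x y] assms by auto
qed

lemma less_iff:
  assumes "x \<in> N" "y \<in> N" shows "x \<prec> y \<longleftrightarrow> (\<exists>w\<in>N. y = x \<oplus> w \<oplus> \<one>)"
proof
  assume lt: "x \<prec> y"
  then have "\<not> y \<prec> x" using less_trans[of x y x] assms by auto
  then obtain w where w: "w \<in> N" "y = x \<oplus> w" using not_less_iff assms by blast
  then have "w \<noteq> \<zero>" using lt assms by auto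
  then obtain v where "v \<in> N" "w = v \<oplus> \<one>" using N_cases w by blast
  then show "\<exists>w\<in>N. y = x \<oplus> w \<oplus> \<one>" using w assms arith(1)[of x v \<one>] const_in(2) by metis
next
  assume "\<exists>w\<in>N. y = x \<oplus> w \<oplus> \<one>"
  then obtain w where w: "w \<in> N" "y = x \<oplus> w \<oplus> \<one>" by blast
  then have "y = x \<oplus> (w \<oplus> \<one>)" using assms arith(1)[of x w \<one>] by simp
  then show "x \<prec> y" using less_add[of x "w \<oplus> \<one>"] w assms by auto
qed

lemma less_Suc_iff: 
  assumes "x \<in> N" "y \<in> N" shows "x \<prec> y \<oplus> \<one> \<longleftrightarrow> x \<prec> y \<or> x = y"
proof -
  have "x \<prec> y \<oplus> \<one> \<longleftrightarrow> (\<exists>w\<in>N. y = x \<oplus> w)" using assms by (auto simp: less_iff)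
  also have "\<dots> \<longleftrightarrow> \<not> y \<prec> x" using assms not_less_iff by blast
  also have "\<dots> \<longleftrightarrow> x \<prec> y \<or> x = y"
    using arith(11)[OF assms] less_trans[of x y x] assms by auto
  finally show ?thesis .
qed

text \<open>The pairing (x + y)^2 + x avoids the halving in Cantor's polynomial. It is injective but
  not surjective, which suffices for comparing codes.\<close>

definition prE :: 'a where
  "prE = ev e0 (lam 0 T0 (lam 1 T0 (bin (I Plus)
     (bin (I Times) (bin (I Plus) (PV T0 0) (PV T0 1)) (bin (I Plus) (PV T0 0) (PV T0 1)))
     (PV T0 0))))"

lemma prE_in [simp]: "prE \<in> D (T0 \<rightarrow> T0 \<rightarrow> T0)"
  unfolding prE_def by simp

lemma prE: "x \<in> N \<Longrightarrow> y \<in> N \<Longrightarrow> prE \<bullet> x \<bullet> y = (x \<oplus> y) \<otimes> (x \<oplus> y) \<oplus> x"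
  unfolding prE_def by simp

text \<open>A first component never exceeds the code, so a search for it can be bounded by the
  code.\<close>

lemma less_prE: "x \<in> N \<Longrightarrow> y \<in> N \<Longrightarrow> x \<prec> prE \<bullet> x \<bullet> y \<oplus> \<one>"
proof -
  assume xy: "x \<in> N" "y \<in> N"
  then have "prE \<bullet> x \<bullet> y = x \<oplus> (x \<oplus> y) \<otimes> (x \<oplus> y)" by (simp add: prE arith(2)[of x])
  then show ?thesis using xy less_iff[of x "prE \<bullet> x \<bullet> y \<oplus> \<one>"] by auto
qed

text \<open>Codes of pairs with sum s lie between s^2 and s^2 + s, whereas a larger sum s' gives
  codes of at least s'^2, which is at least s^2 + s + 1.\<close>

lemma sum_less_prE_less:
  assumes N: "x \<in> N" "y \<in> N" "x' \<in> N" "y' \<in> N" and lt: "x \<oplus> y \<prec> x' \<oplus> y'"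
  shows "prE \<bullet> x \<bullet> y \<prec> prE \<bullet> x' \<bullet> y'"
proof -
  define s s' where "s = x \<oplus> y" and "s' = x' \<oplus> y'"
  have S: "s \<in> N" "s' \<in> N" using N by (simp_all add: s_def s'_def)
  obtain w where w: "w \<in> N" "s' = s \<oplus> w \<oplus> \<one>" using lt S less_iff by (auto simp: s_def s'_def)
  have "x \<prec> s \<oplus> \<one>" using N less_iff[of x "s \<oplus> \<one>"] by (auto simp: s_def)
  then have 1: "s \<otimes> s \<oplus> x \<prec> s \<otimes> s \<oplus> (s \<oplus> \<one>)"
    using S N arith(2)[of "s \<otimes> s"] by simp
  have eq: "s' \<otimes> s' = s \<otimes> s \<oplus> (s \<oplus> \<one>) \<oplus> (w \<otimes> s \<oplus> s' \<otimes> w \<oplus> s \<oplus> w)"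
  proof -
    have "s' \<otimes> s' = s' \<otimes> s \<oplus> s' \<otimes> w \<oplus> s'"
      using S w arith(8)[of s' "s \<oplus> w" \<one>] arith(8)[of s' s w] by simp
    moreover have "s' \<otimes> s = s \<otimes> s \<oplus> w \<otimes> s \<oplus> s"
      using S w arith(8)[of s "s \<oplus> w" \<one>] arith(8)[of s s w] arith(5)[of s' s] arith(5)[of w s] by simp
    ultimately have "s' \<otimes> s' = s \<otimes> s \<oplus> w \<otimes> s \<oplus> s \<oplus> s' \<otimes> w \<oplus> (s \<oplus> w \<oplus> \<one>)"
      using w(2) by simp
    moreover have "a \<oplus> b \<oplus> s \<oplus> c \<oplus> (s \<oplus> w \<oplus> \<one>) = a \<oplus> (s \<oplus> \<one>) \<oplus> (b \<oplus> c \<oplus> s \<oplus> w)"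
      if "a \<in> N" "b \<in> N" "c \<in> N" for a b c
      using that S w(1) add_left_commute by (simp add: arith(1) arith(2) add_left_commute)
    ultimately show ?thesis using S w by simp
  qed
  have 2: "\<not> s' \<otimes> s' \<oplus> x' \<prec> s \<otimes> s \<oplus> (s \<oplus> \<one>)"
    using not_less_iff[of "s \<otimes> s \<oplus> (s \<oplus> \<one>)" "s' \<otimes> s' \<oplus> x'"] S N w
      arith(1)[of "s \<otimes> s \<oplus> (s \<oplus> \<one>)" "w \<otimes> s \<oplus> s' \<otimes> w \<oplus> s \<oplus> w" x'] eq by auto
  show ?thesis
    using 1 2 less_trans S N arith(11)[of "s \<otimes> s \<oplus> (s \<oplus> \<one>)" "s' \<otimes> s' \<oplus> x'"]
    by (auto simp: prE simp flip: s_def s'_def)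
qed

lemma prE_inject:
  assumes N: "x \<in> N" "y \<in> N" "x' \<in> N" "y' \<in> N" and eq: "prE \<bullet> x \<bullet> y = prE \<bullet> x' \<bullet> y'"
  shows "x = x' \<and> y = y'"
proof -
  have s: "x \<oplus> y = x' \<oplus> y'"
    using sum_less_prE_less[OF N] sum_less_prE_less[OF N(3,4,1,2)] arith(11)[of "x \<oplus> y" "x' \<oplus> y'"]
      eq N by auto
  then have "x = x'" using eq N prE arith(2)[of "(x' \<oplus> y') \<otimes> (x' \<oplus> y')"] by simp
  then show ?thesis using s N arith(2)[of x] by simp
qed

section \<open>Basic functionals\<close>

lemma ap_in_simps2 [simp]:
  "Y \<in> D (T1 \<rightarrow> T0 \<rightarrow> T0 \<rightarrow> T0) \<Longrightarrow> f \<in> D T1 \<Longrightarrow> Y \<bullet> f \<in> D (T0 \<rightarrow> T0 \<rightarrow> T0)"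
  "Z \<in> D (T0 \<rightarrow> T1 \<rightarrow> T1) \<Longrightarrow> x \<in> N \<Longrightarrow> Z \<bullet> x \<in> D (T1 \<rightarrow> T1)"
  "W \<in> D (T0 \<rightarrow> T1 \<rightarrow> T0) \<Longrightarrow> x \<in> N \<Longrightarrow> W \<bullet> x \<in> D (T1 \<rightarrow> T0)"
  by (rule ap_in; assumption)+

lemma fun_ext: "f \<in> D T1 \<Longrightarrow> g \<in> D T1 \<Longrightarrow> (\<And>x. x \<in> N \<Longrightarrow> f \<bullet> x = g \<bullet> x) \<Longrightarrow> f = g"
  by (rule extensional)

text \<open>The product of the values of h below n, starting from the empty product one; it vanishes
  exactly if one factor does, and so performs bounded search.\<close>

definition boundedE :: 'a where
  "boundedE = ev e0 (lam 0 T1 (prec 0 1 (bin (I Times) (PV T0 1) (PV T1 0 \<odot> PV T0 0)) (PC T0 \<one>)))"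

lemma boundedE_in [simp]: "boundedE \<in> D (T1 \<rightarrow> T0 \<rightarrow> T0)"
  unfolding boundedE_def by simp

lemma boundedE_eq_zero [simp]:
  assumes h: "h \<in> D T1" and n: "n \<in> N"
  shows "boundedE \<bullet> h \<bullet> n = \<zero> \<longleftrightarrow> (\<exists>j\<in>N. j \<prec> n \<and> h \<bullet> j = \<zero>)"
proof
  have B0: "boundedE \<bullet> h \<bullet> \<zero> = \<one>"
    using h unfolding boundedE_def by simp
  have BS: "boundedE \<bullet> h \<bullet> (m \<oplus> \<one>) = boundedE \<bullet> h \<bullet> m \<otimes> (h \<bullet> m)" if "m \<in> N" for m
    using that h unfolding boundedE_def by simp
  have B: "boundedE \<bullet> h \<in> D T1" using h by simp
  show "\<exists>j\<in>N. j \<prec> n \<and> h \<bullet> j = \<zero>" if "boundedE \<bullet> h \<bullet> n = \<zero>"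
  proof (rule ccontr)
    assume no: "\<not> (\<exists>j\<in>N. j \<prec> n \<and> h \<bullet> j = \<zero>)"
    \<comment> \<open>The first disjunct confines the induction to m up to n, where the assumption
      that h has no zero below n can be used in the step. The assumption itself has a quantifier and
      cannot be part of the induction formula.\<close>
    have "n \<prec> n \<or> boundedE \<bullet> h \<bullet> n \<noteq> \<zero>"
    proof (rule N_induct[OF n, where P = "\<lambda>m. n \<prec> m \<or> boundedE \<bullet> h \<bullet> m \<noteq> \<zero>"
          and t = "bin (I Times) (bin ltE (PC T0 n) (PV T0 0))
            (PC T1 ntE \<odot> (PC T1 (boundedE \<bullet> h) \<odot> PV T0 0))"])
      fix m assume m: "m \<in> N" and IH: "n \<prec> m \<or> boundedE \<bullet> h \<bullet> m \<noteq> \<zero>"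
      consider "n \<prec> m" | "n = m" | "m \<prec> n" using arith(11) m n by blast
      then show "n \<prec> m \<oplus> \<one> \<or> boundedE \<bullet> h \<bullet> (m \<oplus> \<one>) \<noteq> \<zero>"
      proof cases
        case 3
        then have "\<not> n \<prec> m" using less_trans[of m n m] m n by auto
        then show ?thesis using IH no m h 3 B by (auto simp: BS)
      qed (use m n in \<open>auto simp: less_Suc_iff\<close>)
    qed (use n h B B0 in simp_all)
    then show False using that n by simp
  qed
  show "boundedE \<bullet> h \<bullet> n = \<zero>" if "\<exists>j\<in>N. j \<prec> n \<and> h \<bullet> j = \<zero>"
  proof -
    from that obtain j where j: "j \<in> N" "j \<prec> n" "h \<bullet> j = \<zero>" by blast
    \<comment> \<open>The product vanishes from j + 1 on, so the claim is guarded by j being below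
      the current bound.\<close>
    have "\<not> j \<prec> n \<or> boundedE \<bullet> h \<bullet> n = \<zero>"
    proof (rule N_induct[OF n, of "bin (I Times) (PC T1 ntE \<odot> bin ltE (PC T0 j) (PV T0 0))
        (PC T1 (boundedE \<bullet> h) \<odot> PV T0 0)"])
      fix m assume m: "m \<in> N" and IH: "\<not> j \<prec> m \<or> boundedE \<bullet> h \<bullet> m = \<zero>"
      show "\<not> j \<prec> m \<oplus> \<one> \<or> boundedE \<bullet> h \<bullet> (m \<oplus> \<one>) = \<zero>"
        using IH m j h B by (auto simp: less_Suc_iff BS)
    qed (use j h B in simp_all)
    then show ?thesis using j by blast
  qed
qed

definition consE :: 'a where
  "consE = ev e0 (lam 0 T0 (lam 0 T1 (prec 1 2 (PV T1 0 \<odot> PV T0 1) (PV T0 0))))"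

definition tailE :: 'a where
  "tailE = ev e0 (lam 0 T1 (lam 0 T0 (PV T1 0 \<odot> bin (I Plus) (PV T0 0) (PC T0 \<one>))))"

text \<open>A retraction of Baire space onto Cantor space. Applying it turns a search over all
  functions into one over binary functions.\<close>

definition signE :: 'a where
  "signE = ev e0 (lam 0 T1 (lam 0 T0 (bin eqE (PV T1 0 \<odot> PV T0 0) (PC T0 \<zero>))))"

lemma list_in [simp]: "consE \<in> D (T0 \<rightarrow> T1 \<rightarrow> T1)" "tailE \<in> D (T1 \<rightarrow> T1)" "signE \<in> D (T1 \<rightarrow> T1)"
  unfolding consE_def tailE_def signE_def by simp_all

lemma consE [simp]:
  assumes "x \<in> N" "f \<in> D T1"
  shows "consE \<bullet> x \<bullet> f \<bullet> \<zero> = x" and "n \<in> N \<Longrightarrow> consE \<bullet> x \<bullet> f \<bullet> (n \<oplus> \<one>) = f \<bullet> n"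
    and "consE \<bullet> x \<bullet> f \<bullet> \<one> = f \<bullet> \<zero>"
proof -
  show *: "consE \<bullet> x \<bullet> f \<bullet> \<zero> = x" "n \<in> N \<Longrightarrow> consE \<bullet> x \<bullet> f \<bullet> (n \<oplus> \<one>) = f \<bullet> n" for n
    using assms unfolding consE_def by simp_all
  show "consE \<bullet> x \<bullet> f \<bullet> \<one> = f \<bullet> \<zero>" using *(2)[of \<zero>] by simp
qed

lemma tailE [simp]: "f \<in> D T1 \<Longrightarrow> n \<in> N \<Longrightarrow> tailE \<bullet> f \<bullet> n = f \<bullet> (n \<oplus> \<one>)"
  unfolding tailE_def by simp

lemma tailE_consE [simp]: "x \<in> N \<Longrightarrow> f \<in> D T1 \<Longrightarrow> tailE \<bullet> (consE \<bullet> x \<bullet> f) = f"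
  by (rule fun_ext) simp_all

lemma signE [simp]:
  "f \<in> D T1 \<Longrightarrow> n \<in> N \<Longrightarrow> signE \<bullet> f \<bullet> n = (if f \<bullet> n = \<zero> then \<zero> else \<one>)"
  unfolding signE_def by simp

definition is_bin :: "'a \<Rightarrow> bool" where
  "is_bin f \<longleftrightarrow> f \<in> D T1 \<and> (\<forall>k\<in>N. f \<bullet> k = \<zero> \<or> f \<bullet> k = \<one>)"

lemma is_bin_signE [simp]: "f \<in> D T1 \<Longrightarrow> is_bin (signE \<bullet> f)"
  by (simp add: is_bin_def)

lemma signE_id: "is_bin f \<Longrightarrow> signE \<bullet> f = f"
  by (rule fun_ext) (auto simp: is_bin_def)


section \<open>The principles in a model\<close>

definition NCC_holds :: bool where
  "NCC_holds \<longleftrightarrow> (\<forall>Y\<in>D (T1 \<rightarrow> T0 \<rightarrow> T0 \<rightarrow> T0).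
     (\<forall>n\<in>N. \<exists>m\<in>N. \<exists>f. is_bin f \<and> Y \<bullet> f \<bullet> m \<bullet> n = \<zero>) \<longrightarrow>
     (\<exists>g\<in>D T1. \<forall>n\<in>N. \<exists>f. is_bin f \<and> Y \<bullet> f \<bullet> (g \<bullet> n) \<bullet> n = \<zero>))"

definition BOOT_holds :: bool where
  "BOOT_holds \<longleftrightarrow> (\<forall>Y\<in>D (T1 \<rightarrow> T0 \<rightarrow> T0). \<exists>X. is_bin X \<and>
     (\<forall>n\<in>N. X \<bullet> n = \<one> \<longleftrightarrow> (\<exists>f\<in>D T1. Y \<bullet> f \<bullet> n = \<zero>)))"

definition Delta_CA_holds :: bool where
  "Delta_CA_holds \<longleftrightarrow> (\<forall>Y\<in>D (T1 \<rightarrow> T0 \<rightarrow> T0). \<forall>Z\<in>D (T1 \<rightarrow> T0 \<rightarrow> T0).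
     (\<forall>n\<in>N. (\<exists>f\<in>D T1. Y \<bullet> f \<bullet> n = \<zero>) \<longleftrightarrow> (\<forall>g\<in>D T1. Z \<bullet> g \<bullet> n = \<zero>)) \<longrightarrow>
     (\<exists>X. is_bin X \<and> (\<forall>n\<in>N. X \<bullet> n = \<one> \<longleftrightarrow> (\<exists>f\<in>D T1. Y \<bullet> f \<bullet> n = \<zero>))))"

lemma sat_NCC: "sat e NCC \<longleftrightarrow> NCC_holds"
  unfolding NCC_holds_def is_bin_def NCC_def NCC_matrix_def binary_def
  by (simp add: Let_def Bex_def Ball_def conj_ac)

lemma sat_BOOT: "sat e BOOT \<longleftrightarrow> BOOT_holds"
  unfolding BOOT_holds_def is_bin_def BOOT_def mem_def binary_def
  by (simp add: Let_def Bex_def conj_assoc flip: iff_conv_conj_imp)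

lemma sat_Delta_CA: "sat e Delta_CA \<longleftrightarrow> Delta_CA_holds"
  unfolding Delta_CA_holds_def is_bin_def Delta_CA_def mem_def binary_def
  by (simp add: Let_def Bex_def conj_assoc flip: iff_conv_conj_imp)

lemma choice01_imp_NCC:
  assumes choice: "\<And>W. W \<in> D (T0 \<rightarrow> T1 \<rightarrow> T0) \<Longrightarrow> (\<And>n. n \<in> N \<Longrightarrow> \<exists>h\<in>D T1. W \<bullet> n \<bullet> h = \<zero>) \<Longrightarrow>
      \<exists>F\<in>D (T0 \<rightarrow> T1). \<forall>n\<in>N. W \<bullet> n \<bullet> (F \<bullet> n) = \<zero>"
  shows NCC_holds
  unfolding NCC_holds_def
proof (intro ballI impI)
  fix Y assume Y: "Y \<in> D (T1 \<rightarrow> T0 \<rightarrow> T0 \<rightarrow> T0)"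
    and ex: "\<forall>n\<in>N. \<exists>m\<in>N. \<exists>f. is_bin f \<and> Y \<bullet> f \<bullet> m \<bullet> n = \<zero>"
  \<comment> \<open>One function h carries both objects to be chosen: m is its value at zero, and
    the binary witness is the sign of its tail.\<close>
  define W where "W = ev e0 (lam 0 T0 (lam 0 T1 (PC (T1 \<rightarrow> T0 \<rightarrow> T0 \<rightarrow> T0) Y
    \<odot> (PC (T1 \<rightarrow> T1) signE \<odot> (PC (T1 \<rightarrow> T1) tailE \<odot> PV T1 0)) \<odot> (PV T1 0 \<odot> PC T0 \<zero>) \<odot> PV T0 0)))"
  have W_in: "W \<in> D (T0 \<rightarrow> T1 \<rightarrow> T0)" using Y unfolding W_def by simp
  have W: "W \<bullet> n \<bullet> h = Y \<bullet> (signE \<bullet> (tailE \<bullet> h)) \<bullet> (h \<bullet> \<zero>) \<bullet> n" if "n \<in> N" "h \<in> D T1" for n h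
    using that Y unfolding W_def by simp
  have "\<exists>h\<in>D T1. W \<bullet> n \<bullet> h = \<zero>" if n: "n \<in> N" for n
  proof -
    from ex n obtain m f where mf: "m \<in> N" "is_bin f" "Y \<bullet> f \<bullet> m \<bullet> n = \<zero>" by blast
    then have f: "f \<in> D T1" by (simp add: is_bin_def)
    have "W \<bullet> n \<bullet> (consE \<bullet> m \<bullet> f) = \<zero>" using n f mf by (simp add: W signE_id)
    moreover have "consE \<bullet> m \<bullet> f \<in> D T1" using mf f by simp
    ultimately show ?thesis by blast
  qed
  from choice[OF W_in this] obtain F where F: "F \<in> D (T0 \<rightarrow> T1)"
    and WF: "\<forall>n\<in>N. W \<bullet> n \<bullet> (F \<bullet> n) = \<zero>" by blast
  define g where "g = ev e0 (lam 0 T0 (PC (T0 \<rightarrow> T1) F \<odot> PV T0 0 \<odot> PC T0 \<zero>))"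
  have g: "g \<in> D T1" "\<And>n. n \<in> N \<Longrightarrow> g \<bullet> n = F \<bullet> n \<bullet> \<zero>" using F unfolding g_def by simp_all
  have "\<exists>f. is_bin f \<and> Y \<bullet> f \<bullet> (g \<bullet> n) \<bullet> n = \<zero>" if n: "n \<in> N" for n
  proof (intro exI conjI)
    show "is_bin (signE \<bullet> (tailE \<bullet> (F \<bullet> n)))" using F n by simp
    show "Y \<bullet> (signE \<bullet> (tailE \<bullet> (F \<bullet> n))) \<bullet> (g \<bullet> n) \<bullet> n = \<zero>"
      using WF F n by (simp add: g W)
  qed
  then show "\<exists>g\<in>D T1. \<forall>n\<in>N. \<exists>f. is_bin f \<and> Y \<bullet> f \<bullet> (g \<bullet> n) \<bullet> n = \<zero>" using g(1) by blast
qed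

text \<open>Pairs \<open>(n, m)\<close> are only coded, never decoded: the existential quantifier of \<open>BOOT\<close> also
  guesses \<open>n\<close> and \<open>m\<close>, as the first two values of \<open>f\<close>.\<close>

lemma BOOT_imp_NCC:
  assumes BOOT_holds
  shows NCC_holds
  unfolding NCC_holds_def
proof (intro ballI impI)
  fix Y assume Y: "Y \<in> D (T1 \<rightarrow> T0 \<rightarrow> T0 \<rightarrow> T0)"
    and ex: "\<forall>n\<in>N. \<exists>m\<in>N. \<exists>f. is_bin f \<and> Y \<bullet> f \<bullet> m \<bullet> n = \<zero>"
  define Y' where "Y' = ev e0 (lam 0 T1 (lam 0 T0 (bin (I Plus)
    (bin eqE (PV T0 0) (bin prE (PV T1 0 \<odot> PC T0 \<zero>) (PV T1 0 \<odot> PC T0 \<one>)))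
    (PC (T1 \<rightarrow> T0 \<rightarrow> T0 \<rightarrow> T0) Y
      \<odot> (PC (T1 \<rightarrow> T1) signE \<odot> (PC (T1 \<rightarrow> T1) tailE \<odot> (PC (T1 \<rightarrow> T1) tailE \<odot> PV T1 0)))
      \<odot> (PV T1 0 \<odot> PC T0 \<one>) \<odot> (PV T1 0 \<odot> PC T0 \<zero>)))))"
  have Y'_in: "Y' \<in> D (T1 \<rightarrow> T0 \<rightarrow> T0)" using Y unfolding Y'_def by simp
  have Y': "Y' \<bullet> h \<bullet> q = \<zero> \<longleftrightarrow> q = prE \<bullet> (h \<bullet> \<zero>) \<bullet> (h \<bullet> \<one>) \<and>
      Y \<bullet> (signE \<bullet> (tailE \<bullet> (tailE \<bullet> h))) \<bullet> (h \<bullet> \<one>) \<bullet> (h \<bullet> \<zero>) = \<zero>" if "h \<in> D T1" "q \<in> N" for h q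
    using that Y unfolding Y'_def by simp
  from assms Y'_in obtain X where X: "is_bin X"
    "\<forall>q\<in>N. X \<bullet> q = \<one> \<longleftrightarrow> (\<exists>h\<in>D T1. Y' \<bullet> h \<bullet> q = \<zero>)" unfolding BOOT_holds_def by blast
  have X_in: "X \<in> D T1" using X by (simp add: is_bin_def)
  have X_iff: "X \<bullet> (prE \<bullet> n \<bullet> m) = \<one> \<longleftrightarrow> (\<exists>f. is_bin f \<and> Y \<bullet> f \<bullet> m \<bullet> n = \<zero>)"
    if nm: "n \<in> N" "m \<in> N" for n m
  proof
    assume "X \<bullet> (prE \<bullet> n \<bullet> m) = \<one>"
    then obtain h where h: "h \<in> D T1" "Y' \<bullet> h \<bullet> (prE \<bullet> n \<bullet> m) = \<zero>" using X nm by auto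
    then have "prE \<bullet> n \<bullet> m = prE \<bullet> (h \<bullet> \<zero>) \<bullet> (h \<bullet> \<one>)"
      "Y \<bullet> (signE \<bullet> (tailE \<bullet> (tailE \<bullet> h))) \<bullet> (h \<bullet> \<one>) \<bullet> (h \<bullet> \<zero>) = \<zero>" using Y' nm by auto
    moreover have "n = h \<bullet> \<zero> \<and> m = h \<bullet> \<one>"
      by (rule prE_inject) (use calculation h nm in simp_all)
    ultimately have "is_bin (signE \<bullet> (tailE \<bullet> (tailE \<bullet> h))) \<and>
        Y \<bullet> (signE \<bullet> (tailE \<bullet> (tailE \<bullet> h))) \<bullet> m \<bullet> n = \<zero>" using h by simp
    then show "\<exists>f. is_bin f \<and> Y \<bullet> f \<bullet> m \<bullet> n = \<zero>" ..
  next
    assume "\<exists>f. is_bin f \<and> Y \<bullet> f \<bullet> m \<bullet> n = \<zero>"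
    then obtain f where f: "is_bin f" "Y \<bullet> f \<bullet> m \<bullet> n = \<zero>" by blast
    then have f_in: "f \<in> D T1" by (simp add: is_bin_def)
    let ?h = "consE \<bullet> n \<bullet> (consE \<bullet> m \<bullet> f)"
    have "?h \<in> D T1" "Y' \<bullet> ?h \<bullet> (prE \<bullet> n \<bullet> m) = \<zero>" using nm f f_in by (simp_all add: Y' signE_id)
    then show "X \<bullet> (prE \<bullet> n \<bullet> m) = \<one>" using X nm by auto
  qed
  \<comment> \<open>The number n enters as the value of a function at zero, since choice is
    available for function arguments only; g then applies the choice functional to the constant
    function with value n.\<close>
  define W where "W = ev e0 (lam 0 T1 (lam 0 T0
    (bin eqE (PC T1 X \<odot> (bin prE (PV T1 0 \<odot> PC T0 \<zero>) (PV T0 0))) (PC T0 \<one>))))"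
  have W_in: "W \<in> D (T1 \<rightarrow> T0 \<rightarrow> T0)" using X_in unfolding W_def by simp
  have W: "W \<bullet> f \<bullet> m = \<zero> \<longleftrightarrow> X \<bullet> (prE \<bullet> (f \<bullet> \<zero>) \<bullet> m) = \<one>" if "f \<in> D T1" "m \<in> N" for f m
    using that X_in unfolding W_def by simp
  have "\<exists>m\<in>N. W \<bullet> f \<bullet> m = \<zero>" if f: "f \<in> D T1" for f
    using ex f X_iff[of "f \<bullet> \<zero>"] by (auto simp: W)
  from choice10[OF W_in this] obtain F where F: "F \<in> D (T1 \<rightarrow> T0)"
    and WF: "\<forall>f\<in>D T1. W \<bullet> f \<bullet> (F \<bullet> f) = \<zero>" by blast
  define c where "c = ev e0 (lam 0 T0 (lam 1 T0 (PV T0 0)))"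
  have c: "c \<in> D (T0 \<rightarrow> T1)" "\<And>n k. n \<in> N \<Longrightarrow> k \<in> N \<Longrightarrow> c \<bullet> n \<bullet> k = n"
    unfolding c_def by simp_all
  define g where "g = ev e0 (lam 0 T0 (PC (T1 \<rightarrow> T0) F \<odot> (PC (T0 \<rightarrow> T1) c \<odot> PV T0 0)))"
  have g: "g \<in> D T1" "\<And>n. n \<in> N \<Longrightarrow> g \<bullet> n = F \<bullet> (c \<bullet> n)" using F c unfolding g_def by simp_all
  have "\<exists>f. is_bin f \<and> Y \<bullet> f \<bullet> (g \<bullet> n) \<bullet> n = \<zero>" if n: "n \<in> N" for n
  proof -
    have "c \<bullet> n \<in> D T1" using c n by simp
    then show ?thesis using WF[rule_format, of "c \<bullet> n"] c F n X_iff by (simp add: W g)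
  qed
  then show "\<exists>g\<in>D T1. \<forall>n\<in>N. \<exists>f. is_bin f \<and> Y \<bullet> f \<bullet> (g \<bullet> n) \<bullet> n = \<zero>" using g(1) by blast
qed


section \<open>Coding functions by binary functions\<close>

text \<open>Zero marks membership in the graph. Whether q codes a pair (i, f(i)) is decided by
  trying all i up to q, so that q need not be decoded.\<close>

lemma ex_graph:
  assumes f: "f \<in> D T1"
  shows "\<exists>c. is_bin c \<and> (\<forall>i\<in>N. \<forall>j\<in>N. c \<bullet> (prE \<bullet> i \<bullet> j) = \<zero> \<longleftrightarrow> f \<bullet> i = j)"
proof -
  define G where "G = ev e0 (lam 0 T0 (lam 1 T0
    (bin eqE (PV T0 0) (bin prE (PV T0 1) (PC T1 f \<odot> PV T0 1)))))"
  have G: "G \<in> D (T0 \<rightarrow> T1)" "\<And>q i. q \<in> N \<Longrightarrow> i \<in> N \<Longrightarrow>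
      G \<bullet> q \<bullet> i = (if q = prE \<bullet> i \<bullet> (f \<bullet> i) then \<zero> else \<one>)" using f unfolding G_def by simp_all
  define c where "c = ev e0 (lam 0 T0 (bin eqE (PC (T1 \<rightarrow> T1) boundedE
    \<odot> (PC (T0 \<rightarrow> T1) G \<odot> PV T0 0) \<odot> bin (I Plus) (PV T0 0) (PC T0 \<one>)) (PC T0 \<zero>)))"
  have c_in: "c \<in> D T1" using G unfolding c_def by simp
  have c: "c \<bullet> q = (if \<exists>i\<in>N. i \<prec> q \<oplus> \<one> \<and> G \<bullet> q \<bullet> i = \<zero> then \<zero> else \<one>)" if "q \<in> N" for q
    using that G(1) unfolding c_def by simp
  have "is_bin c" using c_in c by (simp add: is_bin_def)
  moreover have "c \<bullet> (prE \<bullet> i \<bullet> j) = \<zero> \<longleftrightarrow> f \<bullet> i = j" if ij: "i \<in> N" "j \<in> N" for i j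
  proof -
    have "c \<bullet> (prE \<bullet> i \<bullet> j) = \<zero> \<longleftrightarrow>
        (\<exists>k\<in>N. k \<prec> prE \<bullet> i \<bullet> j \<oplus> \<one> \<and> prE \<bullet> i \<bullet> j = prE \<bullet> k \<bullet> (f \<bullet> k))"
      using ij f by (auto simp: c G(2))
    also have "\<dots> \<longleftrightarrow> f \<bullet> i = j"
      using prE_inject[OF ij] less_prE[OF ij] ap_in_simps(1)[OF f] ij(1) by blast
    finally show ?thesis .
  qed
  ultimately show ?thesis by blast
qed

definition sectionE :: 'a where
  "sectionE = ev e0 (lam 0 T1 (lam 0 T0 (lam 1 T0 (PV T1 0 \<odot> bin prE (PV T0 0) (PV T0 1)))))"

lemma sectionE [simp]:
  "sectionE \<in> D (T1 \<rightarrow> T0 \<rightarrow> T1)"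
  "c \<in> D T1 \<Longrightarrow> i \<in> N \<Longrightarrow> j \<in> N \<Longrightarrow> sectionE \<bullet> c \<bullet> i \<bullet> j = c \<bullet> (prE \<bullet> i \<bullet> j)"
  unfolding sectionE_def by simp_all

text \<open>\<open>Q\<close> decides whether the search for \<open>f(i)\<close> in the graph of \<open>f\<close> is going to succeed; this
  makes the search total.\<close>

lemma ex_decoder:
  assumes Q: "Q \<in> D (T1 \<rightarrow> T0 \<rightarrow> T0)"
    and sound: "\<forall>h\<in>D T1. \<forall>m\<in>N. Q \<bullet> h \<bullet> m = \<zero> \<longrightarrow> (\<exists>n\<in>N. h \<bullet> n = \<zero>)"
  shows "\<exists>d\<in>D (T1 \<rightarrow> T0 \<rightarrow> T1). \<forall>f\<in>D T1. \<exists>c. is_bin c \<and>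
    (\<forall>i\<in>N. \<forall>j\<in>N. sectionE \<bullet> c \<bullet> i \<bullet> j = \<zero> \<longleftrightarrow> f \<bullet> i = j) \<and>
    (\<forall>m\<in>N. \<forall>i\<in>N. d \<bullet> c \<bullet> m \<bullet> i = (if Q \<bullet> (sectionE \<bullet> c \<bullet> i) \<bullet> m = \<zero> then f \<bullet> i else \<zero>))"
proof -
  let ?sec = "\<lambda>h. PC (T1 \<rightarrow> T0 \<rightarrow> T1) sectionE
      \<odot> (PC (T1 \<rightarrow> T1) tailE \<odot> (PC (T1 \<rightarrow> T1) tailE \<odot> h)) \<odot> (h \<odot> PC T0 \<zero>)"
  \<comment> \<open>The argument h packs i, m and the code c of a function, in this order. The
    condition on j is an implication: if Q accepts row i of c, then j is a zero of that row.\<close>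
  define W where "W = ev e0 (lam 0 T1 (lam 0 T0 (bin (I Times)
    (PC T1 ntE \<odot> (PC (T1 \<rightarrow> T1) Q \<odot> ?sec (PV T1 0) \<odot> (PV T1 0 \<odot> PC T0 \<one>)))
    (?sec (PV T1 0) \<odot> PV T0 0))))"
  have W_in: "W \<in> D (T1 \<rightarrow> T0 \<rightarrow> T0)" using Q unfolding W_def by simp
  have W: "W \<bullet> h \<bullet> j = \<zero> \<longleftrightarrow>
      (Q \<bullet> (sectionE \<bullet> (tailE \<bullet> (tailE \<bullet> h)) \<bullet> (h \<bullet> \<zero>)) \<bullet> (h \<bullet> \<one>) = \<zero>
        \<longrightarrow> sectionE \<bullet> (tailE \<bullet> (tailE \<bullet> h)) \<bullet> (h \<bullet> \<zero>) \<bullet> j = \<zero>)" if "h \<in> D T1" "j \<in> N" for h j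
    using that Q unfolding W_def by simp
  have "\<exists>j\<in>N. W \<bullet> h \<bullet> j = \<zero>" if h: "h \<in> D T1" for h
  proof -
    let ?s = "sectionE \<bullet> (tailE \<bullet> (tailE \<bullet> h)) \<bullet> (h \<bullet> \<zero>)"
    have s: "?s \<in> D T1" "h \<bullet> \<one> \<in> N" using h by simp_all
    show ?thesis
    proof (cases "Q \<bullet> ?s \<bullet> (h \<bullet> \<one>) = \<zero>")
      case True
      from sound s this obtain j where "j \<in> N" "?s \<bullet> j = \<zero>" by blast
      then show ?thesis using W[OF h] by blast
    next
      case False
      \<comment> \<open>Where Q rejects, the implication is vacuous and any number will do.\<close>
      then show ?thesis using h by (intro bexI[of _ \<zero>]) (simp_all only: W const_in simp_thms)
    qed
  qed
  from choice10[OF W_in this] obtain F where F: "F \<in> D (T1 \<rightarrow> T0)"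
    and WF: "\<forall>h\<in>D T1. W \<bullet> h \<bullet> (F \<bullet> h) = \<zero>" by blast
  \<comment> \<open>The second factor is one where Q accepts and zero where it rejects, so that the
    arbitrary choice made by F in the latter case is replaced by the default zero.\<close>
  define d where "d = ev e0 (lam 0 T1 (lam 0 T0 (lam 1 T0 (bin (I Times)
    (PC (T1 \<rightarrow> T0) F \<odot> (PC (T0 \<rightarrow> T1 \<rightarrow> T1) consE \<odot> PV T0 1
      \<odot> (PC (T0 \<rightarrow> T1 \<rightarrow> T1) consE \<odot> PV T0 0 \<odot> PV T1 0)))
    (PC T1 ntE \<odot> (PC (T1 \<rightarrow> T1) Q \<odot> (PC (T1 \<rightarrow> T0 \<rightarrow> T1) sectionE \<odot> PV T1 0 \<odot> PV T0 1) \<odot> PV T0 0))))))"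
  have d_in: "d \<in> D (T1 \<rightarrow> T0 \<rightarrow> T1)" using F Q unfolding d_def by simp
  have d: "d \<bullet> c \<bullet> m \<bullet> i = F \<bullet> (consE \<bullet> i \<bullet> (consE \<bullet> m \<bullet> c))
      \<otimes> (if Q \<bullet> (sectionE \<bullet> c \<bullet> i) \<bullet> m = \<zero> then \<one> else \<zero>)"
    if "c \<in> D T1" "m \<in> N" "i \<in> N" for c m i
    using that F Q unfolding d_def by simp
  have "\<exists>c. is_bin c \<and> (\<forall>i\<in>N. \<forall>j\<in>N. sectionE \<bullet> c \<bullet> i \<bullet> j = \<zero> \<longleftrightarrow> f \<bullet> i = j) \<and>
    (\<forall>m\<in>N. \<forall>i\<in>N. d \<bullet> c \<bullet> m \<bullet> i = (if Q \<bullet> (sectionE \<bullet> c \<bullet> i) \<bullet> m = \<zero> then f \<bullet> i else \<zero>))"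
    if f: "f \<in> D T1" for f
  proof -
    from ex_graph[OF f] obtain c where c: "is_bin c"
      and graph: "\<forall>i\<in>N. \<forall>j\<in>N. c \<bullet> (prE \<bullet> i \<bullet> j) = \<zero> \<longleftrightarrow> f \<bullet> i = j" by blast
    have c_in: "c \<in> D T1" using c by (simp add: is_bin_def)
    have sec: "sectionE \<bullet> c \<bullet> i \<bullet> j = \<zero> \<longleftrightarrow> f \<bullet> i = j" if "i \<in> N" "j \<in> N" for i j
      using graph that c_in by simp
    have "d \<bullet> c \<bullet> m \<bullet> i = (if Q \<bullet> (sectionE \<bullet> c \<bullet> i) \<bullet> m = \<zero> then f \<bullet> i else \<zero>)"
      if mi: "m \<in> N" "i \<in> N" for m i
    proof -
      let ?h = "consE \<bullet> i \<bullet> (consE \<bullet> m \<bullet> c)"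
      have h: "?h \<in> D T1" "F \<bullet> ?h \<in> N" using mi c_in F by simp_all
      have "W \<bullet> ?h \<bullet> (F \<bullet> ?h) = \<zero>" using WF h by blast
      then have "f \<bullet> i = F \<bullet> ?h" if "Q \<bullet> (sectionE \<bullet> c \<bullet> i) \<bullet> m = \<zero>"
        using that h mi c_in sec[of i "F \<bullet> ?h"] unfolding W[OF h] by (simp del: sectionE)
      then show ?thesis using h mi c_in by (simp add: d)
    qed
    then show ?thesis using c sec by blast
  qed
  then show ?thesis using d_in by blast
qed

text \<open>Grilliot's trick: if \<open>F(f) = 0\<close> but \<open>F\<close> has no zero among the bounded functions, then \<open>F\<close> is
  discontinuous at \<open>f\<close> along the truncations \<open>J h\<close> of \<open>f\<close>, and \<open>h \<mapsto> F(J h)\<close> decides whether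
  \<open>h\<close> has a zero.\<close>

lemma grilliot:
  assumes no_E: "\<not> (\<exists>E\<in>D (T1 \<rightarrow> T0). \<forall>h\<in>D T1. E \<bullet> h = \<zero> \<longleftrightarrow> (\<exists>n\<in>N. h \<bullet> n = \<zero>))"
    and F: "F \<in> D (T1 \<rightarrow> T0)" and f: "f \<in> D T1" "F \<bullet> f = \<zero>"
  shows "\<exists>k\<in>N. \<exists>g\<in>D T1. F \<bullet> g = \<zero> \<and> (\<forall>i\<in>N. g \<bullet> i = \<zero> \<or> g \<bullet> i \<prec> k)"
proof (rule ccontr)
  assume "\<not> ?thesis"
  then have nz: "F \<bullet> g \<noteq> \<zero>" if "k \<in> N" "g \<in> D T1" "\<forall>i\<in>N. g \<bullet> i = \<zero> \<or> g \<bullet> i \<prec> k" for k g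
    using that by blast
  \<comment> \<open>The value f(i) is kept only if h has no zero up to and including f(i). The added
    one includes f(i) itself, so that a zero n of h leaves only values strictly below n.\<close>
  define J where "J = ev e0 (lam 0 T1 (lam 0 T0 (bin (I Times) (PC T1 f \<odot> PV T0 0)
    (bin eqE (PC (T1 \<rightarrow> T1) boundedE \<odot> PV T1 0 \<odot> bin (I Plus) (PC T1 f \<odot> PV T0 0) (PC T0 \<one>))
      (PC T0 \<zero>)))))"
  have J_in: "J \<in> D (T1 \<rightarrow> T1)" using f unfolding J_def by simp
  have J: "J \<bullet> h \<bullet> i = (if \<exists>j\<in>N. j \<prec> f \<bullet> i \<oplus> \<one> \<and> h \<bullet> j = \<zero> then \<zero> else f \<bullet> i)"
    if "h \<in> D T1" "i \<in> N" for h i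
    using that f unfolding J_def by auto
  define E where "E = ev e0 (lam 0 T1 (PC T1 ntE \<odot> (PC (T1 \<rightarrow> T0) F \<odot> (PC (T1 \<rightarrow> T1) J \<odot> PV T1 0))))"
  have E_in: "E \<in> D (T1 \<rightarrow> T0)" using F J_in unfolding E_def by simp
  have E: "E \<bullet> h = \<zero> \<longleftrightarrow> F \<bullet> (J \<bullet> h) \<noteq> \<zero>" if "h \<in> D T1" for h
    using that F J_in unfolding E_def by simp
  have "E \<bullet> h = \<zero> \<longleftrightarrow> (\<exists>n\<in>N. h \<bullet> n = \<zero>)" if h: "h \<in> D T1" for h
  proof (cases "\<exists>n\<in>N. h \<bullet> n = \<zero>")
    case True
    then obtain n where n: "n \<in> N" "h \<bullet> n = \<zero>" by blast
    have "J \<bullet> h \<bullet> i = \<zero> \<or> J \<bullet> h \<bullet> i \<prec> n" if i: "i \<in> N" for i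
      using n i f h arith(11)[of "f \<bullet> i" n] by (auto simp: J less_Suc_iff)
    then have "F \<bullet> (J \<bullet> h) \<noteq> \<zero>" using nz[of n "J \<bullet> h"] n h J_in by simp
    then show ?thesis using True E h by simp
  next
    case False
    have "J \<bullet> h = f" by (rule fun_ext) (use False h f J_in in \<open>auto simp: J\<close>)
    then show ?thesis using False E h f by simp
  qed
  then show False using no_E E_in by blast
qed

text \<open>The second argument of the decoder is a search bound in the absence of \<exists>^2 and
  has no effect on decoding in its presence. Success at k and at k + 1 leaves the parity of the
  bound free for another purpose.\<close>

lemma ex_uniform_decoder:
  "\<exists>d\<in>D (T1 \<rightarrow> T0 \<rightarrow> T1). \<forall>F\<in>D (T1 \<rightarrow> T0). (\<exists>f\<in>D T1. F \<bullet> f = \<zero>) \<longrightarrow>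
     (\<exists>k\<in>N. \<exists>c. is_bin c \<and> F \<bullet> (d \<bullet> c \<bullet> k) = \<zero> \<and> F \<bullet> (d \<bullet> c \<bullet> (k \<oplus> \<one>)) = \<zero>)"
proof (cases "\<exists>E\<in>D (T1 \<rightarrow> T0). \<forall>h\<in>D T1. E \<bullet> h = \<zero> \<longleftrightarrow> (\<exists>n\<in>N. h \<bullet> n = \<zero>)")
  case True
  then obtain E where E: "E \<in> D (T1 \<rightarrow> T0)" "\<forall>h\<in>D T1. E \<bullet> h = \<zero> \<longleftrightarrow> (\<exists>n\<in>N. h \<bullet> n = \<zero>)" by blast
  define Q where "Q = ev e0 (lam 0 T1 (lam 0 T0 (PC (T1 \<rightarrow> T0) E \<odot> PV T1 0)))"
  have Q: "Q \<in> D (T1 \<rightarrow> T0 \<rightarrow> T0)" "\<And>h m. h \<in> D T1 \<Longrightarrow> m \<in> N \<Longrightarrow> Q \<bullet> h \<bullet> m = E \<bullet> h"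
    using E(1) unfolding Q_def by simp_all
  have sound: "\<forall>h\<in>D T1. \<forall>m\<in>N. Q \<bullet> h \<bullet> m = \<zero> \<longrightarrow> (\<exists>n\<in>N. h \<bullet> n = \<zero>)"
    using E(2) Q(2) by simp
  obtain d where d_in: "d \<in> D (T1 \<rightarrow> T0 \<rightarrow> T1)" and d: "\<forall>f\<in>D T1. \<exists>c. is_bin c \<and>
    (\<forall>i\<in>N. \<forall>j\<in>N. sectionE \<bullet> c \<bullet> i \<bullet> j = \<zero> \<longleftrightarrow> f \<bullet> i = j) \<and>
    (\<forall>m\<in>N. \<forall>i\<in>N. d \<bullet> c \<bullet> m \<bullet> i = (if Q \<bullet> (sectionE \<bullet> c \<bullet> i) \<bullet> m = \<zero> then f \<bullet> i else \<zero>))"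
    using ex_decoder[OF Q(1) sound] by blast
  have dec: "\<exists>c. is_bin c \<and> (\<forall>m\<in>N. d \<bullet> c \<bullet> m = f)" if f: "f \<in> D T1" for f
  proof -
    from d f obtain c where c: "is_bin c"
      and sec: "\<forall>i\<in>N. \<forall>j\<in>N. sectionE \<bullet> c \<bullet> i \<bullet> j = \<zero> \<longleftrightarrow> f \<bullet> i = j"
      and dc: "\<forall>m\<in>N. \<forall>i\<in>N. d \<bullet> c \<bullet> m \<bullet> i = (if Q \<bullet> (sectionE \<bullet> c \<bullet> i) \<bullet> m = \<zero> then f \<bullet> i else \<zero>)"
      by blast
    have c_in: "c \<in> D T1" using c by (simp add: is_bin_def)
    have "d \<bullet> c \<bullet> m = f" if m: "m \<in> N" for m
    proof (rule fun_ext)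
      fix i assume i: "i \<in> N"
      have s: "sectionE \<bullet> c \<bullet> i \<in> D T1" using c_in i by simp
      have "\<exists>j\<in>N. sectionE \<bullet> c \<bullet> i \<bullet> j = \<zero>" using sec i f by (metis ap_in_simps(1))
      then have "Q \<bullet> (sectionE \<bullet> c \<bullet> i) \<bullet> m = \<zero>" using E(2) Q(2) s m by simp
      then show "d \<bullet> c \<bullet> m \<bullet> i = f \<bullet> i" using dc m i by simp
    qed (use d_in c_in m f in simp_all)
    then show ?thesis using c by blast
  qed
  show ?thesis
  proof (intro bexI[OF _ d_in] ballI impI)
    fix F assume "\<exists>f\<in>D T1. F \<bullet> f = \<zero>"
    then obtain f where f: "f \<in> D T1" "F \<bullet> f = \<zero>" by blast
    from dec[OF f(1)] obtain c where "is_bin c" "\<forall>m\<in>N. d \<bullet> c \<bullet> m = f" by blast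
    then show "\<exists>k\<in>N. \<exists>c. is_bin c \<and> F \<bullet> (d \<bullet> c \<bullet> k) = \<zero> \<and> F \<bullet> (d \<bullet> c \<bullet> (k \<oplus> \<one>)) = \<zero>"
      using f by (intro bexI[of _ \<zero>] exI[of _ c]) simp_all
  qed
next
  case False
  have sound: "\<forall>h\<in>D T1. \<forall>m\<in>N. boundedE \<bullet> h \<bullet> m = \<zero> \<longrightarrow> (\<exists>n\<in>N. h \<bullet> n = \<zero>)"
    using boundedE_eq_zero by blast
  obtain d where d_in: "d \<in> D (T1 \<rightarrow> T0 \<rightarrow> T1)" and d: "\<forall>f\<in>D T1. \<exists>c. is_bin c \<and>
    (\<forall>i\<in>N. \<forall>j\<in>N. sectionE \<bullet> c \<bullet> i \<bullet> j = \<zero> \<longleftrightarrow> f \<bullet> i = j) \<and>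
    (\<forall>m\<in>N. \<forall>i\<in>N. d \<bullet> c \<bullet> m \<bullet> i = (if boundedE \<bullet> (sectionE \<bullet> c \<bullet> i) \<bullet> m = \<zero> then f \<bullet> i else \<zero>))"
    using ex_decoder[OF boundedE_in sound] by blast
  show ?thesis
  proof (intro bexI[OF _ d_in] ballI impI)
    fix F assume F: "F \<in> D (T1 \<rightarrow> T0)" and "\<exists>f\<in>D T1. F \<bullet> f = \<zero>"
    then obtain k g where k: "k \<in> N" and g: "g \<in> D T1" "F \<bullet> g = \<zero>"
      "\<forall>i\<in>N. g \<bullet> i = \<zero> \<or> g \<bullet> i \<prec> k" using grilliot[OF False F] by blast
    from d g obtain c where c: "is_bin c"
      and sec: "\<forall>i\<in>N. \<forall>j\<in>N. sectionE \<bullet> c \<bullet> i \<bullet> j = \<zero> \<longleftrightarrow> g \<bullet> i = j"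
      and dc: "\<forall>m\<in>N. \<forall>i\<in>N. d \<bullet> c \<bullet> m \<bullet> i =
        (if boundedE \<bullet> (sectionE \<bullet> c \<bullet> i) \<bullet> m = \<zero> then g \<bullet> i else \<zero>)" by blast
    have c_in: "c \<in> D T1" using c by (simp add: is_bin_def)
    \<comment> \<open>A value below m is found by the search, and the value zero is also the default
      of d; hence it is correct even if m is zero and nothing is searched.\<close>
    have dec: "d \<bullet> c \<bullet> m = g" if m: "m \<in> N" "\<forall>i\<in>N. g \<bullet> i = \<zero> \<or> g \<bullet> i \<prec> m" for m
    proof (rule fun_ext)
      fix i assume i: "i \<in> N"
      have s: "sectionE \<bullet> c \<bullet> i \<in> D T1" using c_in i by simp
      have "boundedE \<bullet> (sectionE \<bullet> c \<bullet> i) \<bullet> m = \<zero>" if "g \<bullet> i \<prec> m"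
        unfolding boundedE_eq_zero[OF s m(1)] using sec i g(1) that by (intro bexI[of _ "g \<bullet> i"]) auto
      then show "d \<bullet> c \<bullet> m \<bullet> i = g \<bullet> i" using dc m i by auto
    qed (use d_in c_in m g in simp_all)
    have "\<forall>i\<in>N. g \<bullet> i = \<zero> \<or> g \<bullet> i \<prec> k \<oplus> \<one>" using g k by (auto simp: less_Suc_iff)
    then have "d \<bullet> c \<bullet> k = g" "d \<bullet> c \<bullet> (k \<oplus> \<one>) = g" using dec k g by simp_all
    then show "\<exists>k\<in>N. \<exists>c. is_bin c \<and> F \<bullet> (d \<bullet> c \<bullet> k) = \<zero> \<and> F \<bullet> (d \<bullet> c \<bullet> (k \<oplus> \<one>)) = \<zero>"
      using k c g by (intro bexI[of _ k] exI[of _ c]) simp_all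
  qed
qed

text \<open>The parity of the number chosen by \<open>NCC\<close> records which of the two cases has been witnessed.\<close>

lemma NCC_imp_Delta_CA:
  assumes NCC: NCC_holds
  shows Delta_CA_holds
  unfolding Delta_CA_holds_def
proof (intro ballI impI)
  fix Y Z assume Y: "Y \<in> D (T1 \<rightarrow> T0 \<rightarrow> T0)" and Z: "Z \<in> D (T1 \<rightarrow> T0 \<rightarrow> T0)"
    and YZ: "\<forall>n\<in>N. (\<exists>f\<in>D T1. Y \<bullet> f \<bullet> n = \<zero>) \<longleftrightarrow> (\<forall>g\<in>D T1. Z \<bullet> g \<bullet> n = \<zero>)"
  obtain d where d: "d \<in> D (T1 \<rightarrow> T0 \<rightarrow> T1)" and dec: "\<And>F. F \<in> D (T1 \<rightarrow> T0) \<Longrightarrow> \<exists>f\<in>D T1. F \<bullet> f = \<zero> \<Longrightarrow>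
      \<exists>k\<in>N. \<exists>c. is_bin c \<and> F \<bullet> (d \<bullet> c \<bullet> k) = \<zero> \<and> F \<bullet> (d \<bullet> c \<bullet> (k \<oplus> \<one>)) = \<zero>"
    using ex_uniform_decoder by blast
  \<comment> \<open>The parity function: its value is zero at even numbers and one at odd
    ones.\<close>
  define p where "p = ev e0 (prec 0 1 (PC T1 ntE \<odot> PV T0 1) (PC T0 \<zero>))"
  have p: "p \<in> D T1" "\<And>n. n \<in> N \<Longrightarrow> p \<bullet> (n \<oplus> \<one>) = ntE \<bullet> (p \<bullet> n)" unfolding p_def by simp_all
  let ?dec = "PC (T1 \<rightarrow> T0 \<rightarrow> T1) d \<odot> PV T1 0 \<odot> PV T0 0" and ?p = "PC T1 p \<odot> PV T0 0"
  \<comment> \<open>The number m serves as bound of the decoder and, through its parity, as the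
    choice between Y and the negation of Z. The two factors are the two alternatives, each a
    conjunction written as a sum.\<close>
  define V where "V = ev e0 (lam 0 T1 (lam 0 T0 (lam 1 T0 (bin (I Times)
    (bin (I Plus) ?p (PC (T1 \<rightarrow> T1) Y \<odot> ?dec \<odot> PV T0 1))
    (bin (I Plus) (PC T1 ntE \<odot> ?p) (PC T1 ntE \<odot> (PC (T1 \<rightarrow> T1) Z \<odot> ?dec \<odot> PV T0 1)))))))"
  have V_in: "V \<in> D (T1 \<rightarrow> T0 \<rightarrow> T0 \<rightarrow> T0)" using d p Y Z unfolding V_def by simp
  have V: "V \<bullet> c \<bullet> m \<bullet> n = \<zero> \<longleftrightarrow>
      p \<bullet> m = \<zero> \<and> Y \<bullet> (d \<bullet> c \<bullet> m) \<bullet> n = \<zero> \<or> p \<bullet> m \<noteq> \<zero> \<and> Z \<bullet> (d \<bullet> c \<bullet> m) \<bullet> n \<noteq> \<zero>"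
    if "c \<in> D T1" "m \<in> N" "n \<in> N" for c m n
    using that d p Y Z unfolding V_def by simp
  have "\<exists>m\<in>N. \<exists>c. is_bin c \<and> V \<bullet> c \<bullet> m \<bullet> n = \<zero>" if n: "n \<in> N" for n
  proof (cases "\<exists>f\<in>D T1. Y \<bullet> f \<bullet> n = \<zero>")
    case True
    define F where "F = ev e0 (lam 0 T1 (PC (T1 \<rightarrow> T1) Y \<odot> PV T1 0 \<odot> PC T0 n))"
    have F: "F \<in> D (T1 \<rightarrow> T0)" "\<And>f. f \<in> D T1 \<Longrightarrow> F \<bullet> f = Y \<bullet> f \<bullet> n"
      using Y n unfolding F_def by simp_all
    obtain k c where k: "k \<in> N" and c: "is_bin c"
      and Fc: "F \<bullet> (d \<bullet> c \<bullet> k) = \<zero>" "F \<bullet> (d \<bullet> c \<bullet> (k \<oplus> \<one>)) = \<zero>"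
      using dec[OF F(1)] True F(2) by auto
    have c_in: "c \<in> D T1" using c by (simp add: is_bin_def)
    \<comment> \<open>Of the two consecutive bounds, the one with the parity assigned to Y is
      taken.\<close>
    obtain m where m: "m \<in> N" "p \<bullet> m = \<zero>" "F \<bullet> (d \<bullet> c \<bullet> m) = \<zero>"
    proof (cases "p \<bullet> k = \<zero>")
      case True
      then show ?thesis using that k Fc by blast
    next
      case False
      then have "p \<bullet> (k \<oplus> \<one>) = \<zero>" using p k by simp
      then show ?thesis using that[of "k \<oplus> \<one>"] k Fc by simp
    qed
    have "V \<bullet> c \<bullet> m \<bullet> n = \<zero>" using m c_in n d F by (simp add: V)
    then show ?thesis using m c by blast
  next
    case False
    define F where "F = ev e0 (lam 0 T1 (PC T1 ntE \<odot> (PC (T1 \<rightarrow> T1) Z \<odot> PV T1 0 \<odot> PC T0 n)))"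
    have F: "F \<in> D (T1 \<rightarrow> T0)" "\<And>f. f \<in> D T1 \<Longrightarrow> F \<bullet> f = \<zero> \<longleftrightarrow> Z \<bullet> f \<bullet> n \<noteq> \<zero>"
      using Z n unfolding F_def by simp_all
    have "\<exists>f\<in>D T1. F \<bullet> f = \<zero>" using YZ False F(2) n by blast
    from dec[OF F(1) this] obtain k c where k: "k \<in> N" and c: "is_bin c"
      and Fc: "F \<bullet> (d \<bullet> c \<bullet> k) = \<zero>" "F \<bullet> (d \<bullet> c \<bullet> (k \<oplus> \<one>)) = \<zero>" by blast
    have c_in: "c \<in> D T1" using c by (simp add: is_bin_def)
    obtain m where m: "m \<in> N" "p \<bullet> m \<noteq> \<zero>" "F \<bullet> (d \<bullet> c \<bullet> m) = \<zero>"
    proof (cases "p \<bullet> k = \<zero>")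
      case True
      then have "p \<bullet> (k \<oplus> \<one>) \<noteq> \<zero>" using p k by simp
      then show ?thesis using that[of "k \<oplus> \<one>"] k Fc by simp
    next
      case False
      then show ?thesis using that k Fc by blast
    qed
    have "V \<bullet> c \<bullet> m \<bullet> n = \<zero>" using m c_in n d F by (simp add: V)
    then show ?thesis using m c by blast
  qed
  then obtain g where g: "g \<in> D T1" and Vg: "\<forall>n\<in>N. \<exists>c. is_bin c \<and> V \<bullet> c \<bullet> (g \<bullet> n) \<bullet> n = \<zero>"
    using NCC V_in unfolding NCC_holds_def by blast
  \<comment> \<open>Membership in a set is coded by the value one, contrary to the zero of decision
    terms; \<open>ntE\<close> converts between the two.\<close>
  define X where "X = ev e0 (lam 0 T0 (PC T1 ntE \<odot> (PC T1 p \<odot> (PC T1 g \<odot> PV T0 0))))"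
  have X: "X \<in> D T1" "\<And>n. n \<in> N \<Longrightarrow> X \<bullet> n = (if p \<bullet> (g \<bullet> n) = \<zero> then \<one> else \<zero>)"
    using p g unfolding X_def by simp_all
  have "is_bin X" using X by (simp add: is_bin_def)
  moreover have "X \<bullet> n = \<one> \<longleftrightarrow> (\<exists>f\<in>D T1. Y \<bullet> f \<bullet> n = \<zero>)" if n: "n \<in> N" for n
  proof -
    from Vg n obtain c where c: "is_bin c" "V \<bullet> c \<bullet> (g \<bullet> n) \<bullet> n = \<zero>" by blast
    have dc: "d \<bullet> c \<bullet> (g \<bullet> n) \<in> D T1" using c d g n by (simp add: is_bin_def)
    have "p \<bullet> (g \<bullet> n) = \<zero> \<and> Y \<bullet> (d \<bullet> c \<bullet> (g \<bullet> n)) \<bullet> n = \<zero>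
        \<or> p \<bullet> (g \<bullet> n) \<noteq> \<zero> \<and> Z \<bullet> (d \<bullet> c \<bullet> (g \<bullet> n)) \<bullet> n \<noteq> \<zero>"
      using c g n by (subst V[symmetric]) (auto simp: is_bin_def)
    \<comment> \<open>In the odd case the decoded function is a counterexample to the universal
      side, so by hypothesis the existential side fails.\<close>
    then show ?thesis using X(2)[OF n] YZ n dc by auto
  qed
  ultimately show "\<exists>X. is_bin X \<and> (\<forall>n\<in>N. X \<bullet> n = \<one> \<longleftrightarrow> (\<exists>f\<in>D T1. Y \<bullet> f \<bullet> n = \<zero>))" by blast
qed

end


section \<open>Provability from validity\<close>

lemma ext_in_closed_base: "ext_axiom \<rho> \<tau> \<in> closed_base"
  unfolding closed_base_def by blast

text \<open>T may be a schema with open axioms, to which \<open>completeness\<close> does not apply.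
  It is represented by sentences U derivable from it, and only models of \<open>closed_base\<close>
  and U have to be considered.\<close>

lemma provable_if_valid:
  assumes U: "\<And>B. B \<in> U \<Longrightarrow> RCA0_omega \<union> T; {} \<turnstile> B"
    and U_closed: "\<And>B. B \<in> U \<Longrightarrow> wf_fm B \<and> fv_below 0 B"
    and A: "wf_fm A"
    and valid: "\<And>(D :: ty \<Rightarrow> tm set set) ap I lt e. rca_model D ap I lt \<Longrightarrow>
      (\<And>B. B \<in> U \<Longrightarrow> applicative.sat D ap I lt e B) \<Longrightarrow> applicative.sat D ap I lt e A"
  shows "RCA0_omega \<union> T; {} \<turnstile> A"
proof (rule proves_theory)
  fix B assume "B \<in> closed_base \<union> U"
  moreover have "RCA0_omega \<union> T; {} \<turnstile> B" if "B \<in> closed_base"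
    using RCA0_omega_closed_base[OF that]
    by (rule proves_theory) (simp add: proves.Axiom)
  ultimately show "RCA0_omega \<union> T; {} \<turnstile> B" using U by blast
next
  show "closed_base \<union> U; {} \<turnstile> A"
  proof (rule completeness)
    fix D :: "ty \<Rightarrow> tm set set" and ap I lt e
    assume M: "extensional_model D ap I" and e: "applicative.wt_env D e"
      and sat: "\<And>B e. B \<in> closed_base \<union> U \<Longrightarrow> applicative.wt_env D e \<Longrightarrow>
        applicative.sat D ap I lt e B"
    interpret extensional_model D ap I lt by (rule M)
    have "rca_model D ap I lt" by unfold_locales (use sat in blast)
    then show "applicative.sat D ap I lt e A" using valid sat e by blast
  qed (use A U_closed closed_base_closed closed_base_wf ext_in_closed_base in auto)
qed

lemma wf_principles: "wf_fm NCC" "wf_fm BOOT" "wf_fm Delta_CA"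
  by (simp_all add: NCC_def NCC_matrix_def BOOT_def Delta_CA_def mem_def binary_def Let_def)

lemma closed_BOOT: "fv_below 0 BOOT"
  by (rule fv_below_0I, simp add: BOOT_def mem_def binary_def Let_def)

lemma choice_instance_01:
  "wf_fm (choice_instance T0 T1)" "fv_below 0 (choice_instance T0 T1)"
  "RCA0_omega \<union> QF_AC T0 T1; {} \<turnstile> choice_instance T0 T1"
proof -
  show wf: "wf_fm (choice_instance T0 T1)" by (simp add: choice_instance_def choice_axiom_def)
  show "fv_below 0 (choice_instance T0 T1)"
    by (rule fv_below_0I) (simp add: choice_instance_def choice_axiom_def)
  show "RCA0_omega \<union> QF_AC T0 T1; {} \<turnstile> choice_instance T0 T1"
    unfolding choice_instance_def
    by (rule proves_axiom_closure) (use wf in \<open>auto simp: choice_instance_def QF_AC_def\<close>)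
qed

theorem theorem3p1:
  shows "(RCA0_omega \<union> {BOOT}; {} \<turnstile> NCC)
       \<and> (RCA0_omega \<union> QF_AC T0 T1; {} \<turnstile> NCC)
       \<and> (RCA0_omega; {} \<turnstile> NCC \<^bold>\<longrightarrow> Delta_CA)"
proof (intro conjI)
  show "RCA0_omega \<union> {BOOT}; {} \<turnstile> NCC"
  proof (rule provable_if_valid[where U = "{BOOT}"])
    fix D :: "ty \<Rightarrow> tm set set" and ap I lt e
    assume "rca_model D ap I lt" and BOOT: "\<And>B. B \<in> {BOOT} \<Longrightarrow> applicative.sat D ap I lt e B"
    then interpret rca_model D ap I lt by simp
    show "sat e NCC" using BOOT BOOT_imp_NCC by (simp add: sat_NCC sat_BOOT)
  qed (auto simp: wf_principles closed_BOOT intro: proves.Axiom)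
  show "RCA0_omega \<union> QF_AC T0 T1; {} \<turnstile> NCC"
  proof (rule provable_if_valid[where U = "{choice_instance T0 T1}"])
    fix D :: "ty \<Rightarrow> tm set set" and ap I lt e
    assume "rca_model D ap I lt"
      and AC: "\<And>B. B \<in> {choice_instance T0 T1} \<Longrightarrow> applicative.sat D ap I lt e B"
    then interpret rca_model D ap I lt by simp
    have "sat e (choice_instance T0 T1)" using AC by simp
    from sat_choice_instance[OF this] show "sat e NCC"
      unfolding sat_NCC by (intro choice01_imp_NCC) simp_all
  qed (auto simp: wf_principles choice_instance_01)
  have "RCA0_omega \<union> {}; {} \<turnstile> NCC \<^bold>\<longrightarrow> Delta_CA"
  proof (rule provable_if_valid[where U = "{}"])
    fix D :: "ty \<Rightarrow> tm set set" and ap I lt e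
    assume "rca_model D ap I lt"
    then interpret rca_model D ap I lt .
    show "sat e (NCC \<^bold>\<longrightarrow> Delta_CA)" using NCC_imp_Delta_CA by (simp add: sat_NCC sat_Delta_CA)
  qed (auto simp: wf_principles)
  then show "RCA0_omega; {} \<turnstile> NCC \<^bold>\<longrightarrow> Delta_CA" by simp
qed

end
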